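(* Let $p\ge2$ be an integer, $\mathbb{P}=\{1,\ldots,p-1\}$, let $G$ be the Vilenkin group with dual group $G^*$, and let $\Omega=\{\Omega^{(u)}\}_{u\in\mathbb{P}}$ be a wavelet set of subsets of $G^*$. For each $u\in\mathbb{P}$ let $\psi^{(u)}\in L^2(G)$ be defined by $\widehat{\psi^{(u)}}=\mathbf{1}_{\Omega^{(u)}}$. Then $\{\psi^{(u)}\}_{u\in\mathbb{P}}$ is associated with an MRA of $L^2(G)$ if and only if $$\mu^*\left(\Omega_\Sigma\cap\left(\Omega_\Sigma\oplus n\right)\right)=\begin{cases}1&\text{if } n=\theta,\\ 0&\text{if } n\in\Lambda\setminus\{\theta\},\end{cases}$$ where $\theta=(\ldots,0,0,\ldots)$ is the identity element of $G^*$, $\Lambda$ is regarded as a subgroup of $G^*$, and $$\Omega_\Sigma=\bigcup_{u\in\mathbb{P}}\bigcup_{j=1}^{\infty}\sigma^j\left(\Omega^{(u)}\right).$$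
   Context: Let $p\ge2$ be a fixed integer. The Vilenkin group $G$ is the set of all sequences $x=(x_j)_{j\in\mathbb{Z}}$ with $x_j\in\{0,1,\ldots,p-1\}$ and $x_j=0$ for all $j<k_x$ for some integer $k_x$ depending on $x$. The group operation $\oplus$ is coordinatewise addition modulo $p$, and $\ominus$ is its inverse operation (subtraction). The maps $\rho,\sigma:G\to G$ are $(\rho(x))_j=x_{j+1}$ and $(\sigma(x))_j=x_{j-1}$; they are mutually inverse automorphisms. Let $U=\{x\in G: x_j=0\text{ for all }j\le 0\}$; the sets $x\oplus\rho^m(U)$, $x\in G$, $m\in\mathbb{Z}$, form a base of the topology of $G$, making $G$ a locally compact abelian group. The dual group $G^*$ consists of the same kind of sequences $\omega=(\omega_j)_{j\in\mathbb{Z}}$ with the same operation, topology and maps $\rho,\sigma$, and $U^*\subset G^*$ is defined in the same way as $U$. The pairing is $$\chi(x,\omega)=\exp\left(\frac{2\pi i}{p}\sum_{j\in\mathbb{Z}}x_j\omega_{1-j}\right),\qquad x\in G,\ \omega\in G^*.$$ $\mu$ and $\mu^*$ are the Haar measures on $G$ and $G^*$ normalized by $\mu(U)=1$ and $\mu^*(U^* )=1$. The Fourier transform of $f\in L^1(G)\cap L^2(G)$ is $\widehat f(\omega)=\int_G f(x)\overline{\chi(x,\omega)}\,d\mu(x)$, and the inverse Fourier transform of $f\in L^1(G^* )\cap L^2(G^* )$ is $f^\vee(x)=\int_{G^*}f(\omega)\chi(x,\omega)\,d\mu^*(\omega)$; both are extended to $L^2$ in the usual way. Let $\Lambda=\{x\in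 G: x_j=0\text{ for all }j>0\}$, a countable closed subgroup of $G$; the subgroup of $G^*$ defined in the same way is also denoted $\Lambda$. For $f\in L^2(G)$, $j\in\mathbb{Z}$, $n\in\Lambda$, set $f_{j,n}(x)=p^{j/2}f(\rho^j(x)\ominus n)$. For $E\subset G^*$ and $n\in\Lambda\subset G^*$, $E\oplus n=\{\omega\oplus n:\omega\in E\}$. Wavelet set: a set $\{\Omega^{(u)}\subset G^*:u\in\mathbb{P}\}$ of measurable subsets of $G^*$ is called a wavelet set if, with $\psi^{(u)}=(\mathbf{1}_{\Omega^{(u)}})^\vee$ (in particular $\mathbf{1}_{\Omega^{(u)}}\in L^2(G^* )$), the family $\{\psi^{(u)}_{j,n}\}_{j\in\mathbb{Z},n\in\Lambda,u\in\mathbb{P}}$ is an orthonormal basis of $L^2(G)$. MRA: a multiresolution analysis (MRA) of $L^2(G)$ is an increasing sequence $\{V_j\}_{j\in\mathbb{Z}}$ of closed subspaces of $L^2(G)$ such that (i) $\bigcup_jV_j$ is dense in $L^2(G)$ and $\bigcap_jV_j=\{0\}$; (ii) for each $j\in\mathbb{Z}$ and $f\in L^2(G)$, $f\in V_j$ if and only if $f(\rho\,\cdot)\in V_{j+1}$; (iii) for any $f\in L^2(G)$, $f\in V_0$ if and only if $f(\cdot\ominus n)\in V_0$ for any $n\in\Lambda$; (iv) there is $\phi\in L^2(G)$ (a scaling function) such that $\{\phi(\cdot\ominus n)\}_{n\in\Lambda}$ is a Riesz basis of $V_0$. $W_j$ denotes the orthogonal complement of $V_j$ in $V_{j+1}$.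 A family $\{\psi^{(u)}\}_{u\in\mathbb{P}}\subset L^2(G)$ is associated with an MRA if there are an MRA $\{V_j\}_{j\in\mathbb{Z}}$ and a scaling function $\phi$ of it such that, for every $j\in\mathbb{Z}$, $\{\phi_{j,n}\}_{n\in\Lambda}$ is an orthonormal basis of $V_j$ and $\{\psi^{(u)}_{j,n}\}_{n\in\Lambda,u\in\mathbb{P}}$ is an orthonormal basis of $W_j$. *)

theory Defs
  imports "HOL-Analysis.Analysis" "HOL-Library.Groups_Big_Fun"
begin

section \<open>The Vilenkin group\<close>

text \<open>
  The group and its dual consist of the same sequences, with the same operation and topology,
  so both are modelled by the carrier set \<open>vil p\<close> of two-sided digit sequences.
\<close>

type_synonym vseq = "int \<Rightarrow> int"

definition vil :: "int \<Rightarrow> vseq set" where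
  "vil p = {x. (\<forall>j. 0 \<le> x j \<and> x j < p) \<and> (\<exists>k. \<forall>j<k. x j = 0)}"

definition vil_add :: "int \<Rightarrow> vseq \<Rightarrow> vseq \<Rightarrow> vseq" where
  "vil_add p x y = (\<lambda>j. (x j + y j) mod p)"

definition vil_sub :: "int \<Rightarrow> vseq \<Rightarrow> vseq \<Rightarrow> vseq" where
  "vil_sub p x y = (\<lambda>j. (x j - y j) mod p)"

definition vil_zero :: vseq where
  "vil_zero = (\<lambda>j. 0)"

definition rho :: "vseq \<Rightarrow> vseq" where
  "rho x = (\<lambda>j. x (j + 1))"

definition sigma_shift :: "vseq \<Rightarrow> vseq" where
  "sigma_shift x = (\<lambda>j. x (j - 1))"

text \<open>The integer powers of \<open>rho\<close>; see the two lemmas below.\<close>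

definition rho_pow :: "int \<Rightarrow> vseq \<Rightarrow> vseq" where
  "rho_pow m x = (\<lambda>j. x (j + m))"

lemma rho_pow_of_nat: "rho_pow (int n) = rho ^^ n"
proof (induction n)
  case 0
  show ?case by (simp add: rho_pow_def fun_eq_iff)
next
  case (Suc n)
  have "rho_pow (int (Suc n)) x = rho (rho_pow (int n) x)" for x
    by (simp add: rho_pow_def rho_def algebra_simps)
  then show ?case by (simp add: Suc fun_eq_iff)
qed

lemma rho_pow_uminus_of_nat: "rho_pow (- int n) = sigma_shift ^^ n"
proof (induction n)
  case 0
  show ?case by (simp add: rho_pow_def fun_eq_iff)
next
  case (Suc n)
  have "rho_pow (- int (Suc n)) x = sigma_shift (rho_pow (- int n) x)" for x
    by (simp add: rho_pow_def sigma_shift_def algebra_simps)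
  then show ?case by (simp add: Suc fun_eq_iff)
qed

definition vil_U :: "int \<Rightarrow> vseq set" where
  "vil_U p = {x \<in> vil p. \<forall>j\<le>0. x j = 0}"

definition vil_Lambda :: "int \<Rightarrow> vseq set" where
  "vil_Lambda p = {x \<in> vil p. \<forall>j>0. x j = 0}"

definition vil_top :: "int \<Rightarrow> vseq topology" where
  "vil_top p =
     topology_generated_by {vil_add p x ` (rho_pow m ` vil_U p) | x m. x \<in> vil p}"

text \<open>
  Haar measure on the Borel sets, normalized by giving \<open>vil_U p\<close> mass 1. The group is second
  countable and locally compact, so regularity need not be required separately.
\<close>

definition vil_haar :: "int \<Rightarrow> vseq measure \<Rightarrow> bool" where
  "vil_haar p M \<longleftrightarrow>
     space M = vil p \<and>
     sets M = sigma_sets (vil p) {S. openin (vil_top p) S} \<and>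
     (\<forall>x\<in>vil p. \<forall>A\<in>sets M. emeasure M (vil_add p x ` A) = emeasure M A) \<and>
     (\<forall>K\<in>sets M. compactin (vil_top p) K \<longrightarrow> emeasure M K < \<infinity>) \<and>
     emeasure M (vil_U p) = 1"

text \<open>
  The sum over all integers has only finitely many nonzero terms for \<open>x\<close> and \<open>w\<close> in \<open>vil p\<close>.
\<close>

definition vil_chi :: "int \<Rightarrow> vseq \<Rightarrow> vseq \<Rightarrow> complex" where
  "vil_chi p x w =
     exp (2 * complex_of_real pi * \<i> / of_int p * of_int (Sum_any (\<lambda>j. x j * w (1 - j))))"


section \<open>Square-integrable functions\<close>

text \<open>
  Elements of \<open>L\<^sup>2\<close> are represented by functions, not by classes modulo null sets. Closed
  subspaces and closed spans as defined here are automatically saturated under equality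
  almost everywhere. The Bochner integral is 0 for non-integrable functions, so \<open>L2_norm\<close>
  is meaningful only on \<open>L2_space\<close>; all uses below are guarded by membership.
\<close>

definition L2_space :: "'a measure \<Rightarrow> ('a \<Rightarrow> complex) set" where
  "L2_space M = {f \<in> borel_measurable M. integrable M (\<lambda>x. (cmod (f x))\<^sup>2)}"

definition L2_inner :: "'a measure \<Rightarrow> ('a \<Rightarrow> complex) \<Rightarrow> ('a \<Rightarrow> complex) \<Rightarrow> complex" where
  "L2_inner M f g = (LINT x|M. f x * cnj (g x))"

definition L2_norm :: "'a measure \<Rightarrow> ('a \<Rightarrow> complex) \<Rightarrow> real" where
  "L2_norm M f = sqrt (LINT x|M. (cmod (f x))\<^sup>2)"

definition L2_tendsto :: "'a measure \<Rightarrow> (nat \<Rightarrow> 'a \<Rightarrow> complex) \<Rightarrow> ('a \<Rightarrow> complex) \<Rightarrow> bool" where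
  "L2_tendsto M F f \<longleftrightarrow>
     (\<forall>k. F k \<in> L2_space M) \<and> f \<in> L2_space M \<and>
     (\<lambda>k. L2_norm M (\<lambda>x. F k x - f x)) \<longlonglongrightarrow> 0"

definition L2_closed_subspace :: "'a measure \<Rightarrow> ('a \<Rightarrow> complex) set \<Rightarrow> bool" where
  "L2_closed_subspace M V \<longleftrightarrow>
     V \<subseteq> L2_space M \<and>
     (\<lambda>x. 0) \<in> V \<and>
     (\<forall>f\<in>V. \<forall>g\<in>V. (\<lambda>x. f x + g x) \<in> V) \<and>
     (\<forall>c. \<forall>f\<in>V. (\<lambda>x. c * f x) \<in> V) \<and>
     (\<forall>f\<in>L2_space M. (\<forall>e>0. \<exists>g\<in>V. L2_norm M (\<lambda>x. f x - g x) < e) \<longrightarrow> f \<in> V)"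

definition L2_closed_span ::
    "'a measure \<Rightarrow> 'i set \<Rightarrow> ('i \<Rightarrow> 'a \<Rightarrow> complex) \<Rightarrow> ('a \<Rightarrow> complex) set" where
  "L2_closed_span M I b =
     {f \<in> L2_space M. \<forall>e>0. \<exists>F c. finite F \<and> F \<subseteq> I \<and>
        L2_norm M (\<lambda>x. f x - (\<Sum>i\<in>F. c i * b i x)) < e}"

definition L2_onb ::
    "'a measure \<Rightarrow> 'i set \<Rightarrow> ('i \<Rightarrow> 'a \<Rightarrow> complex) \<Rightarrow> ('a \<Rightarrow> complex) set \<Rightarrow> bool" where
  "L2_onb M I b V \<longleftrightarrow>
     (\<forall>i\<in>I. b i \<in> L2_space M) \<and>
     (\<forall>i\<in>I. \<forall>k\<in>I. L2_inner M (b i) (b k) = (if i = k then 1 else 0)) \<and>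
     L2_closed_span M I b = V"

definition L2_riesz_basis ::
    "'a measure \<Rightarrow> 'i set \<Rightarrow> ('i \<Rightarrow> 'a \<Rightarrow> complex) \<Rightarrow> ('a \<Rightarrow> complex) set \<Rightarrow> bool" where
  "L2_riesz_basis M I b V \<longleftrightarrow>
     (\<forall>i\<in>I. b i \<in> L2_space M) \<and>
     L2_closed_span M I b = V \<and>
     (\<exists>A B. 0 < A \<and> A \<le> B \<and>
        (\<forall>F c. finite F \<and> F \<subseteq> I \<longrightarrow>
           A * (\<Sum>i\<in>F. (cmod (c i))\<^sup>2) \<le> (L2_norm M (\<lambda>x. \<Sum>i\<in>F. c i * b i x))\<^sup>2 \<and>
           (L2_norm M (\<lambda>x. \<Sum>i\<in>F. c i * b i x))\<^sup>2 \<le> B * (\<Sum>i\<in>F. (cmod (c i))\<^sup>2)))"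

text \<open>
  Extension by continuity to \<open>L\<^sup>2\<close> of an operator \<open>T\<close> given on \<open>L\<^sup>1 \<inter> L\<^sup>2\<close>. For the Fourier
  transforms the result does not depend, up to null sets, on the approximating sequence
  or on the chosen representative.
\<close>

definition L2_extension ::
    "'a measure \<Rightarrow> 'b measure \<Rightarrow> (('a \<Rightarrow> complex) \<Rightarrow> 'b \<Rightarrow> complex) \<Rightarrow>
     ('a \<Rightarrow> complex) \<Rightarrow> 'b \<Rightarrow> complex" where
  "L2_extension M N T f =
     (SOME g. \<exists>F. (\<forall>k. integrable M (F k)) \<and> L2_tendsto M F f \<and>
        L2_tendsto N (\<lambda>k. T (F k)) g)"


section \<open>Fourier transform\<close>

text \<open>From here on, \<open>M\<close> is the Haar measure on the group and \<open>N\<close> that on the dual group.\<close>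

definition vil_fourier :: "int \<Rightarrow> vseq measure \<Rightarrow> (vseq \<Rightarrow> complex) \<Rightarrow> vseq \<Rightarrow> complex" where
  "vil_fourier p M f w = (LINT x|M. f x * cnj (vil_chi p x w))"

definition vil_inv_fourier :: "int \<Rightarrow> vseq measure \<Rightarrow> (vseq \<Rightarrow> complex) \<Rightarrow> vseq \<Rightarrow> complex" where
  "vil_inv_fourier p N f x = (LINT w|N. f w * vil_chi p x w)"

definition vil_fourier_L2 ::
    "int \<Rightarrow> vseq measure \<Rightarrow> vseq measure \<Rightarrow> (vseq \<Rightarrow> complex) \<Rightarrow> vseq \<Rightarrow> complex" where
  "vil_fourier_L2 p M N = L2_extension M N (vil_fourier p M)"

definition vil_inv_fourier_L2 ::
    "int \<Rightarrow> vseq measure \<Rightarrow> vseq measure \<Rightarrow> (vseq \<Rightarrow> complex) \<Rightarrow> vseq \<Rightarrow> complex" where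
  "vil_inv_fourier_L2 p M N = L2_extension N M (vil_inv_fourier p N)"


section \<open>Wavelet sets and multiresolution analyses\<close>

definition vil_dil :: "int \<Rightarrow> int \<Rightarrow> vseq \<Rightarrow> (vseq \<Rightarrow> complex) \<Rightarrow> vseq \<Rightarrow> complex" where
  "vil_dil p j n f =
     (\<lambda>x. complex_of_real (real_of_int p powr (real_of_int j / 2)) *
          f (vil_sub p (rho_pow j x) n))"

definition wavelet_set ::
    "int \<Rightarrow> vseq measure \<Rightarrow> vseq measure \<Rightarrow> (int \<Rightarrow> vseq set) \<Rightarrow> bool" where
  "wavelet_set p M N \<Omega> \<longleftrightarrow>
     (\<forall>u\<in>{1..p-1}. \<Omega> u \<in> sets N \<and> indicator (\<Omega> u) \<in> L2_space N) \<and>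
     L2_onb M (UNIV \<times> vil_Lambda p \<times> {1..p-1})
       (\<lambda>(j, n, u). vil_dil p j n (vil_inv_fourier_L2 p M N (indicator (\<Omega> u))))
       (L2_space M)"

definition scaling_function ::
    "int \<Rightarrow> vseq measure \<Rightarrow> (int \<Rightarrow> (vseq \<Rightarrow> complex) set) \<Rightarrow> (vseq \<Rightarrow> complex) \<Rightarrow> bool" where
  "scaling_function p M V \<phi> \<longleftrightarrow>
     \<phi> \<in> L2_space M \<and>
     L2_riesz_basis M (vil_Lambda p) (\<lambda>n x. \<phi> (vil_sub p x n)) (V 0)"

text \<open>The intersection being \<open>{0}\<close> becomes: it consists of the functions vanishing a.e.\<close>

definition mra :: "int \<Rightarrow> vseq measure \<Rightarrow> (int \<Rightarrow> (vseq \<Rightarrow> complex) set) \<Rightarrow> bool" where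
  "mra p M V \<longleftrightarrow>
     (\<forall>j. L2_closed_subspace M (V j)) \<and>
     (\<forall>j. V j \<subseteq> V (j + 1)) \<and>
     (\<forall>f\<in>L2_space M. \<forall>e>0. \<exists>g\<in>(\<Union>j. V j). L2_norm M (\<lambda>x. f x - g x) < e) \<and>
     (\<Inter>j. V j) = {f \<in> L2_space M. AE x in M. f x = 0} \<and>
     (\<forall>j. \<forall>f\<in>L2_space M. f \<in> V j \<longleftrightarrow> (\<lambda>x. f (rho x)) \<in> V (j + 1)) \<and>
     (\<forall>f\<in>L2_space M. f \<in> V 0 \<longleftrightarrow> (\<forall>n\<in>vil_Lambda p. (\<lambda>x. f (vil_sub p x n)) \<in> V 0)) \<and>
     (\<exists>\<phi>. scaling_function p M V \<phi>)"

definition mra_W ::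
    "vseq measure \<Rightarrow> (int \<Rightarrow> (vseq \<Rightarrow> complex) set) \<Rightarrow> int \<Rightarrow> (vseq \<Rightarrow> complex) set" where
  "mra_W M V j = {f \<in> V (j + 1). \<forall>g\<in>V j. L2_inner M f g = 0}"

definition associated_with_mra ::
    "int \<Rightarrow> vseq measure \<Rightarrow> (int \<Rightarrow> vseq \<Rightarrow> complex) \<Rightarrow> bool" where
  "associated_with_mra p M \<psi> \<longleftrightarrow>
     (\<exists>V \<phi>. mra p M V \<and> scaling_function p M V \<phi> \<and>
        (\<forall>j. L2_onb M (vil_Lambda p) (\<lambda>n. vil_dil p j n \<phi>) (V j) \<and>
             L2_onb M (vil_Lambda p \<times> {1..p-1}) (\<lambda>(n, u). vil_dil p j n (\<psi> u)) (mra_W M V j)))"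

definition Omega_Sigma :: "int \<Rightarrow> (int \<Rightarrow> vseq set) \<Rightarrow> vseq set" where
  "Omega_Sigma p \<Omega> = (\<Union>u\<in>{1..p-1}. \<Union>j\<in>{1..}. (sigma_shift ^^ j) ` \<Omega> u)"

end

theory Submission
  imports Defs
begin

text \<open>
  A Haar measure is determined by its values on balls, so \<open>M = N\<close>, and by Plancherel everything can
  be read on the Fourier side. If the functions \<open>1\<^sub>E \<chi>\<^sub>n\<close>, \<open>n \<in> \<Lambda>\<close>, are orthonormal, then reduction
  modulo \<open>\<Lambda>\<close> maps \<open>E\<close> onto \<open>U\<close> in a measure preserving way (\<open>E\<close> is a tile), and then they are even an
  orthonormal basis of \<open>L\<^sup>2(E)\<close>. Hence every set \<open>\<Omega>\<^sup>u\<close> of a wavelet set is a tile, and the sets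
  \<open>\<rho>\<^sup>j(\<Omega>\<^sup>u)\<close> partition the dual group up to null sets. If the wavelets belong to an MRA, orthogonality of
  the spaces \<open>W\<^sub>j\<close> forces \<open>V\<^sub>0\<close> to consist of the functions with Fourier transform supported in
  \<open>\<Omega>\<^sub>\<Sigma>\<close>; comparing the Parseval identities for the basis \<open>\<phi>\<chi>\<^sub>n\<close> and for the characters of a coset of \<open>U\<close>
  shows that the transform of the scaling function has modulus \<open>1\<close> on \<open>\<Omega>\<^sub>\<Sigma>\<close>, so \<open>\<Omega>\<^sub>\<Sigma>\<close> is a tile.
  Conversely, if \<open>\<Omega>\<^sub>\<Sigma>\<close> is a tile, the functions with transform supported in \<open>\<rho>\<^sup>j(\<Omega>\<^sub>\<Sigma>)\<close> form an MRA.
  Being a tile is exactly the condition on the intersections with translates.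
\<close>

subsection \<open>Square-integrable functions\<close>

text \<open>Two obstacles shape the argument. Transforms of elements of \<open>L2_space\<close> are
  determined only up to null sets and are chosen by \<open>SOME\<close>, so the extended transform
  is handled as a relation \<open>fext\<close>, shown to be total, unique almost everywhere,
  invertible and isometric; spans and inner products are then moved across it. Completeness of
  exponentials is reached without infinite series: the indicator of a ball pulled back along
  reduction modulo \<open>vil_Lambda p\<close> is a finite average of characters
  (\<open>indicator_vfrac_vball\<close>), and a Dynkin argument passes from balls to all sets. The
  same average explains why orthonormality forces a tile: the image on \<open>vil_U p\<close> of
  Haar measure on E has the Fourier coefficients of Haar measure on \<open>vil_U p\<close>, hence
  agrees with it on balls. Null overlaps make the reduction measure preserving because injectivity
  bounds the image measure from above while the total mass is 1 on both sides. The modulus of the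
  scaling function can be read off because \<open>V 0\<close> corresponds to all functions supported
  in one set, so that indicators of arbitrary parts of a coset are available as test
  functions.\<close>

lemma L2_spaceD [dest]:
  assumes "f \<in> L2_space M"
  shows "f \<in> borel_measurable M" "integrable M (\<lambda>x. (cmod (f x))\<^sup>2)"
  using assms by (auto simp: L2_space_def)

lemma L2_space_bound:
  assumes "f \<in> borel_measurable M" "integrable M g" "AE x in M. (cmod (f x))\<^sup>2 \<le> g x"
  shows "f \<in> L2_space M"
proof -
  have "integrable M (\<lambda>x. (cmod (f x))\<^sup>2)"
    by (rule Bochner_Integration.integrable_bound[OF assms(2)])
       (use assms in \<open>auto elim!: eventually_mono\<close>)
  then show ?thesis using assms by (simp add: L2_space_def)
qed

lemma L2_space_cong_AE:
  assumes "f \<in> L2_space M" "g \<in> borel_measurable M" "AE x in M. f x = g x"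
  shows "g \<in> L2_space M"
  by (rule L2_space_bound[OF assms(2) L2_spaceD(2)[OF assms(1)]])
     (use assms(3) in \<open>auto elim!: eventually_mono\<close>)

lemma L2_zero [simp]: "(\<lambda>x. 0) \<in> L2_space M"
  by (simp add: L2_space_def)

lemma L2_scale [intro]:
  assumes "f \<in> L2_space M"
  shows "(\<lambda>x. c * f x) \<in> L2_space M"
proof -
  have "integrable M (\<lambda>x. (cmod c)\<^sup>2 * (cmod (f x))\<^sup>2)"
    using L2_spaceD(2)[OF assms] by simp
  then show ?thesis using L2_spaceD(1)[OF assms]
    by (auto simp: L2_space_def norm_mult power_mult_distrib)
qed

lemma L2_mult_bounded:
  assumes "f \<in> L2_space M" "h \<in> borel_measurable M" "\<And>x. x \<in> space M \<Longrightarrow> cmod (h x) \<le> 1"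
  shows "(\<lambda>x. f x * h x) \<in> L2_space M"
proof (rule L2_space_bound[OF _ L2_spaceD(2)[OF assms(1)]])
  show "(\<lambda>x. f x * h x) \<in> borel_measurable M" using L2_spaceD(1)[OF assms(1)] assms(2) by simp
  have "(cmod (f x * h x))\<^sup>2 \<le> (cmod (f x))\<^sup>2" if "x \<in> space M" for x
    using assms(3)[OF that] by (intro power_mono) (auto simp: norm_mult mult_left_le)
  then show "AE x in M. (cmod (f x * h x))\<^sup>2 \<le> (cmod (f x))\<^sup>2" by auto
qed

lemma norm_add_sq_le: "(cmod (a + b))\<^sup>2 \<le> 2 * (cmod a)\<^sup>2 + 2 * (cmod b)\<^sup>2"
proof -
  have "(cmod (a + b))\<^sup>2 \<le> (cmod a + cmod b)\<^sup>2" by (intro power_mono norm_triangle_ineq) auto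
  also have "\<dots> \<le> 2 * (cmod a)\<^sup>2 + 2 * (cmod b)\<^sup>2"
    using sum_squares_bound[of "cmod a" "cmod b"] by (simp add: power2_sum)
  finally show ?thesis .
qed

lemma L2_add [intro]:
  assumes "f \<in> L2_space M" "g \<in> L2_space M"
  shows "(\<lambda>x. f x + g x) \<in> L2_space M"
proof (rule L2_space_bound)
  show "(\<lambda>x. f x + g x) \<in> borel_measurable M"
    using L2_spaceD(1)[OF assms(1)] L2_spaceD(1)[OF assms(2)] by simp
  show "integrable M (\<lambda>x. 2 * (cmod (f x))\<^sup>2 + 2 * (cmod (g x))\<^sup>2)"
    using L2_spaceD(2)[OF assms(1)] L2_spaceD(2)[OF assms(2)] by simp
qed (simp add: norm_add_sq_le)

lemma L2_diff [intro]:
  assumes "f \<in> L2_space M" "g \<in> L2_space M"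
  shows "(\<lambda>x. f x - g x) \<in> L2_space M"
  using L2_add[OF assms(1) L2_scale[OF assms(2), of "-1"]] by simp

lemma L2_sum [intro]:
  assumes "\<And>i. i \<in> F \<Longrightarrow> b i \<in> L2_space M"
  shows "(\<lambda>x. \<Sum>i\<in>F. c i * b i x) \<in> L2_space M"
  using assms
proof (induction F rule: infinite_finite_induct)
  case (insert i F)
  then have "(\<lambda>x. c i * b i x + (\<Sum>i\<in>F. c i * b i x)) \<in> L2_space M"
    by (intro L2_add L2_scale) auto
  then show ?case using insert by simp
qed simp_all

lemma borel_measurable_cnj':
  assumes "f \<in> borel_measurable M"
  shows "(\<lambda>x. cnj (f x)) \<in> borel_measurable M"
  by (rule measurable_compose[OF assms]) (intro borel_measurable_continuous_onI continuous_intros)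

lemma cmod_indicator_sq: "(cmod (indicator A x))\<^sup>2 = (indicator A x :: real)"
  by (simp add: indicator_def)

lemma L2_indicator [intro]:
  assumes "A \<in> sets M" "emeasure M A < \<infinity>"
  shows "(indicator A :: _ \<Rightarrow> complex) \<in> L2_space M"
  unfolding L2_space_def
  using borel_measurable_indicator[OF assms(1)] integrable_real_indicator[OF assms]
  by (simp only: cmod_indicator_sq mem_Collect_eq simp_thms)

lemma integrable_indicator_complex:
  assumes "A \<in> sets M" "emeasure M A < \<infinity>"
  shows "integrable M (indicator A :: _ \<Rightarrow> complex)"
proof -
  have "integrable M (\<lambda>x. complex_of_real (indicator A x))"
    by (intro integrable_of_real integrable_real_indicator assms)
  moreover have "(\<lambda>x. complex_of_real (indicator A x)) = indicator A"
    by (simp add: fun_eq_iff indicator_def)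
  ultimately show ?thesis by simp
qed

lemma L2_indicator_emeasure:
  assumes "A \<in> sets M" "(indicator A :: _ \<Rightarrow> complex) \<in> L2_space M"
  shows "emeasure M A < \<infinity>"
proof -
  have "integrable M (indicator A :: _ \<Rightarrow> real)"
    using L2_spaceD(2)[OF assms(2)] by (simp only: cmod_indicator_sq)
  then have "emeasure M (A \<inter> space M) < \<infinity>" unfolding integrable_indicator_iff by blast
  moreover have "A \<inter> space M = A" using sets.sets_into_space[OF assms(1)] by blast
  ultimately show ?thesis by simp
qed

lemma L2_restrict [intro]:
  assumes "f \<in> L2_space M" "A \<in> sets M"
  shows "(\<lambda>x. f x * indicator A x) \<in> L2_space M"
proof (rule L2_mult_bounded[OF assms(1)])
  show "(\<lambda>x. indicator A x :: complex) \<in> borel_measurable M"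
    by (rule borel_measurable_indicator[OF assms(2)])
qed (simp add: indicator_def)

lemma integrable_L2_mult:
  assumes "f \<in> L2_space M" "g \<in> L2_space M"
  shows "integrable M (\<lambda>x. f x * cnj (g x))"
proof (rule Bochner_Integration.integrable_bound)
  show "integrable M (\<lambda>x. (cmod (f x))\<^sup>2 + (cmod (g x))\<^sup>2)"
    using L2_spaceD(2)[OF assms(1)] L2_spaceD(2)[OF assms(2)] by simp
  show "(\<lambda>x. f x * cnj (g x)) \<in> borel_measurable M"
    using L2_spaceD(1)[OF assms(1)] L2_spaceD(1)[OF assms(2)]
    by (intro borel_measurable_times borel_measurable_cnj')
  have "cmod (f x * cnj (g x)) \<le> norm ((cmod (f x))\<^sup>2 + (cmod (g x))\<^sup>2)" for x
  proof -
    have "0 \<le> cmod (f x) * cmod (g x)" by simp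
    then show ?thesis using sum_squares_bound[of "cmod (f x)" "cmod (g x)"]
      unfolding norm_mult complex_mod_cnj real_norm_def by linarith
  qed
  then show "AE x in M. cmod (f x * cnj (g x)) \<le> norm ((cmod (f x))\<^sup>2 + (cmod (g x))\<^sup>2)" by simp
qed

lemma L2_inner_add_left:
  assumes "f \<in> L2_space M" "g \<in> L2_space M" "h \<in> L2_space M"
  shows "L2_inner M (\<lambda>x. f x + g x) h = L2_inner M f h + L2_inner M g h"
  unfolding L2_inner_def
  by (simp add: distrib_right integrable_L2_mult[OF assms(1,3)] integrable_L2_mult[OF assms(2,3)])

lemma L2_inner_scale_left: "L2_inner M (\<lambda>x. c * f x) h = c * L2_inner M f h"
  unfolding L2_inner_def by (simp add: mult.assoc)

lemma L2_inner_cnj: "L2_inner M g f = cnj (L2_inner M f g)"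
proof -
  have "cnj (L2_inner M f g) = (LINT x|M. cnj (f x * cnj (g x)))"
    unfolding L2_inner_def by (rule Bochner_Integration.integral_cnj[symmetric])
  then show ?thesis by (simp add: L2_inner_def mult.commute)
qed

lemma L2_inner_scale_right: "L2_inner M h (\<lambda>x. c * f x) = cnj c * L2_inner M h f"
  by (metis L2_inner_cnj L2_inner_scale_left complex_cnj_mult)

lemma L2_inner_diff_left:
  assumes "f \<in> L2_space M" "g \<in> L2_space M" "h \<in> L2_space M"
  shows "L2_inner M (\<lambda>x. f x - g x) h = L2_inner M f h - L2_inner M g h"
  using L2_inner_add_left[OF assms(1) L2_scale[OF assms(2), of "-1"] assms(3)]
    L2_inner_scale_left[of M "-1" g h] by simp

lemma L2_inner_diff_right:
  assumes "f \<in> L2_space M" "g \<in> L2_space M" "h \<in> L2_space M"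
  shows "L2_inner M h (\<lambda>x. f x - g x) = L2_inner M h f - L2_inner M h g"
  using L2_inner_diff_left[OF assms] by (metis L2_inner_cnj complex_cnj_diff)

lemma L2_inner_sum_left:
  assumes "\<And>i. i \<in> F \<Longrightarrow> b i \<in> L2_space M" "h \<in> L2_space M"
  shows "L2_inner M (\<lambda>x. \<Sum>i\<in>F. c i * b i x) h = (\<Sum>i\<in>F. c i * L2_inner M (b i) h)"
  using assms
proof (induction F rule: infinite_finite_induct)
  case (insert i F)
  then have "L2_inner M (\<lambda>x. c i * b i x + (\<Sum>i\<in>F. c i * b i x)) h =
      L2_inner M (\<lambda>x. c i * b i x) h + L2_inner M (\<lambda>x. \<Sum>i\<in>F. c i * b i x) h"
    by (intro L2_inner_add_left) auto
  then show ?case using insert by (simp add: L2_inner_scale_left)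
qed (simp_all add: L2_inner_def)

lemma L2_inner_sum_right:
  assumes "\<And>i. i \<in> F \<Longrightarrow> b i \<in> L2_space M" "h \<in> L2_space M"
  shows "L2_inner M h (\<lambda>x. \<Sum>i\<in>F. c i * b i x) = (\<Sum>i\<in>F. cnj (c i) * L2_inner M h (b i))"
proof -
  have "cnj (L2_inner M (\<lambda>x. \<Sum>i\<in>F. c i * b i x) h) = (\<Sum>i\<in>F. cnj (c i) * cnj (L2_inner M (b i) h))"
    by (subst L2_inner_sum_left[OF assms]) auto
  then show ?thesis by (simp only: L2_inner_cnj[symmetric])
qed

lemma L2_norm_nonneg [simp]: "0 \<le> L2_norm M f"
  by (simp add: L2_norm_def)

lemma L2_norm_sq: "(L2_norm M f)\<^sup>2 = (LINT x|M. (cmod (f x))\<^sup>2)"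
  by (simp add: L2_norm_def)

lemma L2_inner_self: "L2_inner M f f = of_real ((L2_norm M f)\<^sup>2)"
proof -
  have "L2_inner M f f = (LINT x|M. complex_of_real ((cmod (f x))\<^sup>2))"
    unfolding L2_inner_def by (simp only: complex_norm_square)
  also have "\<dots> = complex_of_real (LINT x|M. (cmod (f x))\<^sup>2)"
    by (rule integral_complex_of_real)
  finally show ?thesis by (simp only: L2_norm_sq)
qed

lemma L2_norm_scale: "L2_norm M (\<lambda>x. c * f x) = cmod c * L2_norm M f"
  by (simp add: L2_norm_def norm_mult power_mult_distrib real_sqrt_mult)

lemma L2_norm_minus_commute: "L2_norm M (\<lambda>x. f x - g x) = L2_norm M (\<lambda>x. g x - f x)"
  by (simp add: L2_norm_def norm_minus_commute)

lemma L2_norm_zero [simp]: "L2_norm M (\<lambda>x. 0) = 0"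
  by (simp add: L2_norm_def)

lemma L2_norm_cong_AE:
  assumes "f \<in> borel_measurable M" "g \<in> borel_measurable M" "AE x in M. cmod (f x) = cmod (g x)"
  shows "L2_norm M f = L2_norm M g"
  unfolding L2_norm_def by (intro arg_cong[where f=sqrt] integral_cong_AE) (use assms in auto)

lemma L2_norm_eq_0_iff:
  assumes "f \<in> L2_space M"
  shows "L2_norm M f = 0 \<longleftrightarrow> (AE x in M. f x = 0)"
  using integral_nonneg_eq_0_iff_AE[OF L2_spaceD(2)[OF assms]] by (simp add: L2_norm_def)

lemma L2_inner_cong_AE:
  assumes "f \<in> borel_measurable M" "g \<in> borel_measurable M" "f' \<in> borel_measurable M" "g' \<in> borel_measurable M"
    and "AE x in M. f x * cnj (g x) = f' x * cnj (g' x)"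
  shows "L2_inner M f g = L2_inner M f' g'"
  unfolding L2_inner_def by (intro integral_cong_AE borel_measurable_times borel_measurable_cnj' assms)

lemma L2_inner_AE_zero:
  assumes "AE x in M. f x * cnj (g x) = 0"
  shows "L2_inner M f g = 0"
  unfolding L2_inner_def by (rule integral_eq_zero_AE[OF assms])

lemma L2_norm_diff_expand:
  assumes "f \<in> L2_space M" "g \<in> L2_space M"
  shows "(L2_norm M (\<lambda>x. f x - g x))\<^sup>2 = (L2_norm M f)\<^sup>2 + (L2_norm M g)\<^sup>2 - 2 * Re (L2_inner M f g)"
proof -
  have "complex_of_real ((L2_norm M (\<lambda>x. f x - g x))\<^sup>2) =
      L2_inner M f f - L2_inner M g f - (L2_inner M f g - L2_inner M g g)"
    unfolding L2_inner_self[symmetric] using assms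
    by (simp add: L2_inner_diff_left L2_inner_diff_right L2_diff)
  also have "\<dots> = of_real ((L2_norm M f)\<^sup>2 + (L2_norm M g)\<^sup>2 - 2 * Re (L2_inner M f g))"
    unfolding L2_inner_self L2_inner_cnj[of M g f] by (simp add: complex_eq_iff)
  finally show ?thesis using of_real_eq_iff by blast
qed

lemma L2_Cauchy_Schwarz:
  assumes "f \<in> L2_space M" "g \<in> L2_space M"
  shows "cmod (L2_inner M f g) \<le> L2_norm M f * L2_norm M g"
proof (cases "L2_norm M g = 0")
  case True
  then have "AE x in M. g x = 0" using L2_norm_eq_0_iff[OF assms(2)] by simp
  then have "L2_inner M f g = 0" by (intro L2_inner_AE_zero) (auto elim!: eventually_mono)
  then show ?thesis by simp
next
  case False
  define c where "c = L2_inner M f g / of_real ((L2_norm M g)\<^sup>2)"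
  have "0 \<le> (L2_norm M (\<lambda>x. f x - c * g x))\<^sup>2" by simp
  also have "\<dots> = (L2_norm M f)\<^sup>2 + (cmod c * L2_norm M g)\<^sup>2 - 2 * Re (cnj c * L2_inner M f g)"
    by (simp only: L2_norm_diff_expand[OF assms(1) L2_scale[OF assms(2)]] L2_norm_scale L2_inner_scale_right)
  also have "cnj c * L2_inner M f g = of_real ((cmod (L2_inner M f g))\<^sup>2 / (L2_norm M g)\<^sup>2)"
    unfolding c_def complex_cnj_divide complex_cnj_complex_of_real of_real_divide complex_norm_square
    by (simp add: mult.commute)
  also have "(cmod c * L2_norm M g)\<^sup>2 = (cmod (L2_inner M f g))\<^sup>2 / (L2_norm M g)\<^sup>2"
    using False by (simp add: c_def norm_divide norm_power norm_mult power_divide power_mult_distrib power2_eq_square)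
  finally have "(cmod (L2_inner M f g))\<^sup>2 / (L2_norm M g)\<^sup>2 \<le> (L2_norm M f)\<^sup>2" by simp
  then have "(cmod (L2_inner M f g))\<^sup>2 \<le> (L2_norm M f * L2_norm M g)\<^sup>2"
    using False by (simp add: divide_simps power_mult_distrib split: if_splits)
  then show ?thesis by (rule power2_le_imp_le) simp
qed

lemma L2_norm_triangle:
  assumes "f \<in> L2_space M" "g \<in> L2_space M"
  shows "L2_norm M (\<lambda>x. f x + g x) \<le> L2_norm M f + L2_norm M g"
proof (rule power2_le_imp_le)
  have g': "(\<lambda>x. - 1 * g x) \<in> L2_space M" using assms by blast
  have "(L2_norm M (\<lambda>x. f x + g x))\<^sup>2 =
      (L2_norm M f)\<^sup>2 + (L2_norm M g)\<^sup>2 + 2 * Re (L2_inner M f g)"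
    using L2_norm_diff_expand[OF assms(1) g'] L2_norm_scale[of M "-1" g] L2_inner_scale_right[of M f "-1" g]
    by simp
  also have "\<dots> \<le> (L2_norm M f + L2_norm M g)\<^sup>2"
    using L2_Cauchy_Schwarz[OF assms] complex_Re_le_cmod[of "L2_inner M f g"]
    by (simp add: power2_sum)
  finally show "(L2_norm M (\<lambda>x. f x + g x))\<^sup>2 \<le> (L2_norm M f + L2_norm M g)\<^sup>2" .
qed simp

lemma L2_norm_triangle_diff:
  assumes "f \<in> L2_space M" "g \<in> L2_space M" "h \<in> L2_space M"
  shows "L2_norm M (\<lambda>x. f x - h x) \<le> L2_norm M (\<lambda>x. f x - g x) + L2_norm M (\<lambda>x. g x - h x)"
  using L2_norm_triangle[OF L2_diff[OF assms(1,2)] L2_diff[OF assms(2,3)]] by simp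

lemma L2_inner_limit:
  assumes "L2_tendsto M F f" "g \<in> L2_space M"
  shows "(\<lambda>k. L2_inner M (F k) g) \<longlonglongrightarrow> L2_inner M f g"
proof -
  have F: "F k \<in> L2_space M" "f \<in> L2_space M" "(\<lambda>k. L2_norm M (\<lambda>x. F k x - f x)) \<longlonglongrightarrow> 0" for k
    using assms by (auto simp: L2_tendsto_def)
  have "(\<lambda>k. L2_inner M (F k) g - L2_inner M f g) \<longlonglongrightarrow> 0"
  proof (rule Lim_null_comparison)
    show "(\<lambda>k. L2_norm M (\<lambda>x. F k x - f x) * L2_norm M g) \<longlonglongrightarrow> 0"
      using tendsto_mult_right[OF F(3), of "L2_norm M g"] by simp
    show "\<forall>\<^sub>F k in sequentially. cmod (L2_inner M (F k) g - L2_inner M f g)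
        \<le> L2_norm M (\<lambda>x. F k x - f x) * L2_norm M g"
      using L2_Cauchy_Schwarz[OF L2_diff[OF F(1,2)] assms(2)] F assms
      by (simp add: L2_inner_diff_left)
  qed
  then show ?thesis by (rule LIM_zero_cancel)
qed

lemma L2_norm_diff_abs:
  assumes "f \<in> L2_space M" "g \<in> L2_space M"
  shows "\<bar>L2_norm M f - L2_norm M g\<bar> \<le> L2_norm M (\<lambda>x. f x - g x)"
  using L2_norm_triangle[OF L2_diff[OF assms] assms(2)] L2_norm_triangle[OF L2_diff[OF assms(2,1)] assms(1)]
  by (simp add: L2_norm_minus_commute[of M f g])

lemma L2_norm_limit:
  assumes "L2_tendsto M F f"
  shows "(\<lambda>k. L2_norm M (F k)) \<longlonglongrightarrow> L2_norm M f"
proof -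
  have F: "F k \<in> L2_space M" "f \<in> L2_space M" "(\<lambda>k. L2_norm M (\<lambda>x. F k x - f x)) \<longlonglongrightarrow> 0" for k
    using assms by (auto simp: L2_tendsto_def)
  have "(\<lambda>k. L2_norm M (F k) - L2_norm M f) \<longlonglongrightarrow> 0"
    by (rule Lim_null_comparison[OF _ F(3)]) (use L2_norm_diff_abs[OF F(1,2)] in simp)
  then show ?thesis by (rule LIM_zero_cancel)
qed

text \<open>The factor 2 is the one in the approximation of a measurable function by simple
  functions, where this lemma is applied; indicators and truncations satisfy the bound with room to
  spare.\<close>

lemma L2_dominated_convergence:
  assumes f: "f \<in> L2_space M" and F: "\<And>k. F k \<in> L2_space M"
    and lim: "AE x in M. (\<lambda>k. F k x) \<longlonglongrightarrow> f x"
    and bound: "\<And>k. AE x in M. cmod (F k x) \<le> 2 * cmod (f x)"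
  shows "L2_tendsto M F f"
proof -
  have m: "f \<in> borel_measurable M" "F k \<in> borel_measurable M" for k
    using L2_spaceD(1)[OF f] L2_spaceD(1)[OF F] by auto
  have "(\<lambda>k. LINT x|M. (cmod (F k x - f x))\<^sup>2) \<longlonglongrightarrow> (LINT x|M. 0)"
  \<comment> \<open>The terms are bounded by twice \<open>cmod (f x)\<close>, so their difference to
    the limit is bounded by three times it.\<close>
  proof (rule integral_dominated_convergence[where w="\<lambda>x. (3 * cmod (f x))\<^sup>2"])
    show "integrable M (\<lambda>x. (3 * cmod (f x))\<^sup>2)" using L2_spaceD(2)[OF f] by (simp add: power_mult_distrib)
    show "AE x in M. (\<lambda>k. (cmod (F k x - f x))\<^sup>2) \<longlonglongrightarrow> 0"
      using lim
    proof eventually_elim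
      case (elim x)
      then have "(\<lambda>k. cmod (F k x - f x)) \<longlonglongrightarrow> 0" by (simp add: LIM_zero tendsto_norm_zero)
      from tendsto_power[OF this, of 2] show ?case by simp
    qed
    show "AE x in M. norm ((cmod (F k x - f x))\<^sup>2) \<le> (3 * cmod (f x))\<^sup>2" for k
      using bound[of k]
    proof eventually_elim
      case (elim x)
      have "cmod (F k x - f x) \<le> 3 * cmod (f x)" using elim norm_triangle_ineq4[of "F k x" "f x"] by linarith
      then have "(cmod (F k x - f x))\<^sup>2 \<le> (3 * cmod (f x))\<^sup>2" by (intro power_mono) auto
      then show ?case by simp
    qed
  qed (use m in auto)
  then have "(\<lambda>k. sqrt (LINT x|M. (cmod (F k x - f x))\<^sup>2)) \<longlonglongrightarrow> sqrt 0"
    by (intro tendsto_real_sqrt) simp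
  then show ?thesis using f F by (simp add: L2_tendsto_def L2_norm_def)
qed

text \<open>Riesz-Fischer: a rapidly Cauchy subsequence converges almost everywhere, and Fatou
  upgrades the pointwise limit to a limit in norm of the whole sequence. It is needed to produce
  Fourier transforms as limits.\<close>

theorem L2_complete:
  assumes F: "\<And>k. F k \<in> L2_space M"
    and Cauchy: "\<And>e. e > 0 \<Longrightarrow> \<exists>K. \<forall>m\<ge>K. \<forall>n\<ge>K. L2_norm M (\<lambda>x. F m x - F n x) < e"
  obtains f where "L2_tendsto M F f"
proof -
  have [measurable]: "F k \<in> borel_measurable M" for k using F by auto
  have nn: "(\<integral>\<^sup>+x. ennreal ((cmod (F m x - F n x))\<^sup>2) \<partial>M) = ennreal ((L2_norm M (\<lambda>x. F m x - F n x))\<^sup>2)" for m n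
    unfolding L2_norm_sq
    by (rule nn_integral_eq_integral) (use L2_spaceD(2)[OF L2_diff[OF F F]] in auto)
  have "\<exists>K. \<forall>k. \<forall>m\<ge>K k. \<forall>n\<ge>K k. L2_norm M (\<lambda>x. F m x - F n x) < (1/4)^k"
    by (rule choice) (use Cauchy in simp)
  then obtain K where K: "\<And>k m n. m \<ge> K k \<Longrightarrow> n \<ge> K k \<Longrightarrow> L2_norm M (\<lambda>x. F m x - F n x) < (1/4)^k"
    by blast
  \<comment> \<open>Summing the thresholds makes the indices nondecreasing; the extra summand
    \<open>k\<close> makes them tend to infinity, so that far terms of the subsequence are far terms
    of the sequence.\<close>
  define r where "r = (\<lambda>k. k + (\<Sum>i\<le>k. K i))"
  have rK: "r k \<ge> K k" for k unfolding r_def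
    by (metis atMost_iff finite_atMost le_add2 member_le_sum order_refl order_trans zero_le)
  have rSuc: "r k \<le> r (Suc k)" for k by (simp add: r_def)
  have rk: "r k \<ge> k" for k by (simp add: r_def)
  \<comment> \<open>Weighted by \<open>4^k\<close>, squared distances below
    \<open>(1/4)^(2*k)\<close> still form a convergent geometric series, and boundedness of the
    weighted terms forces pointwise increments of order \<open>(1/2)^k\<close>.\<close>
  define d where "d = (\<lambda>k x. (cmod (F (r (Suc k)) x - F (r k) x))\<^sup>2)"
  have [measurable]: "d k \<in> borel_measurable M" for k by (simp add: d_def)
  have "(\<integral>\<^sup>+x. suminf (\<lambda>k. ennreal (4^k * d k x)) \<partial>M) = suminf (\<lambda>k. \<integral>\<^sup>+x. ennreal (4^k * d k x) \<partial>M)"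
    by (rule nn_integral_suminf) simp
  also have "\<dots> \<le> suminf (\<lambda>k. ennreal ((1/4)^k))"
  proof (intro suminf_le)
    fix k
    have "(\<integral>\<^sup>+x. ennreal (4^k * d k x) \<partial>M) = ennreal (4^k) * (\<integral>\<^sup>+x. ennreal (d k x) \<partial>M)"
      by (simp add: ennreal_mult nn_integral_cmult d_def)
    also have "\<dots> = ennreal (4^k * (L2_norm M (\<lambda>x. F (r (Suc k)) x - F (r k) x))\<^sup>2)"
      unfolding d_def nn by (simp add: ennreal_mult)
    also have "\<dots> \<le> ennreal (4^k * ((1/4)^k)\<^sup>2)"
    proof (intro ennreal_leI mult_left_mono power_mono)
      show "L2_norm M (\<lambda>x. F (r (Suc k)) x - F (r k) x) \<le> (1/4)^k"
        using K[of k "r (Suc k)" "r k"] rK[of k] rSuc[of k] by (simp add: less_imp_le)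
    qed auto
    also have "4^k * ((1/4)^k)\<^sup>2 = ((1/4::real)^k)"
      by (simp only: power2_eq_square power_mult_distrib[symmetric] mult.assoc[symmetric]) simp
    finally show "(\<integral>\<^sup>+x. ennreal (4^k * d k x) \<partial>M) \<le> ennreal ((1/4)^k)" .
  qed auto
  also have "\<dots> < \<infinity>"
  proof -
    have "suminf (\<lambda>k. ennreal ((1/4)^k)) = ennreal (suminf (\<lambda>k. (1/4)^k))"
      by (rule suminf_ennreal2) (auto intro: summable_geometric)
    then show ?thesis by simp
  qed
  finally have "AE x in M. suminf (\<lambda>k. ennreal (4^k * d k x)) \<noteq> \<infinity>"
    by (intro nn_integral_PInf_AE) auto
  then have conv: "AE x in M. convergent (\<lambda>k. F (r k) x)"
  proof eventually_elim
    case (elim x)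
    then have "summable (\<lambda>k. 4^k * d k x)"
      by (intro summable_suminf_not_top) (auto simp: d_def)
    then have "(\<lambda>k. 4^k * d k x) \<longlonglongrightarrow> 0" by (rule summable_LIMSEQ_zero)
    then have "Bseq (\<lambda>k. 4^k * d k x)" by (metis convergentI convergent_imp_Bseq)
    then obtain C where C: "C > 0" "\<And>k. norm (4^k * d k x) \<le> C" by (auto elim: BseqE)
    have "norm (F (r (Suc k)) x - F (r k) x) \<le> sqrt C * (1/2)^k" for k
    proof (rule power2_le_imp_le)
      have "4^k * d k x \<le> C" using C(2)[of k] by (simp add: d_def)
      then have "d k x \<le> C / 4^k" by (simp add: pos_le_divide_eq mult.commute)
      also have "C / 4^k = (sqrt C * (1/2)^k)\<^sup>2"
      proof -
        have "((1/2::real)^k)\<^sup>2 = (1/4)^k"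
          by (simp only: power2_eq_square power_mult_distrib[symmetric]) simp
        then have "(sqrt C * (1/2)^k)\<^sup>2 = C * (1/4)^k"
          using C(1) by (simp only: power_mult_distrib real_sqrt_pow2 less_imp_le)
        then show ?thesis by (simp add: power_one_over)
      qed
      finally show "(norm (F (r (Suc k)) x - F (r k) x))\<^sup>2 \<le> (sqrt C * (1/2)^k)\<^sup>2" by (simp add: d_def)
    qed (use C in simp)
    moreover have "summable (\<lambda>k. sqrt C * (1/2)^k)"
      by (rule summable_mult[OF summable_geometric]) simp
    ultimately have "summable (\<lambda>k. F (r (Suc k)) x - F (r k) x)"
      by (blast intro: summable_comparison_test')
    then have "convergent (\<lambda>n. \<Sum>k<n. F (r (Suc k)) x - F (r k) x)"
      by (simp add: summable_iff_convergent)
    moreover have "(\<Sum>k<n. F (r (Suc k)) x - F (r k) x) = F (r n) x - F (r 0) x" for n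
      by (rule sum_lessThan_telescope)
    ultimately have "convergent (\<lambda>n. F (r n) x - F (r 0) x)" by (simp only:)
    then have "convergent (\<lambda>n. (F (r n) x - F (r 0) x) + F (r 0) x)"
      by (intro convergent_add convergent_const)
    then show ?case by simp
  qed
  define f where "f = (\<lambda>x. lim (\<lambda>k. F (r k) x))"
  have fm [measurable]: "f \<in> borel_measurable M" unfolding f_def by measurable
  have lim: "AE x in M. (\<lambda>k. F (r k) x) \<longlonglongrightarrow> f x"
    using conv by eventually_elim (simp add: f_def convergent_LIMSEQ_iff)
  \<comment> \<open>The index \<open>n\<close> stays fixed while the other one runs along the
    subsequence; this gives both that \<open>F n - f\<close> is square-integrable and the size of
    its norm.\<close>
  have Fatou: "(\<integral>\<^sup>+x. ennreal ((cmod (F n x - f x))\<^sup>2) \<partial>M) \<le> ennreal (e\<^sup>2)"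
    if "\<And>m. m \<ge> L \<Longrightarrow> L2_norm M (\<lambda>x. F n x - F m x) < e" for n L e
  proof -
    have "(\<integral>\<^sup>+x. ennreal ((cmod (F n x - f x))\<^sup>2) \<partial>M) =
        (\<integral>\<^sup>+x. liminf (\<lambda>k. ennreal ((cmod (F n x - F (r k) x))\<^sup>2)) \<partial>M)"
    proof (rule nn_integral_cong_AE)
      show "AE x in M. ennreal ((cmod (F n x - f x))\<^sup>2) = liminf (\<lambda>k. ennreal ((cmod (F n x - F (r k) x))\<^sup>2))"
        using lim
      proof eventually_elim
        case (elim x)
        then have "(\<lambda>k. ennreal ((cmod (F n x - F (r k) x))\<^sup>2)) \<longlonglongrightarrow> ennreal ((cmod (F n x - f x))\<^sup>2)"
          by (intro tendsto_ennrealI tendsto_power tendsto_norm tendsto_diff tendsto_const)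
        then show ?case by (metis lim_imp_Liminf trivial_limit_sequentially)
      qed
    qed
    also have "\<dots> \<le> liminf (\<lambda>k. \<integral>\<^sup>+x. ennreal ((cmod (F n x - F (r k) x))\<^sup>2) \<partial>M)"
      by (rule nn_integral_liminf) simp
    also have "\<dots> = liminf (\<lambda>k. ennreal ((L2_norm M (\<lambda>x. F n x - F (r k) x))\<^sup>2))"
      by (simp only: nn)
    also have "\<dots> \<le> ennreal (e\<^sup>2)"
    proof (rule Liminf_le)
      have "ennreal ((L2_norm M (\<lambda>x. F n x - F (r k) x))\<^sup>2) \<le> ennreal (e\<^sup>2)" if "k \<ge> L" for k
        using \<open>\<And>m. m \<ge> L \<Longrightarrow> L2_norm M (\<lambda>x. F n x - F m x) < e\<close>[of "r k"] rk[of k] that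
        by (intro ennreal_leI power_mono) auto
      then show "\<forall>\<^sub>F k in sequentially. ennreal ((L2_norm M (\<lambda>x. F n x - F (r k) x))\<^sup>2) \<le> ennreal (e\<^sup>2)"
        by (auto simp: eventually_sequentially)
    qed auto
    finally show ?thesis .
  qed
  have est: "\<exists>L. \<forall>n\<ge>L. (\<lambda>x. F n x - f x) \<in> L2_space M \<and> L2_norm M (\<lambda>x. F n x - f x) \<le> e" if "e > 0" for e
  proof -
    obtain L where L: "\<And>m n. m \<ge> L \<Longrightarrow> n \<ge> L \<Longrightarrow> L2_norm M (\<lambda>x. F m x - F n x) < e"
      using Cauchy[OF \<open>e > 0\<close>] by blast
    have "(\<lambda>x. F n x - f x) \<in> L2_space M \<and> L2_norm M (\<lambda>x. F n x - f x) \<le> e" if "n \<ge> L" for n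
    proof -
      have le: "(\<integral>\<^sup>+x. ennreal ((cmod (F n x - f x))\<^sup>2) \<partial>M) \<le> ennreal (e\<^sup>2)"
        by (rule Fatou[where L=L]) (use L that in auto)
      then have i: "integrable M (\<lambda>x. (cmod (F n x - f x))\<^sup>2)"
        by (intro integrableI_bounded) (auto simp: le_less_trans[OF le])
      have "ennreal ((L2_norm M (\<lambda>x. F n x - f x))\<^sup>2) \<le> ennreal (e\<^sup>2)"
        unfolding L2_norm_sq using le nn_integral_eq_integral[OF i] by simp
      then have "(L2_norm M (\<lambda>x. F n x - f x))\<^sup>2 \<le> e\<^sup>2" by simp
      then show ?thesis using i \<open>e > 0\<close> by (auto simp: L2_space_def intro: power2_le_imp_le)
    qed
    then show ?thesis by blast
  qed
  obtain L where "(\<lambda>x. F L x - f x) \<in> L2_space M" using est[of 1] by auto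
  from L2_diff[OF F[of L] this] have fL: "f \<in> L2_space M" by simp
  have "(\<lambda>k. L2_norm M (\<lambda>x. F k x - f x)) \<longlonglongrightarrow> 0"
  proof (rule LIMSEQ_I)
    fix e :: real assume "e > 0"
    then obtain L where "\<forall>n\<ge>L. L2_norm M (\<lambda>x. F n x - f x) \<le> e/2" using est[of "e/2"] by auto
    then show "\<exists>L. \<forall>n\<ge>L. norm (L2_norm M (\<lambda>x. F n x - f x) - 0) < e"
      using \<open>e > 0\<close> by (intro exI[of _ L]) fastforce
  qed
  then show ?thesis using that[of f] F fL by (simp add: L2_tendsto_def)
qed

subsection \<open>Closed subspaces and orthonormal families\<close>

lemma L2_closed_spanI:
  assumes "f \<in> L2_space M"
    and "\<And>e. e > 0 \<Longrightarrow> \<exists>F c. finite F \<and> F \<subseteq> I \<and> L2_norm M (\<lambda>x. f x - (\<Sum>i\<in>F. c i * b i x)) < e"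
  shows "f \<in> L2_closed_span M I b"
  using assms by (auto simp: L2_closed_span_def)

lemma L2_closed_spanE:
  assumes "f \<in> L2_closed_span M I b" "e > 0"
  obtains F c where "finite F" "F \<subseteq> I" "L2_norm M (\<lambda>x. f x - (\<Sum>i\<in>F. c i * b i x)) < e"
  using assms by (auto simp: L2_closed_span_def)

lemma L2_closed_span_space: "f \<in> L2_closed_span M I b \<Longrightarrow> f \<in> L2_space M"
  by (simp add: L2_closed_span_def)

lemma L2_closed_span_add:
  assumes b: "\<And>i. i \<in> I \<Longrightarrow> b i \<in> L2_space M"
    and f: "f \<in> L2_closed_span M I b" and g: "g \<in> L2_closed_span M I b"
  shows "(\<lambda>x. f x + g x) \<in> L2_closed_span M I b"
proof (rule L2_closed_spanI)
  have fg: "f \<in> L2_space M" "g \<in> L2_space M" using f g by (auto intro: L2_closed_span_space)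
  then show "(\<lambda>x. f x + g x) \<in> L2_space M" by blast
  fix e :: real assume "e > 0"
  then have e2: "e/2 > 0" by simp
  obtain F c where F: "finite F" "F \<subseteq> I" "L2_norm M (\<lambda>x. f x - (\<Sum>i\<in>F. c i * b i x)) < e/2"
    using L2_closed_spanE[OF f e2] .
  obtain G d where G: "finite G" "G \<subseteq> I" "L2_norm M (\<lambda>x. g x - (\<Sum>i\<in>G. d i * b i x)) < e/2"
    using L2_closed_spanE[OF g e2] .
  define c' where "c' = (\<lambda>i. if i \<in> F then c i else 0)"
  define d' where "d' = (\<lambda>i. if i \<in> G then d i else 0)"
  have c: "(\<Sum>i\<in>F \<union> G. c' i * b i x) = (\<Sum>i\<in>F. c i * b i x)" for x
    by (rule sum.mono_neutral_cong_right) (use F G in \<open>auto simp: c'_def\<close>)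
  have d: "(\<Sum>i\<in>F \<union> G. d' i * b i x) = (\<Sum>i\<in>G. d i * b i x)" for x
    by (rule sum.mono_neutral_cong_right) (use F G in \<open>auto simp: d'_def\<close>)
  have s: "(\<lambda>x. \<Sum>i\<in>F. c i * b i x) \<in> L2_space M" "(\<lambda>x. \<Sum>i\<in>G. d i * b i x) \<in> L2_space M"
    by (rule L2_sum, rule b, use F G in blast)+
  have "L2_norm M (\<lambda>x. f x + g x - (\<Sum>i\<in>F \<union> G. (c' i + d' i) * b i x)) =
      L2_norm M (\<lambda>x. (f x - (\<Sum>i\<in>F. c i * b i x)) + (g x - (\<Sum>i\<in>G. d i * b i x)))"
    by (rule arg_cong[where f="L2_norm M"], rule ext) (simp add: distrib_right sum.distrib c d)
  also have "\<dots> \<le> L2_norm M (\<lambda>x. f x - (\<Sum>i\<in>F. c i * b i x)) + L2_norm M (\<lambda>x. g x - (\<Sum>i\<in>G. d i * b i x))"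
    by (rule L2_norm_triangle[OF L2_diff[OF fg(1) s(1)] L2_diff[OF fg(2) s(2)]])
  also have "\<dots> < e" using F G by simp
  finally show "\<exists>F c. finite F \<and> F \<subseteq> I \<and> L2_norm M (\<lambda>x. f x + g x - (\<Sum>i\<in>F. c i * b i x)) < e"
    using F G by (intro exI[of _ "F \<union> G"] exI[of _ "\<lambda>i. c' i + d' i"]) auto
qed

lemma L2_closed_span_scale:
  assumes f: "f \<in> L2_closed_span M I b"
  shows "(\<lambda>x. c * f x) \<in> L2_closed_span M I b"
proof (rule L2_closed_spanI)
  show "(\<lambda>x. c * f x) \<in> L2_space M" using L2_closed_span_space[OF f] by blast
  fix e :: real assume "e > 0"
  \<comment> \<open>Dividing by \<open>cmod c + 1\<close> instead of \<open>cmod c\<close> avoids a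
    case distinction for \<open>c = 0\<close>.\<close>
  then have e': "e / (cmod c + 1) > 0" by (simp add: add_nonneg_pos)
  obtain F d where F: "finite F" "F \<subseteq> I"
    "L2_norm M (\<lambda>x. f x - (\<Sum>i\<in>F. d i * b i x)) < e / (cmod c + 1)"
    using L2_closed_spanE[OF f e'] .
  have pos: "0 < cmod c + 1" by (simp add: add_nonneg_pos)
  have "L2_norm M (\<lambda>x. c * f x - (\<Sum>i\<in>F. (c * d i) * b i x)) =
      L2_norm M (\<lambda>x. c * (f x - (\<Sum>i\<in>F. d i * b i x)))"
    by (rule arg_cong[where f="L2_norm M"], rule ext) (simp add: right_diff_distrib sum_distrib_left mult.assoc)
  also have "\<dots> \<le> (cmod c + 1) * L2_norm M (\<lambda>x. f x - (\<Sum>i\<in>F. d i * b i x))"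
    by (simp add: L2_norm_scale distrib_right)
  also have "\<dots> < e" using F(3) pos by (simp add: pos_less_divide_eq mult.commute)
  finally show "\<exists>F d. finite F \<and> F \<subseteq> I \<and> L2_norm M (\<lambda>x. c * f x - (\<Sum>i\<in>F. d i * b i x)) < e"
    using F by (intro exI[of _ F] exI[of _ "\<lambda>i. c * d i"]) auto
qed

lemma L2_closed_subspace_closed_span:
  assumes b: "\<And>i. i \<in> I \<Longrightarrow> b i \<in> L2_space M"
  shows "L2_closed_subspace M (L2_closed_span M I b)"
  unfolding L2_closed_subspace_def
proof (intro conjI ballI allI impI)
  show "L2_closed_span M I b \<subseteq> L2_space M" using L2_closed_span_space by blast
  show "(\<lambda>x. 0) \<in> L2_closed_span M I b"
    by (rule L2_closed_spanI) (auto intro!: exI[of _ "{}"])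
  fix f assume f: "f \<in> L2_space M" and ap: "\<forall>e>0. \<exists>g\<in>L2_closed_span M I b. L2_norm M (\<lambda>x. f x - g x) < e"
  show "f \<in> L2_closed_span M I b"
  proof (rule L2_closed_spanI[OF f])
    fix e :: real assume "e > 0"
    then obtain g where g: "g \<in> L2_closed_span M I b" "L2_norm M (\<lambda>x. f x - g x) < e/2"
      using ap half_gt_zero by blast
    have e2: "e/2 > 0" using \<open>e > 0\<close> by simp
    obtain F c where F: "finite F" "F \<subseteq> I" "L2_norm M (\<lambda>x. g x - (\<Sum>i\<in>F. c i * b i x)) < e/2"
      using L2_closed_spanE[OF g(1) e2] .
    have s: "(\<lambda>x. \<Sum>i\<in>F. c i * b i x) \<in> L2_space M" by (rule L2_sum, rule b, use F in blast)
    have "L2_norm M (\<lambda>x. f x - (\<Sum>i\<in>F. c i * b i x)) < e"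
      using L2_norm_triangle_diff[OF f L2_closed_span_space[OF g(1)] s] g F by linarith
    then show "\<exists>F c. finite F \<and> F \<subseteq> I \<and> L2_norm M (\<lambda>x. f x - (\<Sum>i\<in>F. c i * b i x)) < e"
      using F by blast
  qed
qed (simp_all add: L2_closed_span_add[OF b] L2_closed_span_scale)

lemma L2_closed_span_base:
  assumes "b i \<in> L2_space M" "i \<in> I"
  shows "b i \<in> L2_closed_span M I b"
proof (rule L2_closed_spanI[OF assms(1)])
  fix e :: real assume "e > 0"
  then show "\<exists>F c. finite F \<and> F \<subseteq> I \<and> L2_norm M (\<lambda>x. b i x - (\<Sum>i\<in>F. c i * b i x)) < e"
    using assms(2) by (intro exI[of _ "{i}"] exI[of _ "\<lambda>_. 1"]) auto
qed

lemma L2_closed_subspaceD: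
  assumes "L2_closed_subspace M V"
  shows "f \<in> V \<Longrightarrow> f \<in> L2_space M"
    and "(\<lambda>x. 0) \<in> V"
    and "f \<in> V \<Longrightarrow> g \<in> V \<Longrightarrow> (\<lambda>x. f x + g x) \<in> V"
    and "f \<in> V \<Longrightarrow> (\<lambda>x. c * f x) \<in> V"
    and "f \<in> L2_space M \<Longrightarrow> (\<And>e. e > 0 \<Longrightarrow> \<exists>g\<in>V. L2_norm M (\<lambda>x. f x - g x) < e) \<Longrightarrow> f \<in> V"
  using assms by (auto simp: L2_closed_subspace_def)

lemma L2_closed_subspace_diff:
  assumes "L2_closed_subspace M V" "f \<in> V" "g \<in> V"
  shows "(\<lambda>x. f x - g x) \<in> V"
  using L2_closed_subspaceD(3)[OF assms(1,2) L2_closed_subspaceD(4)[OF assms(1,3), of "-1"]] by simp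

lemma L2_closed_subspace_sum:
  assumes V: "L2_closed_subspace M V" and "\<And>i. i \<in> F \<Longrightarrow> b i \<in> V"
  shows "(\<lambda>x. \<Sum>i\<in>F. c i * b i x) \<in> V"
  using assms(2)
proof (induction F rule: infinite_finite_induct)
  case (insert i F)
  then have "(\<lambda>x. c i * b i x + (\<Sum>i\<in>F. c i * b i x)) \<in> V"
    by (intro L2_closed_subspaceD(3,4)[OF V]) simp_all
  then show ?case using insert by simp
qed (simp_all add: L2_closed_subspaceD(2)[OF V])

text \<open>Properties pass from generators to their closed span by presenting the property as a
  closed subspace; most inclusions of spans below are instances.\<close>

lemma L2_closed_span_minimal:
  assumes V: "L2_closed_subspace M V" and b: "\<And>i. i \<in> I \<Longrightarrow> b i \<in> V"
  shows "L2_closed_span M I b \<subseteq> V"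
proof
  fix f assume f: "f \<in> L2_closed_span M I b"
  have "\<exists>g\<in>V. L2_norm M (\<lambda>x. f x - g x) < e" if "e > 0" for e
  proof -
    obtain F c where F: "finite F" "F \<subseteq> I" "L2_norm M (\<lambda>x. f x - (\<Sum>i\<in>F. c i * b i x)) < e"
      using L2_closed_spanE[OF f \<open>e > 0\<close>] .
    have "(\<lambda>x. \<Sum>i\<in>F. c i * b i x) \<in> V"
      by (rule L2_closed_subspace_sum[OF V]) (use F b in blast)
    then show ?thesis using F(3) by (intro bexI[where x="\<lambda>x. \<Sum>i\<in>F. c i * b i x"])
  qed
  then show "f \<in> V" by (rule L2_closed_subspaceD(5)[OF V L2_closed_span_space[OF f]])
qed

lemma L2_closed_subspace_limit:
  assumes V: "L2_closed_subspace M V" and F: "\<And>k. F k \<in> V" and lim: "L2_tendsto M F f"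
  shows "f \<in> V"
proof -
  have l: "(\<lambda>k. L2_norm M (\<lambda>x. f x - F k x)) \<longlonglongrightarrow> 0" "f \<in> L2_space M"
    using lim by (simp_all add: L2_tendsto_def L2_norm_minus_commute[of M f])
  have "\<exists>g\<in>V. L2_norm M (\<lambda>x. f x - g x) < e" if "e > 0" for e
    using LIMSEQ_D[OF l(1) that] F by auto
  then show ?thesis by (rule L2_closed_subspaceD(5)[OF V l(2)])
qed

text \<open>This is how saturation under equality almost everywhere is used: \<open>g\<close> has
  distance 0 from \<open>f\<close>, and \<open>V\<close> is closed.\<close>

lemma L2_closed_subspace_cong_AE:
  assumes V: "L2_closed_subspace M V" and f: "f \<in> V" and g: "g \<in> borel_measurable M"
    and eq: "AE x in M. f x = g x"
  shows "g \<in> V"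
proof -
  have fM: "f \<in> L2_space M" using V f by (rule L2_closed_subspaceD(1))
  have gM: "g \<in> L2_space M" using L2_space_cong_AE[OF fM g eq] .
  have "L2_norm M (\<lambda>x. g x - f x) = 0"
    unfolding L2_norm_eq_0_iff[OF L2_diff[OF gM fM]] using eq by (auto elim!: eventually_mono)
  then have "\<exists>f\<in>V. L2_norm M (\<lambda>x. g x - f x) < e" if "e > 0" for e
    using that by (intro bexI[OF _ f]) simp
  then show ?thesis by (rule L2_closed_subspaceD(5)[OF V gM])
qed

lemma L2_closed_subspace_orthogonal:
  assumes "S \<subseteq> L2_space M"
  shows "L2_closed_subspace M {f \<in> L2_space M. \<forall>g\<in>S. L2_inner M f g = 0}"
  unfolding L2_closed_subspace_def
proof (intro conjI ballI allI impI)
  fix f assume f: "f \<in> L2_space M"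
    and ap: "\<forall>e>0. \<exists>g\<in>{f \<in> L2_space M. \<forall>g\<in>S. L2_inner M f g = 0}. L2_norm M (\<lambda>x. f x - g x) < e"
  have "L2_inner M f g = 0" if g: "g \<in> S" for g
  proof (rule ccontr)
    assume n: "L2_inner M f g \<noteq> 0"
    \<comment> \<open>Chosen so that Cauchy-Schwarz at a distance below \<open>e\<close> contradicts
      the size of the inner product; the \<open>+ 1\<close> covers
      \<open>L2_norm M g = 0\<close>.\<close>
    define e where "e = cmod (L2_inner M f g) / (L2_norm M g + 1)"
    have pos: "L2_norm M g + 1 > 0" by (simp add: add_nonneg_pos)
    then have "e > 0" using n by (simp add: e_def)
    then obtain h where h: "h \<in> L2_space M" "L2_inner M h g = 0" "L2_norm M (\<lambda>x. f x - h x) < e"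
      using ap g by blast
    have gM: "g \<in> L2_space M" using g assms by blast
    have "cmod (L2_inner M f g) = cmod (L2_inner M (\<lambda>x. f x - h x) g)"
      using h by (simp add: L2_inner_diff_left[OF f h(1) gM])
    also have "\<dots> \<le> L2_norm M (\<lambda>x. f x - h x) * L2_norm M g"
      by (rule L2_Cauchy_Schwarz[OF L2_diff[OF f h(1)] gM])
    also have "\<dots> \<le> L2_norm M (\<lambda>x. f x - h x) * (L2_norm M g + 1)"
      by (intro mult_left_mono) auto
    also have "\<dots> < e * (L2_norm M g + 1)" using h pos by (intro mult_strict_right_mono) auto
    also have "\<dots> = cmod (L2_inner M f g)" using pos by (simp add: e_def)
    finally show False by simp
  qed
  then show "f \<in> {f \<in> L2_space M. \<forall>g\<in>S. L2_inner M f g = 0}" using f by blast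
next
  fix f g assume fg: "f \<in> {f \<in> L2_space M. \<forall>g\<in>S. L2_inner M f g = 0}" "g \<in> {f \<in> L2_space M. \<forall>g\<in>S. L2_inner M f g = 0}"
  have "L2_inner M (\<lambda>x. f x + g x) h = 0" if "h \<in> S" for h
    using fg that assms by (subst L2_inner_add_left) (auto simp: subset_iff)
  then show "(\<lambda>x. f x + g x) \<in> {f \<in> L2_space M. \<forall>g\<in>S. L2_inner M f g = 0}" using fg by auto
qed (use assms in \<open>auto simp: L2_inner_scale_left L2_inner_AE_zero\<close>)

text \<open>The functions orthogonal to \<open>f\<close> form a closed subspace, so it suffices to
  test the generators.\<close>

lemma L2_orthogonal_closed_span:
  assumes b: "\<And>i. i \<in> I \<Longrightarrow> b i \<in> L2_space M" and f: "f \<in> L2_space M"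
    and orth: "\<And>i. i \<in> I \<Longrightarrow> L2_inner M f (b i) = 0" and g: "g \<in> L2_closed_span M I b"
  shows "L2_inner M f g = 0"
proof -
  have "L2_closed_subspace M {g \<in> L2_space M. \<forall>h\<in>{f}. L2_inner M g h = 0}"
    by (rule L2_closed_subspace_orthogonal) (use f in simp)
  moreover have "b i \<in> {g \<in> L2_space M. \<forall>h\<in>{f}. L2_inner M g h = 0}" if "i \<in> I" for i
    using b[OF that] orth[OF that] L2_inner_cnj[of M "b i" f] by simp
  ultimately have "L2_closed_span M I b \<subseteq> {g \<in> L2_space M. \<forall>h\<in>{f}. L2_inner M g h = 0}"
    by (rule L2_closed_span_minimal)
  then have "L2_inner M g f = 0" using g by blast
  then show ?thesis using L2_inner_cnj[of M f g] by simp
qed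

text \<open>Such a function is orthogonal to the whole span and so to itself. Applied to complete
  systems, this is the standard way below of proving that a function vanishes.\<close>

lemma L2_orthogonal_self:
  assumes b: "\<And>i. i \<in> I \<Longrightarrow> b i \<in> L2_space M" and f: "f \<in> L2_closed_span M I b"
    and orth: "\<And>i. i \<in> I \<Longrightarrow> L2_inner M f (b i) = 0"
  shows "AE x in M. f x = 0"
proof -
  have fM: "f \<in> L2_space M" using f by (rule L2_closed_span_space)
  have "L2_inner M f f = 0" by (rule L2_orthogonal_closed_span[OF b fM orth f])
  then show ?thesis using L2_norm_eq_0_iff[OF fM] by (simp add: L2_inner_self)
qed

section \<open>Orthonormal families: Pythagoras, Bessel and comparison of norms\<close>

definition L2_orthonormal :: "'a measure \<Rightarrow> 'i set \<Rightarrow> ('i \<Rightarrow> 'a \<Rightarrow> complex) \<Rightarrow> bool" where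
  "L2_orthonormal M I b \<longleftrightarrow> (\<forall>i\<in>I. b i \<in> L2_space M) \<and>
     (\<forall>i\<in>I. \<forall>k\<in>I. L2_inner M (b i) (b k) = (if i = k then 1 else 0))"

lemma L2_onb_iff: "L2_onb M I b V \<longleftrightarrow> L2_orthonormal M I b \<and> L2_closed_span M I b = V"
  by (simp add: L2_onb_def L2_orthonormal_def)

lemma L2_orthonormal_space: "L2_orthonormal M I b \<Longrightarrow> i \<in> I \<Longrightarrow> b i \<in> L2_space M"
  by (simp add: L2_orthonormal_def)

lemma L2_orthonormal_inner:
  "L2_orthonormal M I b \<Longrightarrow> i \<in> I \<Longrightarrow> k \<in> I \<Longrightarrow> L2_inner M (b i) (b k) = (if i = k then 1 else 0)"
  by (simp add: L2_orthonormal_def)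

lemma L2_orthonormal_norm_sum:
  assumes on: "L2_orthonormal M I b" and F: "finite F" "F \<subseteq> I"
  shows "(L2_norm M (\<lambda>x. \<Sum>i\<in>F. c i * b i x))\<^sup>2 = (\<Sum>i\<in>F. (cmod (c i))\<^sup>2)"
proof -
  have b: "b i \<in> L2_space M" if "i \<in> F" for i using on F that by (auto intro: L2_orthonormal_space)
  have s: "(\<lambda>x. \<Sum>i\<in>F. c i * b i x) \<in> L2_space M" by (rule L2_sum[OF b])
  have k: "L2_inner M (b i) (\<lambda>x. \<Sum>k\<in>F. c k * b k x) = cnj (c i)" if "i \<in> F" for i
  proof -
    have "L2_inner M (b i) (\<lambda>x. \<Sum>k\<in>F. c k * b k x) = (\<Sum>k\<in>F. cnj (c k) * L2_inner M (b i) (b k))"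
      by (rule L2_inner_sum_right[OF b b[OF that]])
    also have "\<dots> = (\<Sum>k\<in>F. if k = i then cnj (c k) else 0)"
      by (rule sum.cong) (use on F that in \<open>auto simp: L2_orthonormal_inner subset_iff\<close>)
    finally show ?thesis using F that by simp
  qed
  have "complex_of_real ((L2_norm M (\<lambda>x. \<Sum>i\<in>F. c i * b i x))\<^sup>2) = (\<Sum>i\<in>F. c i * cnj (c i))"
    unfolding L2_inner_self[symmetric]
    by (subst L2_inner_sum_left[OF b s]) (use k in auto)
  also have "\<dots> = complex_of_real (\<Sum>i\<in>F. (cmod (c i))\<^sup>2)"
    by (simp only: complex_norm_square[symmetric] of_real_sum)
  finally show ?thesis using of_real_eq_iff by blast
qed

text \<open>Completing the square: the coefficients \<open>c\<close> enter only through the last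
  sum. Bessel's inequality, the comparison of norms and the passage to subfamilies all come from
  this identity.\<close>

lemma L2_orthonormal_dist_expand:
  assumes on: "L2_orthonormal M I b" and F: "finite F" "F \<subseteq> I" and f: "f \<in> L2_space M"
  shows "(L2_norm M (\<lambda>x. f x - (\<Sum>i\<in>F. c i * b i x)))\<^sup>2 =
    (L2_norm M f)\<^sup>2 - (\<Sum>i\<in>F. (cmod (L2_inner M f (b i)))\<^sup>2)
      + (\<Sum>i\<in>F. (cmod (c i - L2_inner M f (b i)))\<^sup>2)"
proof -
  have b: "b i \<in> L2_space M" if "i \<in> F" for i using on F that by (auto intro: L2_orthonormal_space)
  have s: "(\<lambda>x. \<Sum>i\<in>F. c i * b i x) \<in> L2_space M" by (rule L2_sum[OF b])
  have ir: "L2_inner M f (\<lambda>x. \<Sum>i\<in>F. c i * b i x) = (\<Sum>i\<in>F. cnj (c i) * L2_inner M f (b i))"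
    by (rule L2_inner_sum_right[OF b f])
  have "(L2_norm M (\<lambda>x. f x - (\<Sum>i\<in>F. c i * b i x)))\<^sup>2 =
    (L2_norm M f)\<^sup>2 + (\<Sum>i\<in>F. (cmod (c i))\<^sup>2) - 2 * Re (\<Sum>i\<in>F. cnj (c i) * L2_inner M f (b i))"
    by (simp only: L2_norm_diff_expand[OF f s] L2_orthonormal_norm_sum[OF on F] ir)
  moreover have "(cmod (c i - L2_inner M f (b i)))\<^sup>2 =
      (cmod (c i))\<^sup>2 + (cmod (L2_inner M f (b i)))\<^sup>2 - 2 * Re (cnj (c i) * L2_inner M f (b i))" for i
    unfolding cmod_power2 by (simp add: power2_eq_square algebra_simps)
  ultimately show ?thesis by (simp add: sum.distrib sum_subtractf sum_distrib_left)
qed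

lemma L2_Bessel:
  assumes on: "L2_orthonormal M I b" and F: "finite F" "F \<subseteq> I" and f: "f \<in> L2_space M"
  shows "(\<Sum>i\<in>F. (cmod (L2_inner M f (b i)))\<^sup>2) \<le> (L2_norm M f)\<^sup>2"
proof -
  have "0 \<le> (L2_norm M (\<lambda>x. f x - (\<Sum>i\<in>F. L2_inner M f (b i) * b i x)))\<^sup>2" by simp
  then show ?thesis unfolding L2_orthonormal_dist_expand[OF on F f] by simp
qed

text \<open>One half of Parseval, free of infinite sums: a finite approximation bounds the norm of
  \<open>f\<close> by finitely many coefficients plus \<open>e\<close>, and Bessel for the other
  family bounds these by the norm of \<open>f'\<close>. Two applications, with the roles exchanged,
  give equality of norms.\<close>

lemma L2_norm_le_if_coeffs_eq:
  assumes on: "L2_orthonormal M I b" "L2_orthonormal M' I b'"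
    and f: "f \<in> L2_closed_span M I b" and f': "f' \<in> L2_space M'"
    and eq: "\<And>i. i \<in> I \<Longrightarrow> cmod (L2_inner M f (b i)) = cmod (L2_inner M' f' (b' i))"
  shows "L2_norm M f \<le> L2_norm M' f'"
proof (rule power2_le_imp_le)
  show "(L2_norm M f)\<^sup>2 \<le> (L2_norm M' f')\<^sup>2"
  proof (rule field_le_epsilon)
    fix e :: real assume "e > 0"
    \<comment> \<open>The span controls the norm, whereas the expansion is for its square.\<close>
    then have "sqrt e > 0" by simp
    from L2_closed_spanE[OF f this] obtain F c where
      F: "finite F" "F \<subseteq> I" "L2_norm M (\<lambda>x. f x - (\<Sum>i\<in>F. c i * b i x)) < sqrt e" .
    have "(L2_norm M (\<lambda>x. f x - (\<Sum>i\<in>F. c i * b i x)))\<^sup>2 \<le> (sqrt e)\<^sup>2"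
      using F by (intro power_mono) auto
    then have 1: "(L2_norm M (\<lambda>x. f x - (\<Sum>i\<in>F. c i * b i x)))\<^sup>2 \<le> e" using \<open>e > 0\<close> by simp
    have "0 \<le> (\<Sum>i\<in>F. (cmod (c i - L2_inner M f (b i)))\<^sup>2)" by (simp add: sum_nonneg)
    then have "(L2_norm M f)\<^sup>2 \<le> (\<Sum>i\<in>F. (cmod (L2_inner M f (b i)))\<^sup>2) + e"
      using 1 unfolding L2_orthonormal_dist_expand[OF on(1) F(1,2) L2_closed_span_space[OF f]] by linarith
    also have "(\<Sum>i\<in>F. (cmod (L2_inner M f (b i)))\<^sup>2) = (\<Sum>i\<in>F. (cmod (L2_inner M' f' (b' i)))\<^sup>2)"
      using F eq by (intro sum.cong) auto
    also have "\<dots> \<le> (L2_norm M' f')\<^sup>2" by (rule L2_Bessel[OF on(2) F(1,2) f'])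
    finally show "(L2_norm M f)\<^sup>2 \<le> (L2_norm M' f')\<^sup>2 + e" by simp
  qed
qed simp

text \<open>Discarding the indices outside \<open>J\<close> cannot increase the distance: there the
  coefficient of \<open>f\<close> is 0, and a term contributes the nonnegative amount
  \<open>(cmod (c i))\<^sup>2\<close>.\<close>

lemma L2_closed_span_subfamily:
  assumes on: "L2_orthonormal M I b" and J: "J \<subseteq> I"
    and f: "f \<in> L2_closed_span M I b" and orth: "\<And>i. i \<in> I - J \<Longrightarrow> L2_inner M f (b i) = 0"
  shows "f \<in> L2_closed_span M J b"
proof (rule L2_closed_spanI)
  show fM: "f \<in> L2_space M" using f by (rule L2_closed_span_space)
  fix e :: real assume "e > 0"
  from L2_closed_spanE[OF f this] obtain F c where
    F: "finite F" "F \<subseteq> I" "L2_norm M (\<lambda>x. f x - (\<Sum>i\<in>F. c i * b i x)) < e" .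
  have FJ: "finite (F \<inter> J)" "F \<inter> J \<subseteq> I" using F by auto
  have "(L2_norm M (\<lambda>x. f x - (\<Sum>i\<in>F \<inter> J. c i * b i x)))\<^sup>2 \<le> (L2_norm M (\<lambda>x. f x - (\<Sum>i\<in>F. c i * b i x)))\<^sup>2"
  proof -
    have "(\<Sum>i\<in>F. (cmod (L2_inner M f (b i)))\<^sup>2) = (\<Sum>i\<in>F \<inter> J. (cmod (L2_inner M f (b i)))\<^sup>2)"
      using F orth by (intro sum.mono_neutral_right) auto
    moreover have "(\<Sum>i\<in>F \<inter> J. (cmod (c i - L2_inner M f (b i)))\<^sup>2) \<le> (\<Sum>i\<in>F. (cmod (c i - L2_inner M f (b i)))\<^sup>2)"
      using F by (intro sum_mono2) auto
    ultimately show ?thesis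
      unfolding L2_orthonormal_dist_expand[OF on F(1,2) fM] L2_orthonormal_dist_expand[OF on FJ fM] by linarith
  qed
  then have "L2_norm M (\<lambda>x. f x - (\<Sum>i\<in>F \<inter> J. c i * b i x)) \<le> L2_norm M (\<lambda>x. f x - (\<Sum>i\<in>F. c i * b i x))"
    by (rule power2_le_imp_le) simp
  then show "\<exists>F c. finite F \<and> F \<subseteq> J \<and> L2_norm M (\<lambda>x. f x - (\<Sum>i\<in>F. c i * b i x)) < e"
    using F by (intro exI[of _ "F \<inter> J"] exI[of _ c]) auto
qed

text \<open>Pythagoras for finite orthonormal sums gives the Riesz bounds with
  \<open>A = B = 1\<close>.\<close>

lemma L2_onb_imp_riesz_basis:
  assumes "L2_onb M I b V"
  shows "L2_riesz_basis M I b V"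
proof -
  have on: "L2_orthonormal M I b" and V: "L2_closed_span M I b = V" using assms by (auto simp: L2_onb_iff)
  have "1 * (\<Sum>i\<in>F. (cmod (c i))\<^sup>2) \<le> (L2_norm M (\<lambda>x. \<Sum>i\<in>F. c i * b i x))\<^sup>2 \<and>
      (L2_norm M (\<lambda>x. \<Sum>i\<in>F. c i * b i x))\<^sup>2 \<le> 1 * (\<Sum>i\<in>F. (cmod (c i))\<^sup>2)"
    if "finite F \<and> F \<subseteq> I" for F c
    using L2_orthonormal_norm_sum[OF on, of F c] that by simp
  then show ?thesis unfolding L2_riesz_basis_def
    using V L2_orthonormal_space[OF on] zero_less_one order_refl by blast
qed

subsection \<open>Functions supported in a set\<close>

text \<open>Support is meant up to null sets, which is what makes these sets closed subspaces; they
  serve as the Fourier images of MRA spaces.\<close>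

definition L2_supp :: "'a measure \<Rightarrow> 'a set \<Rightarrow> ('a \<Rightarrow> complex) set" where
  "L2_supp M E = {f \<in> L2_space M. AE x in M. x \<notin> E \<longrightarrow> f x = 0}"

lemma L2_supp_mono: "E \<subseteq> E' \<Longrightarrow> L2_supp M E \<subseteq> L2_supp M E'"
  by (auto simp: L2_supp_def elim!: eventually_mono)

lemma L2_supp_space: "L2_supp M (space M) = L2_space M"
  by (auto simp: L2_supp_def)

lemma L2_restrict_supp:
  assumes "f \<in> L2_space M" "E \<in> sets M"
  shows "(\<lambda>x. f x * indicator E x) \<in> L2_supp M E"
  using L2_restrict[OF assms] by (simp add: L2_supp_def)

lemma L2_supp_restrict_eq:
  assumes "f \<in> L2_supp M E"
  shows "AE x in M. f x * indicator E x = f x"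
  using assms by (auto simp: L2_supp_def indicator_def elim!: eventually_mono)

text \<open>For closedness: the part of \<open>f\<close> outside \<open>E\<close> agrees almost
  everywhere with that of \<open>f - g\<close> for each \<open>g\<close> supported in
  \<open>E\<close>, so its norm is at most every distance from \<open>f\<close> to such
  \<open>g\<close>.\<close>

lemma L2_closed_subspace_supp:
  assumes E: "E \<in> sets M"
  shows "L2_closed_subspace M (L2_supp M E)"
  unfolding L2_closed_subspace_def
proof (intro conjI ballI allI impI)
  fix f assume f: "f \<in> L2_space M" and ap: "\<forall>e>0. \<exists>g\<in>L2_supp M E. L2_norm M (\<lambda>x. f x - g x) < e"
  let ?h = "\<lambda>x. f x * indicator (space M - E) x"
  have h: "?h \<in> L2_space M" by (rule L2_restrict[OF f]) (use E in auto)
  have "L2_norm M ?h \<le> 0 + e" if "e > 0" for e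
  proof -
    obtain g where g: "g \<in> L2_supp M E" "L2_norm M (\<lambda>x. f x - g x) < e" using ap \<open>e > 0\<close> by blast
    have gM: "g \<in> L2_space M" using g by (simp add: L2_supp_def)
    have "L2_norm M ?h = L2_norm M (\<lambda>x. (f x - g x) * indicator (space M - E) x)"
    proof (rule L2_norm_cong_AE)
      show "?h \<in> borel_measurable M" using h by blast
      show "(\<lambda>x. (f x - g x) * indicator (space M - E) x) \<in> borel_measurable M"
        using L2_restrict[OF L2_diff[OF f gM], of "space M - E"] E by blast
      show "AE x in M. cmod (f x * indicator (space M - E) x) = cmod ((f x - g x) * indicator (space M - E) x)"
        using g(1) by (auto simp: L2_supp_def indicator_def elim!: eventually_mono)
    qed
    also have "\<dots> \<le> L2_norm M (\<lambda>x. f x - g x)"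
      unfolding L2_norm_def
    proof (intro real_sqrt_le_mono integral_mono)
      show "integrable M (\<lambda>x. (cmod ((f x - g x) * indicator (space M - E) x))\<^sup>2)"
        using L2_restrict[OF L2_diff[OF f gM], of "space M - E"] E by blast
      show "integrable M (\<lambda>x. (cmod (f x - g x))\<^sup>2)" using L2_diff[OF f gM] by blast
    qed (auto simp: indicator_def)
    finally show ?thesis using g by simp
  qed
  then have "L2_norm M ?h \<le> 0" by (rule field_le_epsilon)
  then have "L2_norm M ?h = 0" by (simp add: order_antisym)
  then have "AE x in M. ?h x = 0" unfolding L2_norm_eq_0_iff[OF h] .
  with AE_space have "AE x in M. x \<notin> E \<longrightarrow> f x = 0" by eventually_elim (auto simp: indicator_def)
  then show "f \<in> L2_supp M E" using f by (simp add: L2_supp_def)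
next
  fix f g assume "f \<in> L2_supp M E" "g \<in> L2_supp M E"
  then show "(\<lambda>x. f x + g x) \<in> L2_supp M E" by (auto simp: L2_supp_def elim: eventually_elim2)
next
  fix c f assume "f \<in> L2_supp M E"
  then show "(\<lambda>x. c * f x) \<in> L2_supp M E" by (auto simp: L2_supp_def elim!: eventually_mono)
qed (auto simp: L2_supp_def)

lemma L2_inner_disjoint_supp:
  assumes "f \<in> L2_supp M A" "g \<in> L2_supp M B" "AE x in M. x \<notin> A \<or> x \<notin> B"
  shows "L2_inner M f g = 0"
proof (rule L2_inner_AE_zero)
  have "AE x in M. x \<notin> A \<longrightarrow> f x = 0" "AE x in M. x \<notin> B \<longrightarrow> g x = 0" using assms by (auto simp: L2_supp_def)
  with assms(3) show "AE x in M. f x * cnj (g x) = 0" by eventually_elim auto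
qed

text \<open>Simple functions dominated by twice the modulus of \<open>f\<close> on \<open>E\<close>
  converge to \<open>f\<close> in norm, and their nonzero level sets lie in \<open>E\<close> and
  have finite measure. So only indicators of such sets have to be found in \<open>V\<close>.\<close>

lemma L2_supp_subset_if_indicators:
  assumes V: "L2_closed_subspace M V" and E: "E \<in> sets M"
    and ind: "\<And>C. C \<in> sets M \<Longrightarrow> C \<subseteq> E \<Longrightarrow> emeasure M C < \<infinity> \<Longrightarrow> (indicator C :: _ \<Rightarrow> complex) \<in> V"
  shows "L2_supp M E \<subseteq> V"
proof
  fix f assume fE: "f \<in> L2_supp M E"
  then have fM: "f \<in> L2_space M" by (simp add: L2_supp_def)
  let ?f = "\<lambda>x. f x * indicator E x"
  have f: "?f \<in> L2_space M" by (rule L2_restrict[OF fM E])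
  then have fm: "?f \<in> borel_measurable M" by blast
  obtain s where s': "\<forall>i. simple_function M (s i)" "\<forall>x\<in>space M. (\<lambda>i. s i x) \<longlonglongrightarrow> ?f x"
    "\<forall>i. \<forall>x\<in>space M. dist (s i x) 0 \<le> 2 * dist (?f x) 0"
    using borel_measurable_implies_sequence_metric[OF fm, of 0] by blast
  then have s: "\<And>i. simple_function M (s i)"
    "\<And>x. x \<in> space M \<Longrightarrow> (\<lambda>i. s i x) \<longlonglongrightarrow> ?f x"
    "\<And>i x. x \<in> space M \<Longrightarrow> cmod (s i x) \<le> 2 * cmod (?f x)"
    by (simp_all add: dist_norm)
  have sV: "s i \<in> V" and sL: "s i \<in> L2_space M" for i
  proof -
    have sm: "s i \<in> borel_measurable M" using s(1) by (rule borel_measurable_simple_function)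
    have "integrable M (\<lambda>x. 4 * (cmod (?f x))\<^sup>2)" using L2_spaceD(2)[OF f] by simp
    moreover have "(cmod (s i x))\<^sup>2 \<le> 4 * (cmod (?f x))\<^sup>2" if "x \<in> space M" for x
      using power_mono[OF s(3)[OF that, of i] norm_ge_zero, of 2] by (simp add: power_mult_distrib)
    ultimately show sL: "s i \<in> L2_space M" by (intro L2_space_bound[OF sm, where g="\<lambda>x. 4 * (cmod (?f x))\<^sup>2"]) auto
    \<comment> \<open>The value 0 is left out: its level set may have infinite measure and reach
      outside \<open>E\<close>.\<close>
    define R where "R = s i ` space M - {0}"
    have R: "finite R" using s(1)[of i] by (simp add: R_def simple_function_def)
    define S where "S = (\<lambda>c. s i -` {c} \<inter> space M)"
    have S: "S c \<in> sets M" for c unfolding S_def using s(1)[of i] by (rule simple_functionD)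
    have "(indicator (S c) :: _ \<Rightarrow> complex) \<in> V" if c: "c \<in> R" for c
    proof (rule ind[OF S])
      have "c \<noteq> 0" using c by (simp add: R_def)
      show "S c \<subseteq> E"
      proof
        fix x assume x: "x \<in> S c"
        then have "cmod c \<le> 2 * cmod (?f x)" using s(3)[of x i] by (simp add: S_def)
        then show "x \<in> E" using \<open>c \<noteq> 0\<close> by (cases "x \<in> E") auto
      qed
      \<comment> \<open>The indicator of a level set is a rescaled restriction of
        \<open>s i\<close>, hence square-integrable; this yields the finite measure.\<close>
      have "(\<lambda>x. ((1 / c) * s i x) * indicator (S c) x) \<in> L2_space M"
        by (rule L2_restrict[OF L2_scale[OF sL] S])
      moreover have "((1 / c) * s i x) * indicator (S c) x = indicator (S c) x" for x
        using \<open>c \<noteq> 0\<close> by (simp add: S_def indicator_def)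
      ultimately show "emeasure M (S c) < \<infinity>" using L2_indicator_emeasure[OF S, of c] by simp
    qed
    then have V1: "(\<lambda>x. \<Sum>c\<in>R. c * indicator (S c) x) \<in> V" by (rule L2_closed_subspace_sum[OF V])
    show "s i \<in> V"
    proof (rule L2_closed_subspace_cong_AE[OF V V1 sm], rule AE_I2)
      fix x assume x: "x \<in> space M"
      have "(\<Sum>c\<in>R. c * indicator (S c) x) = (\<Sum>c\<in>R. if c = s i x then c else 0)"
        using x by (intro sum.cong) (auto simp: S_def indicator_def)
      also have "\<dots> = s i x" using R x by (auto simp: R_def)
      finally show "(\<Sum>c\<in>R. c * indicator (S c) x) = s i x" .
    qed
  qed
  have "L2_tendsto M s ?f"
    by (rule L2_dominated_convergence[OF f sL]) (use s in auto)
  then have "?f \<in> V" by (rule L2_closed_subspace_limit[OF V sV])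
  then show "f \<in> V" using L2_closed_subspace_cong_AE[OF V] fM L2_supp_restrict_eq[OF fE] by blast
qed

lemma L2_indicator_tendsto_UN:
  fixes C :: "nat \<Rightarrow> 'a set"
  assumes C: "\<And>n. C n \<in> sets M" "incseq C" and fin: "emeasure M (\<Union>n. C n) < \<infinity>"
  shows "L2_tendsto M (\<lambda>n. indicator (C n)) (indicator (\<Union>n. C n))"
proof (rule L2_dominated_convergence)
  show "indicator (\<Union>n. C n) \<in> L2_space M" using C fin by auto
  have "emeasure M (C n) \<le> emeasure M (\<Union>n. C n)" for n using C(1) by (intro emeasure_mono) auto
  then show "indicator (C n) \<in> L2_space M" for n using C fin by (meson L2_indicator le_less_trans)
  show "AE x in M. (\<lambda>n. indicator (C n) x) \<longlonglongrightarrow> indicator (\<Union>n. C n) x"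
    using LIMSEQ_indicator_incseq[OF C(2)] by auto
qed (auto simp: indicator_def)

lemma L2_closed_subspace_indicator_UN:
  fixes C :: "nat \<Rightarrow> 'a set"
  assumes V: "L2_closed_subspace M V" and C: "\<And>n. C n \<in> sets M" "incseq C"
    and fin: "emeasure M (\<Union>n. C n) < \<infinity>" and mem: "\<And>n. (indicator (C n) :: _ \<Rightarrow> complex) \<in> V"
  shows "(indicator (\<Union>n. C n) :: _ \<Rightarrow> complex) \<in> V"
  by (rule L2_closed_subspace_limit[OF V mem L2_indicator_tendsto_UN[OF C fin]])

lemma L2_closed_subspace_indicator_disjoint_UN:
  fixes C :: "nat \<Rightarrow> 'a set"
  assumes V: "L2_closed_subspace M V" and C: "\<And>n. C n \<in> sets M" "disjoint_family C"
    and fin: "emeasure M (\<Union>n. C n) < \<infinity>" and mem: "\<And>n. (indicator (C n) :: _ \<Rightarrow> complex) \<in> V"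
  shows "(indicator (\<Union>n. C n) :: _ \<Rightarrow> complex) \<in> V"
proof -
  let ?D = "\<lambda>n. \<Union>i<n. C i"
  have U: "(\<Union>n. ?D n) = (\<Union>n. C n)" by (auto intro: lessI)
  have "(indicator (\<Union>n. ?D n) :: _ \<Rightarrow> complex) \<in> V"
  proof (rule L2_closed_subspace_indicator_UN[OF V])
    show "?D n \<in> sets M" for n using C(1) by blast
    show "incseq ?D" by (rule incseq_SucI) (auto simp: less_Suc_eq)
    show "emeasure M (\<Union>n. ?D n) < \<infinity>" using fin by (simp only: U)
    fix n
    have "(indicator (?D n) :: _ \<Rightarrow> complex) = (\<lambda>x. \<Sum>i<n. 1 * indicator (C i) x)"
    proof
      fix x
      have "(indicator (?D n) x :: complex) = (\<Sum>i<n. indicator (C i) x)"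
        by (rule indicator_UN_disjoint) (use C(2) in \<open>auto simp: disjoint_family_on_def\<close>)
      then show "(indicator (?D n) x :: complex) = (\<Sum>i<n. 1 * indicator (C i) x)" by simp
    qed
    then show "(indicator (?D n) :: _ \<Rightarrow> complex) \<in> V"
      using L2_closed_subspace_sum[OF V, of "{..<n}" "\<lambda>i. indicator (C i)" "\<lambda>_. 1"] mem by simp
  qed
  then show ?thesis by (simp only: U)
qed

text \<open>The sets \<open>A\<close> satisfying the conclusion form a Dynkin system: complements
  use the indicator of \<open>E\<close>, disjoint unions use closedness of \<open>V\<close>. It is
  applied with \<open>h\<close> the identity for the density of balls, and with
  \<open>h = vfrac\<close> for the completeness of characters.\<close>

lemma L2_indicator_Dynkin:
  assumes V: "L2_closed_subspace M V" and E: "E \<in> sets M" "emeasure M E < \<infinity>"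
    and h: "h \<in> measurable M N"
    and G: "G \<subseteq> Pow (space N)" "Int_stable G" "sets N = sigma_sets (space N) G"
    and memE: "(indicator E :: _ \<Rightarrow> complex) \<in> V"
    and mem: "\<And>A. A \<in> G \<Longrightarrow> (indicator (E \<inter> h -` A) :: _ \<Rightarrow> complex) \<in> V"
    and A: "A \<in> sets N"
  shows "(indicator (E \<inter> h -` A) :: _ \<Rightarrow> complex) \<in> V"
proof -
  have V0: "(\<lambda>x. 0) \<in> V" using V by (simp add: L2_closed_subspace_def)
  have EM: "E \<subseteq> space M" using sets.sets_into_space[OF E(1)] .
  have "A \<in> sigma_sets (space N) G" using A G(3) by simp
  with G(2) G(1) show ?thesis
  proof (induction rule: sigma_sets_induct_disjoint)
    case (basic A) then show ?case by (rule mem)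
  next
    case empty
    have "(indicator (E \<inter> h -` {}) :: _ \<Rightarrow> complex) = (\<lambda>x. 0)" by (simp add: fun_eq_iff)
    then show ?case using V0 by (simp only:)
  next
    case (compl A)
    have "(indicator (E \<inter> h -` (space N - A)) :: _ \<Rightarrow> complex) =
        (\<lambda>x. indicator E x - indicator (E \<inter> h -` A) x)"
      using EM measurable_space[OF h] by (auto simp: indicator_def fun_eq_iff)
    then show ?case using L2_closed_subspace_diff[OF V memE compl.IH] by simp
  next
    case (union C)
    have "(indicator (\<Union>n. E \<inter> h -` C n) :: _ \<Rightarrow> complex) \<in> V"
    proof (rule L2_closed_subspace_indicator_disjoint_UN[OF V])
      have "C n \<in> sets N" for n using union G(3) by auto
      then have "E \<inter> (h -` C n \<inter> space M) \<in> sets M" for n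
        using E(1) measurable_sets[OF h] by blast
      moreover have "E \<inter> (h -` C n \<inter> space M) = E \<inter> h -` C n" for n using EM by blast
      ultimately show "E \<inter> h -` C n \<in> sets M" for n by simp
      have "emeasure M (\<Union>n. E \<inter> h -` C n) \<le> emeasure M E" using E by (intro emeasure_mono) auto
      from this E(2) show "emeasure M (\<Union>n. E \<inter> h -` C n) < \<infinity>" by (rule le_less_trans)
      show "disjoint_family (\<lambda>n. E \<inter> h -` C n)" using union by (fastforce simp: disjoint_family_on_def)
    qed (use union in auto)
    moreover have "(\<Union>n. E \<inter> h -` C n) = E \<inter> h -` (\<Union>n. C n)" by blast
    ultimately show ?case by (simp only:)
  qed
qed

subsection \<open>Balls of the Vilenkin group\<close>

text \<open>For \<open>a\<close> in the group this is the translate by \<open>a\<close> of the image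
  of \<open>vil_U p\<close> under \<open>rho_pow m\<close>, an ultrametric ball of measure p^m;
  larger \<open>m\<close> means a larger ball.\<close>

definition vball :: "int \<Rightarrow> vseq \<Rightarrow> int \<Rightarrow> vseq set" where
  "vball p a m = {x \<in> vil p. \<forall>j\<le>-m. x j = a j}"

text \<open>The empty set is included to make the family stable under intersection: two balls are
  nested or disjoint.\<close>

definition vballs :: "int \<Rightarrow> vseq set set" where
  "vballs p = insert {} {vball p a m | a m. a \<in> vil p}"

lemma vilI:
  assumes "\<And>j. 0 \<le> x j" "\<And>j. x j < p" "\<And>j. j < k \<Longrightarrow> x j = 0"
  shows "x \<in> vil p"
  using assms by (auto simp: vil_def)

lemma vilE:
  assumes "x \<in> vil p"
  obtains k where "\<forall>j<k. x j = 0"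
  using assms by (auto simp: vil_def)

lemma vil_bounds: "x \<in> vil p \<Longrightarrow> 0 \<le> x j" "x \<in> vil p \<Longrightarrow> x j < p"
  by (auto simp: vil_def)

lemma vil_mod [simp]: "x \<in> vil p \<Longrightarrow> x j mod p = x j"
  by (simp add: vil_bounds)

locale vilenkin_base =
  fixes p :: int
  assumes p2: "p \<ge> 2"
begin

lemma p_pos: "p > 0" using p2 by simp

lemma vil_zero_in [simp, intro]: "vil_zero \<in> vil p"
  using p2 by (auto simp: vil_def vil_zero_def)

lemma vil_add_in [simp, intro]:
  assumes "x \<in> vil p" "y \<in> vil p"
  shows "vil_add p x y \<in> vil p"
proof -
  obtain k where k: "\<forall>j<k. x j = 0" using vilE[OF assms(1)] .
  obtain l where l: "\<forall>j<l. y j = 0" using vilE[OF assms(2)] .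
  show ?thesis by (rule vilI[where k="min k l"]) (use p_pos k l in \<open>auto simp: vil_add_def\<close>)
qed

lemma vil_sub_in [simp, intro]:
  assumes "x \<in> vil p" "y \<in> vil p"
  shows "vil_sub p x y \<in> vil p"
proof -
  obtain k where k: "\<forall>j<k. x j = 0" using vilE[OF assms(1)] .
  obtain l where l: "\<forall>j<l. y j = 0" using vilE[OF assms(2)] .
  show ?thesis by (rule vilI[where k="min k l"]) (use p_pos k l in \<open>auto simp: vil_sub_def\<close>)
qed

lemma rho_pow_in [simp, intro]:
  assumes "x \<in> vil p"
  shows "rho_pow m x \<in> vil p"
proof -
  obtain k where k: "\<forall>j<k. x j = 0" using vilE[OF assms(1)] .
  show ?thesis by (rule vilI[where k="k - m"]) (use assms k in \<open>auto simp: rho_pow_def vil_bounds\<close>)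
qed

lemma rho_pow_add [simp]: "rho_pow m (rho_pow n x) = rho_pow (m + n) x"
  by (simp add: rho_pow_def fun_eq_iff algebra_simps)

lemma rho_pow_0 [simp]: "rho_pow 0 x = x"
  by (simp add: rho_pow_def)

lemma rho_pow_in_iff [simp]: "rho_pow m x \<in> vil p \<longleftrightarrow> x \<in> vil p"
  using rho_pow_in[of "rho_pow m x" "-m"] by auto

lemma vil_add_sub_cancel [simp]: "x \<in> vil p \<Longrightarrow> vil_add p y (vil_sub p x y) = x"
  by (simp add: vil_add_def vil_sub_def fun_eq_iff mod_simps)

lemma vil_sub_add_cancel [simp]: "x \<in> vil p \<Longrightarrow> vil_sub p (vil_add p y x) y = x"
  by (simp add: vil_add_def vil_sub_def fun_eq_iff mod_simps)

lemma vil_add_commute: "vil_add p x y = vil_add p y x"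
  by (simp add: vil_add_def add.commute)

lemma vil_sub_zero [simp]: "x \<in> vil p \<Longrightarrow> vil_sub p x vil_zero = x"
  by (simp add: vil_sub_def vil_zero_def)

lemma vil_add_image:
  assumes "a \<in> vil p" "A \<subseteq> vil p"
  shows "vil_add p a ` A = {x \<in> vil p. vil_sub p x a \<in> A}"
proof (intro set_eqI iffI)
  fix x assume "x \<in> vil_add p a ` A"
  then obtain y where "y \<in> A" "x = vil_add p a y" by blast
  then show "x \<in> {x \<in> vil p. vil_sub p x a \<in> A}" using assms by auto
next
  fix x assume "x \<in> {x \<in> vil p. vil_sub p x a \<in> A}"
  then have "x = vil_add p a (vil_sub p x a)" "vil_sub p x a \<in> A" by auto
  then show "x \<in> vil_add p a ` A" by blast
qed

lemma rho_pow_image: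
  assumes "A \<subseteq> vil p"
  shows "rho_pow m ` A = {x \<in> vil p. rho_pow (-m) x \<in> A}"
proof (intro set_eqI iffI)
  fix x assume "x \<in> {x \<in> vil p. rho_pow (-m) x \<in> A}"
  then have "x = rho_pow m (rho_pow (-m) x)" "rho_pow (-m) x \<in> A" by auto
  then show "x \<in> rho_pow m ` A" by blast
qed (use assms in auto)

lemma vball_sub_vil: "vball p a m \<subseteq> vil p"
  by (auto simp: vball_def)

lemma vball_vil: "x \<in> vball p a m \<Longrightarrow> x \<in> vil p"
  by (simp add: vball_def)

lemma vball_self [simp]: "a \<in> vil p \<Longrightarrow> a \<in> vball p a m"
  by (simp add: vball_def)

lemma vball_eq: "b \<in> vball p a m \<Longrightarrow> vball p a m = vball p b m"
  by (auto simp: vball_def)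

lemma vball_mono: "m \<le> l \<Longrightarrow> vball p a m \<subseteq> vball p a l"
  by (auto simp: vball_def)

lemma vball_sub_iff:
  assumes "x \<in> vil p" "a \<in> vil p" "b \<in> vil p"
  shows "vil_sub p x a \<in> vball p b m \<longleftrightarrow> x \<in> vball p (vil_add p b a) m"
proof -
  have "(x j - a j) mod p = b j \<longleftrightarrow> x j = (b j + a j) mod p" for j
  proof
    assume "(x j - a j) mod p = b j"
    then have "(b j + a j) mod p = x j mod p" by (metis diff_add_cancel mod_add_left_eq)
    then show "x j = (b j + a j) mod p" using assms by simp
  next
    assume "x j = (b j + a j) mod p"
    then have "(x j - a j) mod p = b j mod p" by (simp add: mod_simps)
    then show "(x j - a j) mod p = b j" using assms by simp
  qed
  then show ?thesis using vil_sub_in[OF assms(1,2)] assms(1)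
    by (simp add: vball_def vil_sub_def vil_add_def)
qed

lemma vball_zero_sub_iff:
  assumes "x \<in> vil p" "a \<in> vil p"
  shows "vil_sub p x a \<in> vball p vil_zero m \<longleftrightarrow> x \<in> vball p a m"
proof -
  have "vball p (vil_add p vil_zero a) m = vball p a m"
    using assms(2) by (auto simp: vball_def vil_add_def vil_zero_def)
  then show ?thesis using vball_sub_iff[OF assms vil_zero_in] by simp
qed

lemma vball_add_iff:
  assumes "x \<in> vil p" "a \<in> vil p" "b \<in> vil p"
  shows "vil_add p a x \<in> vball p b m \<longleftrightarrow> x \<in> vball p (vil_sub p b a) m"
proof -
  have "vil_add p a x \<in> vball p b m \<longleftrightarrow> b \<in> vball p (vil_add p a x) m"
    using assms by (auto simp: vball_def)
  also have "\<dots> \<longleftrightarrow> b \<in> vball p (vil_add p x a) m" by (simp add: vil_add_commute)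
  also have "\<dots> \<longleftrightarrow> vil_sub p b a \<in> vball p x m" using vball_sub_iff[OF assms(3,2,1)] by simp
  also have "\<dots> \<longleftrightarrow> x \<in> vball p (vil_sub p b a) m"
    using assms by (auto simp: vball_def)
  finally show ?thesis .
qed

lemma rho_pow_vball_iff:
  assumes "x \<in> vil p" "b \<in> vil p"
  shows "rho_pow k x \<in> vball p b m \<longleftrightarrow> x \<in> vball p (rho_pow (-k) b) (m - k)"
proof -
  have "(\<forall>j\<le>-m. x (j + k) = b j) \<longleftrightarrow> (\<forall>j\<le>-(m-k). x j = b (j - k))"
  proof
    assume h: "\<forall>j\<le>-m. x (j + k) = b j"
    show "\<forall>j\<le>-(m-k). x j = b (j - k)"
    proof (intro allI impI)
      fix j assume "j \<le> -(m-k)"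
      then show "x j = b (j - k)" using h[rule_format, of "j - k"] by simp
    qed
  next
    assume h: "\<forall>j\<le>-(m-k). x j = b (j - k)"
    show "\<forall>j\<le>-m. x (j + k) = b j"
    proof (intro allI impI)
      fix j assume "j \<le> -m"
      then show "x (j + k) = b j" using h[rule_format, of "j + k"] by simp
    qed
  qed
  then show ?thesis using assms rho_pow_in[OF assms(1), of k] by (simp add: vball_def rho_pow_def)
qed

lemma vil_U_eq: "vil_U p = vball p vil_zero 0"
  by (auto simp: vil_U_def vball_def vil_zero_def)

lemma rho_pow_vil_U: "rho_pow m ` vil_U p = vball p vil_zero m"
proof -
  have z: "rho_pow k vil_zero = vil_zero" for k by (simp add: rho_pow_def vil_zero_def)
  have "rho_pow m ` vil_U p = {x \<in> vil p. rho_pow (-m) x \<in> vball p vil_zero 0}"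
    unfolding vil_U_eq by (rule rho_pow_image[OF vball_sub_vil])
  also have "\<dots> = {x \<in> vil p. x \<in> vball p vil_zero m}"
    by (simp add: rho_pow_vball_iff z cong: conj_cong)
  also have "\<dots> = vball p vil_zero m" using vball_sub_vil by blast
  finally show ?thesis .
qed

lemma vil_add_vball:
  assumes "a \<in> vil p"
  shows "vil_add p a ` vball p vil_zero m = vball p a m"
proof -
  have "vil_add p a ` vball p vil_zero m = {x \<in> vil p. x \<in> vball p a m}"
    unfolding vil_add_image[OF assms vball_sub_vil]
    by (simp add: vball_zero_sub_iff assms cong: conj_cong)
  then show ?thesis using vball_sub_vil by blast
qed

section \<open>Topology and Borel sets of the group\<close>

lemma vil_top_eq: "vil_top p = topology_generated_by {vball p a m | a m. a \<in> vil p}"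
proof -
  have "{vil_add p x ` (rho_pow m ` vil_U p) | x m. x \<in> vil p} = {vball p a m | a m. a \<in> vil p}"
    by (rule Collect_cong) (metis rho_pow_vil_U vil_add_vball)
  then show ?thesis by (simp add: vil_top_def)
qed

text \<open>Induction over the generation of open sets. Every point of a ball is a centre of it, and
  at a point of an intersection the smaller of the two exponents works.\<close>

lemma openin_vil_topD:
  assumes "openin (vil_top p) S"
  shows "S \<subseteq> vil p \<and> (\<forall>x\<in>S. \<exists>m. vball p x m \<subseteq> S)"
proof -
  have "generate_topology_on {vball p a m | a m. a \<in> vil p} S"
    using assms by (simp add: vil_top_eq openin_topology_generated_by_iff)
  then show ?thesis
  proof (induction rule: generate_topology_on.induct)
    case Empty then show ?case by simp
  next
    case (Int S T)
    have "\<exists>m. vball p x m \<subseteq> S \<inter> T" if x: "x \<in> S \<inter> T" for x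
    proof -
      obtain m l where "vball p x m \<subseteq> S" "vball p x l \<subseteq> T" using Int x by blast
      then have "vball p x (min m l) \<subseteq> S \<inter> T"
        using vball_mono[of "min m l" m x] vball_mono[of "min m l" l x] by auto
      then show ?thesis ..
    qed
    then show ?case using Int by blast
  next
    case (UN K)
    show ?case
    proof (intro conjI ballI)
      show "\<Union>K \<subseteq> vil p" using UN.IH by blast
      fix x assume "x \<in> \<Union>K"
      then obtain T where T: "T \<in> K" "x \<in> T" by blast
      then obtain m where "vball p x m \<subseteq> T" using UN.IH by blast
      then show "\<exists>m. vball p x m \<subseteq> \<Union>K" using T by blast
    qed
  next
    case (Basis S)
    then obtain a m where S: "S = vball p a m" "a \<in> vil p" by blast
    then show ?case using vball_sub_vil vball_eq by blast
  qed
qed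

lemma openin_vil_top_vball: "a \<in> vil p \<Longrightarrow> openin (vil_top p) (vball p a m)"
  unfolding vil_top_eq by (rule topology_generated_by_Basis) blast

lemma finite_vil_bounded_support:
  "finite {x \<in> vil p. \<forall>j. x j \<noteq> 0 \<longrightarrow> j \<in> {k..l}}"
proof (rule finite_subset)
  show "{x \<in> vil p. \<forall>j. x j \<noteq> 0 \<longrightarrow> j \<in> {k..l}} \<subseteq>
    {f. \<forall>x. (x \<in> {k..l} \<longrightarrow> f x \<in> {0..<p}) \<and> (x \<notin> {k..l} \<longrightarrow> f x = 0)}"
    by (auto simp: vil_bounds)
  show "finite {f::vseq. \<forall>x. (x \<in> {k..l} \<longrightarrow> f x \<in> {0..<p}) \<and> (x \<notin> {k..l} \<longrightarrow> f x = 0)}"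
    by (rule finite_set_of_finite_funs) auto
qed

text \<open>Every group element also vanishes below some index, so its nonzero digits fit into a
  finite window, and there are countably many windows.\<close>

lemma countable_vil_vanishing_above: "countable {x \<in> vil p. \<forall>j>l. x j = 0}"
proof (rule countable_subset)
  show "{x \<in> vil p. \<forall>j>l. x j = 0} \<subseteq> (\<Union>k. {x \<in> vil p. \<forall>j. x j \<noteq> 0 \<longrightarrow> j \<in> {k..l}})"
  proof
    fix x assume x: "x \<in> {x \<in> vil p. \<forall>j>l. x j = 0}"
    then obtain k where k: "\<forall>j<k. x j = 0" using vilE by blast
    have "k \<le> j \<and> j \<le> l" if "x j \<noteq> 0" for j
    proof (rule conjI; rule ccontr)
      show False if "\<not> k \<le> j" using k \<open>x j \<noteq> 0\<close> that by simp
      show False if "\<not> j \<le> l" using x \<open>x j \<noteq> 0\<close> that by simp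
    qed
    then have "x \<in> {x \<in> vil p. \<forall>j. x j \<noteq> 0 \<longrightarrow> j \<in> {k..l}}"
      using x by simp
    then show "x \<in> (\<Union>k. {x \<in> vil p. \<forall>j. x j \<noteq> 0 \<longrightarrow> j \<in> {k..l}})" by blast
  qed
  show "countable (\<Union>k. {x \<in> vil p. \<forall>j. x j \<noteq> 0 \<longrightarrow> j \<in> {k..l}})"
    by (rule countable_UN[OF countableI_type countable_finite[OF finite_vil_bounded_support]])
qed

lemma countable_vil_Lambda: "countable (vil_Lambda p)"
  unfolding vil_Lambda_def using countable_vil_vanishing_above[of 0] by simp

lemma countable_vballs: "countable (vballs p)"
proof -
  have "vballs p \<subseteq> insert {} (\<Union>m. (\<lambda>a. vball p a m) ` {x \<in> vil p. \<forall>j>-m. x j = 0})"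
  proof
    fix S assume "S \<in> vballs p"
    then consider "S = {}" | a m where "S = vball p a m" "a \<in> vil p" by (auto simp: vballs_def)
    then show "S \<in> insert {} (\<Union>m. (\<lambda>a. vball p a m) ` {x \<in> vil p. \<forall>j>-m. x j = 0})"
    proof cases
      case (2 a m)
      \<comment> \<open>Digits beyond \<open>-m\<close> do not affect the ball, so the centre can be
        truncated; truncated centres form a countable set.\<close>
      define b where "b = (\<lambda>j. if j \<le> -m then a j else 0)"
      have "b \<in> vil p" using 2 p_pos by (auto simp: vil_def b_def)
      moreover have "S = vball p b m" using 2 by (auto simp: vball_def b_def)
      ultimately have "S \<in> (\<lambda>a. vball p a m) ` {x \<in> vil p. \<forall>j>-m. x j = 0}"
        by (intro image_eqI[of _ _ b]) (auto simp: b_def)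
      then show ?thesis by blast
    qed simp
  qed
  moreover have "countable (insert {} (\<Union>m. (\<lambda>a. vball p a m) ` {x \<in> vil p. \<forall>j>-m. x j = 0}))"
    by (intro countable_insert countable_UN[OF countableI_type] countable_image countable_vil_vanishing_above)
  ultimately show ?thesis by (rule countable_subset)
qed

lemma vballs_Pow: "vballs p \<subseteq> Pow (vil p)"
  using vball_sub_vil by (auto simp: vballs_def)

lemma vball_in_vballs [simp]: "a \<in> vil p \<Longrightarrow> vball p a m \<in> vballs p"
  by (auto simp: vballs_def)

lemma vball_Int:
  assumes "m \<le> l" "a \<in> vil p"
  shows "vball p a m \<inter> vball p b l = (if a \<in> vball p b l then vball p a m else {})"
proof (cases "a \<in> vball p b l")
  case True
  then have "vball p b l = vball p a l" by (rule vball_eq)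
  then show ?thesis using True vball_mono[OF assms(1), of a] by auto
next
  case False
  have "vball p a m \<inter> vball p b l = {}"
  proof (rule ccontr)
    assume "vball p a m \<inter> vball p b l \<noteq> {}"
    then obtain x where x: "x \<in> vball p a m" "x \<in> vball p b l" by blast
    have "a j = b j" if "j \<le> -l" for j using x that assms by (auto simp: vball_def)
    then show False using False assms(2) by (simp add: vball_def)
  qed
  then show ?thesis using False by simp
qed

lemma Int_stable_vballs: "Int_stable (vballs p)"
proof (rule Int_stableI)
  fix S T assume ST: "S \<in> vballs p" "T \<in> vballs p"
  have *: "vball p a m \<inter> vball p b l \<in> vballs p" if "a \<in> vil p" "b \<in> vil p" for a b m l
    using vball_Int[OF _ that(1), of m l b] vball_Int[OF _ that(2), of l m a] that
    by (cases "m \<le> l") (auto simp: Int_commute vballs_def)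
  consider "S = {} \<or> T = {}" | a m b l where "S = vball p a m" "a \<in> vil p" "T = vball p b l" "b \<in> vil p"
    using ST unfolding vballs_def by blast
  then show "S \<inter> T \<in> vballs p"
  proof cases
    case 1 then show ?thesis by (auto simp: vballs_def)
  next
    case (2 a m b l) then show ?thesis by (simp add: *)
  qed
qed

lemma sigma_sets_vil_open_if_locally_ball:
  assumes "S \<subseteq> vil p" "\<And>x. x \<in> S \<Longrightarrow> \<exists>m. vball p x m \<subseteq> S"
  shows "S \<in> sigma_sets (vil p) (vballs p)"
proof -
  have "S = \<Union>{B \<in> vballs p. B \<subseteq> S}"
  proof
    show "S \<subseteq> \<Union>{B \<in> vballs p. B \<subseteq> S}"
    proof
      fix x assume "x \<in> S"
      then obtain m where "vball p x m \<subseteq> S" "x \<in> vil p" using assms by blast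
      then show "x \<in> \<Union>{B \<in> vballs p. B \<subseteq> S}" using vball_self vball_in_vballs by blast
    qed
  qed blast
  moreover have "\<Union>{B \<in> vballs p. B \<subseteq> S} \<in> sigma_sets (vil p) (vballs p)"
  proof (rule sigma_sets_UNION)
    show "countable {B \<in> vballs p. B \<subseteq> S}" using countable_vballs by (rule countable_subset[rotated]) blast
  qed auto
  ultimately show ?thesis by simp
qed

text \<open>There are only countably many balls, so open sets are countable unions of balls. The
  Borel sets thus have an intersection stable generator on which measures and maps can be
  checked.\<close>

lemma sigma_sets_vil_open:
  "sigma_sets (vil p) {S. openin (vil_top p) S} = sigma_sets (vil p) (vballs p)"
proof (rule sigma_sets_eqI)
  fix S assume "S \<in> {S. openin (vil_top p) S}"
  then have "S \<subseteq> vil p \<and> (\<forall>x\<in>S. \<exists>m. vball p x m \<subseteq> S)" using openin_vil_topD by simp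
  then show "S \<in> sigma_sets (vil p) (vballs p)"
    using sigma_sets_vil_open_if_locally_ball[of S] by simp
next
  fix S assume "S \<in> vballs p"
  then consider "S = {}" | a m where "S = vball p a m" "a \<in> vil p" by (auto simp: vballs_def)
  then have "openin (vil_top p) S" by cases (simp_all add: openin_vil_top_vball)
  then show "S \<in> sigma_sets (vil p) {S. openin (vil_top p) S}" by auto
qed

text \<open>Position \<open>1 - m\<close> is the first digit left free in the larger ball; fixing it
  leaves a translate of the next smaller ball.\<close>

lemma vball_split:
  "vball p vil_zero m = (\<Union>d\<in>{0..<p}. vball p (\<lambda>j. if j = 1 - m then d else 0) (m - 1))"
proof (intro set_eqI iffI)
  fix x assume x: "x \<in> vball p vil_zero m"
  have "x \<in> vball p (\<lambda>j. if j = 1 - m then x (1 - m) else 0) (m - 1)"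
    using x by (auto simp: vball_def vil_zero_def)
  moreover have "x (1 - m) \<in> {0..<p}" using x by (auto simp: vball_def vil_bounds)
  ultimately show "x \<in> (\<Union>d\<in>{0..<p}. vball p (\<lambda>j. if j = 1 - m then d else 0) (m - 1))" by blast
qed (auto simp: vball_def vil_zero_def)

lemma single_in_vil: "0 \<le> d \<Longrightarrow> d < p \<Longrightarrow> (\<lambda>j. if j = k then d else 0) \<in> vil p"
  using p_pos by (intro vilI[where k=k]) auto

lemma UN_vball_zero: "(\<Union>n. vball p vil_zero (int n)) = vil p"
proof
  show "vil p \<subseteq> (\<Union>n. vball p vil_zero (int n))"
  proof
    fix x assume x: "x \<in> vil p"
    then obtain k where k: "\<forall>j<k. x j = 0" using vilE by blast
    have "x \<in> vball p vil_zero (int (nat (1 - k)))"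
      using x k by (auto simp: vball_def vil_zero_def)
    then show "x \<in> (\<Union>n. vball p vil_zero (int n))" by blast
  qed
qed (use vball_sub_vil in blast)

end

subsection \<open>Haar measure\<close>

locale vilenkin = vilenkin_base +
  fixes M :: "vseq measure"
  assumes haar: "vil_haar p M"
begin

lemma space_M [simp]: "space M = vil p"
  using haar by (simp add: vil_haar_def)

lemma sets_M: "sets M = sigma_sets (vil p) (vballs p)"
  using haar by (simp add: vil_haar_def sigma_sets_vil_open)

lemma sets_locally_ball:
  assumes "S \<subseteq> vil p" "\<And>x. x \<in> S \<Longrightarrow> \<exists>m. vball p x m \<subseteq> S"
  shows "S \<in> sets M"
  unfolding sets_M using sigma_sets_vil_open_if_locally_ball[OF assms] .

lemma vball_sets [simp, intro]: "a \<in> vil p \<Longrightarrow> vball p a m \<in> sets M"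
  unfolding sets_M by (auto simp: vballs_def)

text \<open>Translation invariance and the splitting into \<open>p\<close> translates give a
  recursion in \<open>m\<close>; starting from mass 1 of \<open>vil_U p\<close> it is run upwards
  and downwards.\<close>

lemma emeasure_vball_zero: "emeasure M (vball p vil_zero m) = ennreal (real_of_int p powi m)"
proof -
  have tr: "emeasure M (vball p a m) = emeasure M (vball p vil_zero m)" if "a \<in> vil p" for a m
    using haar that vball_sets[OF vil_zero_in, of m] unfolding vil_haar_def
    by (simp add: vil_add_vball[OF that, symmetric])
  have rec: "emeasure M (vball p vil_zero m) = ennreal (real_of_int p) * emeasure M (vball p vil_zero (m - 1))" for m
  proof -
    let ?b = "\<lambda>d j. if j = 1 - m then d else 0 :: int"
    have "emeasure M (vball p vil_zero m) = (\<Sum>d\<in>{0..<p}. emeasure M (vball p (?b d) (m - 1)))"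
      unfolding vball_split[of m]
    proof (rule sum_emeasure[symmetric])
      show "(\<lambda>d. vball p (?b d) (m - 1)) ` {0..<p} \<subseteq> sets M"
        by (auto intro!: vball_sets single_in_vil)
      show "disjoint_family_on (\<lambda>d. vball p (?b d) (m - 1)) {0..<p}"
        by (auto simp: disjoint_family_on_def vball_def dest!: spec[of _ "1 - m"])
    qed simp
    also have "\<dots> = (\<Sum>d\<in>{0..<p}. emeasure M (vball p vil_zero (m - 1)))"
      by (intro sum.cong refl tr single_in_vil) auto
    also have "\<dots> = ennreal (real_of_int p) * emeasure M (vball p vil_zero (m - 1))"
      using p_pos by (simp add: ennreal_of_nat_eq_real_of_nat)
    finally show ?thesis .
  qed
  have pp: "real_of_int p > 0" using p_pos by simp
  show ?thesis
  proof (induction m rule: int_induct[where k=0])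
    case base
    show ?case using haar by (simp add: vil_haar_def vil_U_eq)
  next
    case (step1 i)
    have "real_of_int p powi (i + 1) = real_of_int p * real_of_int p powi i"
      using pp by (simp add: power_int_add mult.commute)
    then show ?case using rec[of "i + 1"] step1 pp by (simp add: ennreal_mult)
  next
    case (step2 i)
    have *: "real_of_int p powi i = real_of_int p * real_of_int p powi (i - 1)"
      using pp power_int_add[of "real_of_int p" 1 "i - 1"] by simp
    have "ennreal (real_of_int p) * emeasure M (vball p vil_zero (i - 1)) =
        ennreal (real_of_int p) * ennreal (real_of_int p powi (i - 1))"
      using rec[of i] step2 pp by (simp add: * ennreal_mult)
    then show ?case using pp by (simp add: ennreal_mult_cancel_left)
  qed
qed

lemma emeasure_vball:
  assumes "a \<in> vil p"
  shows "emeasure M (vball p a m) = ennreal (real_of_int p powi m)"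
  using haar assms vball_sets[OF vil_zero_in, of m] emeasure_vball_zero[of m] unfolding vil_haar_def
  by (simp add: vil_add_vball[OF assms, symmetric])

text \<open>Besides identifying the two given Haar measures, this computes image measures: their
  values on balls suffice.\<close>

lemma haar_unique:
  assumes "sets N = sets M" "\<And>a m. a \<in> vil p \<Longrightarrow> emeasure N (vball p a m) = ennreal (real_of_int p powi m)"
  shows "N = M"
proof (rule measure_eqI_generator_eq[OF Int_stable_vballs vballs_Pow])
  show "emeasure N X = emeasure M X" if "X \<in> vballs p" for X
    using that assms(2) emeasure_vball by (auto simp: vballs_def)
  show "range (\<lambda>n. vball p vil_zero (int n)) \<subseteq> vballs p" by auto
  show "emeasure N (vball p vil_zero (int i)) \<noteq> \<infinity>" for i by (simp add: assms(2))
qed (simp_all add: assms(1) sets_M UN_vball_zero)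

sublocale sigma_finite_measure M
proof
  show "\<exists>A. countable A \<and> A \<subseteq> sets M \<and> \<Union>A = space M \<and> (\<forall>a\<in>A. emeasure M a \<noteq> \<infinity>)"
    by (rule exI[of _ "range (\<lambda>n. vball p vil_zero (int n))"])
       (auto simp: UN_vball_zero emeasure_vball)
qed

text \<open>Translations, powers of \<open>rho\<close> and their compositions pull a ball back to a
  ball whose exponent is shifted by a constant \<open>c\<close>. This single property yields
  measurability here, and in the following lemmas the change of variables with factor p^c.\<close>

lemma measurable_vil_map:
  assumes f: "\<And>x. x \<in> vil p \<Longrightarrow> f x \<in> vil p"
    and pre: "\<And>b m. b \<in> vil p \<Longrightarrow> \<exists>b'\<in>vil p. {x \<in> vil p. f x \<in> vball p b m} = vball p b' (m + c)"
  shows "f \<in> measurable M M"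
proof (rule measurable_sigma_sets[OF sets_M vballs_Pow])
  show "f \<in> space M \<rightarrow> vil p" using f by auto
  fix S assume "S \<in> vballs p"
  then consider "S = {}" | b m where "S = vball p b m" "b \<in> vil p" by (auto simp: vballs_def)
  then show "f -` S \<inter> space M \<in> sets M"
  proof cases
    case (2 b m)
    then obtain b' where "b' \<in> vil p" "{x \<in> vil p. f x \<in> vball p b m} = vball p b' (m + c)" using pre by blast
    moreover have "f -` S \<inter> space M = {x \<in> vil p. f x \<in> vball p b m}" using 2 by auto
    ultimately show ?thesis by simp
  qed simp
qed

lemma distr_vil_map:
  assumes f: "\<And>x. x \<in> vil p \<Longrightarrow> f x \<in> vil p"
    and pre: "\<And>b m. b \<in> vil p \<Longrightarrow> \<exists>b'\<in>vil p. {x \<in> vil p. f x \<in> vball p b m} = vball p b' (m + c)"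
  shows "distr M M f = density M (\<lambda>_. ennreal (real_of_int p powi c))"
proof -
  have m: "f \<in> measurable M M" using measurable_vil_map[OF assms] .
  have pp: "real_of_int p > 0" using p_pos by simp
  \<comment> \<open>Rescaling by p^(-c) restores the values on balls, so uniqueness identifies the
    rescaled image measure with \<open>M\<close>.\<close>
  have "density (distr M M f) (\<lambda>_. ennreal (real_of_int p powi (-c))) = M"
  proof (rule haar_unique)
    fix b m' assume b: "b \<in> vil p"
    then obtain b' where b': "b' \<in> vil p" "{x \<in> vil p. f x \<in> vball p b m'} = vball p b' (m' + c)"
      using pre by blast
    have "emeasure (density (distr M M f) (\<lambda>_. ennreal (real_of_int p powi (-c)))) (vball p b m') =
        ennreal (real_of_int p powi (-c)) * emeasure M (f -` vball p b m' \<inter> space M)"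
      using b m by (simp add: emeasure_density_const emeasure_distr)
    also have "f -` vball p b m' \<inter> space M = vball p b' (m' + c)" using b' by auto
    also have "ennreal (real_of_int p powi (-c)) * emeasure M \<dots> = ennreal (real_of_int p powi (-c) * real_of_int p powi (m' + c))"
      using b' pp by (simp add: emeasure_vball ennreal_mult)
    also have "real_of_int p powi (-c) * real_of_int p powi (m' + c) = real_of_int p powi m'"
      using pp by (simp flip: power_int_add)
    finally show "emeasure (density (distr M M f) (\<lambda>_. ennreal (real_of_int p powi (-c)))) (vball p b m') =
        ennreal (real_of_int p powi m')" .
  qed simp
  then have "density M (\<lambda>_. ennreal (real_of_int p powi c)) =
      density (density (distr M M f) (\<lambda>_. ennreal (real_of_int p powi (-c)))) (\<lambda>_. ennreal (real_of_int p powi c))"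
    by simp
  also have "\<dots> = density (distr M M f) (\<lambda>_. 1)"
    using pp by (subst density_density_eq) (auto simp: ennreal_mult[symmetric] power_int_minus)
  finally show ?thesis by (simp add: density_1)
qed

lemma emeasure_vil_map:
  assumes "\<And>x. x \<in> vil p \<Longrightarrow> f x \<in> vil p"
    and "\<And>b m. b \<in> vil p \<Longrightarrow> \<exists>b'\<in>vil p. {x \<in> vil p. f x \<in> vball p b m} = vball p b' (m + c)"
    and A: "A \<in> sets M"
  shows "emeasure M {x \<in> vil p. f x \<in> A} = ennreal (real_of_int p powi c) * emeasure M A"
proof -
  have "emeasure M {x \<in> vil p. f x \<in> A} = emeasure (distr M M f) A"
    using measurable_vil_map[OF assms(1,2)] A
    by (subst emeasure_distr) (auto intro!: arg_cong[where f="emeasure M"])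
  then show ?thesis using A by (simp add: distr_vil_map[OF assms(1,2)] emeasure_density_const)
qed

lemma integral_vil_map:
  fixes g :: "vseq \<Rightarrow> 'b :: {banach, second_countable_topology}"
  assumes "\<And>x. x \<in> vil p \<Longrightarrow> f x \<in> vil p"
    and "\<And>b m. b \<in> vil p \<Longrightarrow> \<exists>b'\<in>vil p. {x \<in> vil p. f x \<in> vball p b m} = vball p b' (m + c)"
    and g: "g \<in> borel_measurable M"
  shows "(LINT x|M. g (f x)) = (real_of_int p powi c) *\<^sub>R (LINT x|M. g x)"
proof -
  have pp: "real_of_int p > 0" using p_pos by simp
  have "(LINT x|M. g (f x)) = (LINT x|distr M M f. g x)"
    by (rule integral_distr[symmetric, OF measurable_vil_map[OF assms(1,2)] g])
  also have "\<dots> = (LINT x|density M (\<lambda>_. ennreal (real_of_int p powi c)). g x)"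
    by (simp add: distr_vil_map[OF assms(1,2)])
  also have "\<dots> = (real_of_int p powi c) *\<^sub>R (LINT x|M. g x)"
    using pp g by (subst integral_density) auto
  finally show ?thesis .
qed

lemma integrable_vil_map:
  fixes g :: "vseq \<Rightarrow> 'b :: {banach, second_countable_topology}"
  assumes "\<And>x. x \<in> vil p \<Longrightarrow> f x \<in> vil p"
    and "\<And>b m. b \<in> vil p \<Longrightarrow> \<exists>b'\<in>vil p. {x \<in> vil p. f x \<in> vball p b m} = vball p b' (m + c)"
    and g: "integrable M g"
  shows "integrable M (\<lambda>x. g (f x))"
proof -
  have pp: "real_of_int p > 0" using p_pos by simp
  have "integrable (density M (\<lambda>_. ennreal (real_of_int p powi c))) g"
    using pp g by (subst integrable_density) auto
  then have "integrable (distr M M f) g" by (simp only: distr_vil_map[OF assms(1,2)])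
  with measurable_vil_map[OF assms(1,2)] show ?thesis by (rule integrable_distr[where f=g])
qed

text \<open>The exponent is written \<open>m + 0\<close> to match the change of variables lemmas
  with \<open>c = 0\<close>.\<close>

lemma vil_add_pre:
  assumes "a \<in> vil p" "b \<in> vil p"
  shows "\<exists>b'\<in>vil p. {x \<in> vil p. vil_add p a x \<in> vball p b m} = vball p b' (m + 0)"
proof -
  have "{x \<in> vil p. vil_add p a x \<in> vball p b m} = vball p (vil_sub p b a) (m + 0)"
    using assms vball_sub_vil[of "vil_sub p b a" m] by (auto simp: vball_add_iff)
  then show ?thesis using assms by blast
qed

lemma vil_sub_pre:
  assumes "a \<in> vil p" "b \<in> vil p"
  shows "\<exists>b'\<in>vil p. {x \<in> vil p. vil_sub p x a \<in> vball p b m} = vball p b' (m + 0)"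
proof -
  have "{x \<in> vil p. vil_sub p x a \<in> vball p b m} = vball p (vil_add p b a) (m + 0)"
    using assms vball_sub_vil[of "vil_add p b a" m] by (auto simp: vball_sub_iff)
  then show ?thesis using assms by blast
qed

lemma rho_pow_pre:
  assumes "b \<in> vil p"
  shows "\<exists>b'\<in>vil p. {x \<in> vil p. rho_pow k x \<in> vball p b m} = vball p b' (m + - k)"
proof -
  have "{x \<in> vil p. rho_pow k x \<in> vball p b m} = vball p (rho_pow (-k) b) (m + - k)"
    using assms vball_sub_vil[of "rho_pow (-k) b" "m - k"] by (auto simp: rho_pow_vball_iff)
  then show ?thesis using assms by blast
qed

lemma sets_vil_coord: "{x \<in> vil p. P (x j)} \<in> sets M"
proof (rule sets_locally_ball)
  fix x assume "x \<in> {x \<in> vil p. P (x j)}"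
  then have "vball p x (-j) \<subseteq> {x \<in> vil p. P (x j)}" by (auto simp: vball_def)
  then show "\<exists>m. vball p x m \<subseteq> {x \<in> vil p. P (x j)}" ..
qed blast

lemma measurable_coord: "(\<lambda>x. x j) \<in> measurable M (count_space UNIV)"
proof (rule measurableI)
  fix A :: "int set"
  have "(\<lambda>x. x j) -` A \<inter> space M = {x \<in> vil p. x j \<in> A}" by auto
  then show "(\<lambda>x. x j) -` A \<inter> space M \<in> sets M" using sets_vil_coord[of "\<lambda>d. d \<in> A" j] by simp
qed simp

end

subsection \<open>Characters\<close>

text \<open>Keeping the integer exponent separate turns identities between characters into
  congruences modulo \<open>p\<close>.\<close>

definition vroot :: "int \<Rightarrow> int \<Rightarrow> complex" where
  "vroot p k = exp (2 * complex_of_real pi * \<i> / of_int p * of_int k)"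

definition vpair :: "vseq \<Rightarrow> vseq \<Rightarrow> int" where
  "vpair x w = Sum_any (\<lambda>j. x j * w (1 - j))"

text \<open>The sign \<open>s\<close> lets the transform (\<open>s = -1\<close>) and its inverse (\<open>s = 1\<close>) be treated at once.\<close>

definition vch :: "int \<Rightarrow> int \<Rightarrow> vseq \<Rightarrow> vseq \<Rightarrow> complex" where
  "vch p s x w = vroot p (s * vpair x w)"

context vilenkin_base
begin

lemma vroot_add: "vroot p (k + l) = vroot p k * vroot p l"
  by (simp add: vroot_def distrib_left exp_add)

lemma vroot_0 [simp]: "vroot p 0 = 1"
  by (simp add: vroot_def)

lemma vroot_eq_1_iff: "vroot p k = 1 \<longleftrightarrow> p dvd k"
proof -
  have z: "2 * complex_of_real pi * \<i> / of_int p * of_int k = \<i> * of_real (2 * pi * (of_int k / of_int p))"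
    by simp
  have "vroot p k = 1 \<longleftrightarrow> (\<exists>n::int. 2 * pi * (of_int k / of_int p) = of_int (2 * n) * pi)"
    unfolding vroot_def z exp_eq_1 by simp
  also have "\<dots> \<longleftrightarrow> (\<exists>n::int. real_of_int k = of_int (p * n))"
    using p_pos by (auto simp: field_simps)
  also have "\<dots> \<longleftrightarrow> p dvd k" by (auto simp: dvd_def simp del: of_int_mult)
  finally show ?thesis .
qed

lemma vroot_diff_mult [simp]: "vroot p (k - p * l) = vroot p k"
proof -
  have "vroot p (k - p * l) * vroot p (p * l) = vroot p k" by (simp add: vroot_add[symmetric])
  moreover have "vroot p (p * l) = 1" by (simp add: vroot_eq_1_iff)
  ultimately show ?thesis by simp
qed

lemma vroot_sum: "finite A \<Longrightarrow> vroot p (s * sum f A) = (\<Prod>j\<in>A. vroot p (s * f j))"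
  by (induction A rule: finite_induct) (auto simp: distrib_left vroot_add)

lemma cnj_vroot: "cnj (vroot p k) = vroot p (- k)"
  by (simp add: vroot_def exp_cnj)

lemma norm_vroot [simp]: "cmod (vroot p k) = 1"
proof -
  have z: "2 * complex_of_real pi * \<i> / of_int p * of_int k = \<i> * of_real (2 * pi * (of_int k / of_int p))"
    by simp
  show ?thesis unfolding vroot_def z by (rule norm_exp_i_times)
qed

lemma cnj_vch: "cnj (vch p s x w) = vch p (- s) x w"
  by (simp add: vch_def cnj_vroot)

lemma norm_vch [simp]: "cmod (vch p s x w) = 1"
  by (simp add: vch_def)

lemma vil_chi_eq: "vil_chi p x w = vch p 1 x w"
  by (simp add: vil_chi_def vch_def vroot_def vpair_def)

text \<open>Agreement on every sufficiently large window allows several pairings to be compared on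
  one common window, and makes characters pointwise limits of functions of finitely many
  digits.\<close>

lemma vpair_window:
  assumes "x \<in> vil p" "w \<in> vil p"
  obtains N where "\<forall>n\<ge>N. vpair x w = (\<Sum>j\<in>{- int n..int n}. x j * w (1 - j))"
proof -
  obtain k where k: "\<forall>j<k. x j = 0" using vilE[OF assms(1)] .
  obtain l where l: "\<forall>j<l. w j = 0" using vilE[OF assms(2)] .
  have "vpair x w = (\<Sum>j\<in>{- int n..int n}. x j * w (1 - j))" if "n \<ge> nat (max \<bar>k\<bar> \<bar>1 - l\<bar>)" for n
    unfolding vpair_def
  proof (rule Sum_any.expand_superset)
    show "{j. x j * w (1 - j) \<noteq> 0} \<subseteq> {- int n..int n}"
    proof
      fix j assume "j \<in> {j. x j * w (1 - j) \<noteq> 0}"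
      then have "\<not> j < k" "\<not> 1 - j < l" using k l by auto
      then show "j \<in> {- int n..int n}" using that by auto
    qed
  qed simp
  then show ?thesis using that by blast
qed

lemma vpair_commute: "vpair x w = vpair w x"
  unfolding vpair_def
proof (rule Sum_any.reindex_cong[where l="\<lambda>j. 1 - j"])
  show "bij ((-) (1::int))" by (rule bijI') (auto intro: exI[of _ "1 - _"])
qed (simp add: fun_eq_iff mult.commute)

lemma vpair_rho_pow: "vpair (rho_pow k x) w = vpair x (rho_pow k w)"
  unfolding vpair_def rho_pow_def
proof (rule Sum_any.reindex_cong[where l="\<lambda>j. j - k"])
  show "bij (\<lambda>j::int. j - k)" by (rule bijI') (auto intro: exI[of _ "_ + k"])
qed (simp add: fun_eq_iff algebra_simps)

lemma vch_commute: "vch p s x w = vch p s w x"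
  unfolding vch_def by (subst vpair_commute) simp

lemma vch_rho_pow: "vch p s (rho_pow k x) w = vch p s x (rho_pow k w)"
  by (simp add: vch_def vpair_rho_pow)

lemma vch_add:
  assumes "x \<in> vil p" "y \<in> vil p" "w \<in> vil p"
  shows "vch p s (vil_add p x y) w = vch p s x w * vch p s y w"
proof -
  obtain K where K: "\<forall>n\<ge>K. vpair x w = (\<Sum>j\<in>{- int n..int n}. x j * w (1 - j))"
    using vpair_window[OF assms(1,3)] .
  obtain L where L: "\<forall>n\<ge>L. vpair y w = (\<Sum>j\<in>{- int n..int n}. y j * w (1 - j))"
    using vpair_window[OF assms(2,3)] .
  obtain N where N: "\<forall>n\<ge>N. vpair (vil_add p x y) w = (\<Sum>j\<in>{- int n..int n}. vil_add p x y j * w (1 - j))"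
    using vpair_window[OF vil_add_in[OF assms(1,2)] assms(3)] .
  define n where "n = max N (max K L)"
  have t: "vroot p (s * (vil_add p x y j * w (1 - j))) =
      vroot p (s * (x j * w (1 - j))) * vroot p (s * (y j * w (1 - j)))" for j
  proof -
    \<comment> \<open>Reducing the digit sum modulo \<open>p\<close> changes it by a multiple of
      \<open>p\<close>, which the root of unity does not see.\<close>
    have v: "vil_add p x y j = x j + y j - p * ((x j + y j) div p)"
      by (simp add: vil_add_def minus_mult_div_eq_mod)
    have "s * (vil_add p x y j * w (1 - j)) =
        (s * (x j * w (1 - j)) + s * (y j * w (1 - j))) - p * (((x j + y j) div p) * s * w (1 - j))"
      unfolding v by (simp add: algebra_simps)
    then show ?thesis by (simp only: vroot_diff_mult vroot_add)
  qed
  have "vpair (vil_add p x y) w = (\<Sum>j\<in>{- int n..int n}. vil_add p x y j * w (1 - j))"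
    "vpair x w = (\<Sum>j\<in>{- int n..int n}. x j * w (1 - j))"
    "vpair y w = (\<Sum>j\<in>{- int n..int n}. y j * w (1 - j))"
    using K L N by (auto simp: n_def)
  then show ?thesis unfolding vch_def by (simp add: vroot_sum t prod.distrib)
qed

lemma vch_sub:
  assumes "x \<in> vil p" "y \<in> vil p" "w \<in> vil p"
  shows "vch p s (vil_sub p x y) w = vch p s x w * vch p (- s) y w"
proof -
  have 1: "vch p s y w * vch p (- s) y w = 1"
    unfolding vch_def by (simp flip: vroot_add)
  have "vch p s x w = vch p s y w * vch p s (vil_sub p x y) w"
    using vch_add[OF assms(2) vil_sub_in[OF assms(1,2)] assms(3), of s] assms by simp
  then have "vch p s x w * vch p (- s) y w = (vch p s y w * vch p (- s) y w) * vch p s (vil_sub p x y) w"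
    by (simp add: mult.commute mult.left_commute)
  then show ?thesis by (simp add: 1)
qed

text \<open>In each term of the pairing one factor vanishes: \<open>x j\<close> for
  \<open>j \<le> -m\<close>, and \<open>w (1 - j)\<close> otherwise. Together with
  \<open>vch_neq_1\<close> this says that the balls about 0 of exponents \<open>m\<close> and
  \<open>- m\<close> annihilate each other.\<close>

lemma vch_eq_1:
  assumes "x \<in> vball p vil_zero m" "w \<in> vball p vil_zero (- m)"
  shows "vch p s x w = 1"
proof -
  have "x j * w (1 - j) = 0" for j
    using assms by (cases "j \<le> -m") (auto simp: vball_def vil_zero_def)
  then have "vpair x w = 0" unfolding vpair_def by (simp only: Sum_any.neutral)
  then show ?thesis by (simp add: vch_def)
qed

text \<open>At every position one of the two digits is 0. It makes the characters with index in
  \<open>vil_Lambda p\<close> periodic modulo \<open>vil_Lambda p\<close>.\<close>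

lemma vch_Lambda_eq_1:
  assumes "x \<in> vil_Lambda p" "w \<in> vil_Lambda p"
  shows "vch p s x w = 1"
proof -
  have "x j * w (1 - j) = 0" for j
    using assms by (cases "j > 0") (auto simp: vil_Lambda_def)
  then have "vpair x w = 0" unfolding vpair_def by (simp only: Sum_any.neutral)
  then show ?thesis by (simp add: vch_def)
qed

lemma vch_neq_1:
  assumes "x \<in> vil p" "x \<notin> vball p vil_zero m" "s = 1 \<or> s = -1"
  obtains w where "w \<in> vball p vil_zero (- m)" "vch p s x w \<noteq> 1"
proof -
  obtain i where i: "i \<le> - m" "x i \<noteq> 0" using assms by (auto simp: vball_def vil_zero_def)
  \<comment> \<open>A single digit 1 at \<open>1 - i\<close> is paired with exactly the digit
    \<open>x i\<close>, which lies strictly between 0 and \<open>p\<close>.\<close>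
  define w where "w = (\<lambda>j. if j = 1 - i then 1 else 0 :: int)"
  have wv: "w \<in> vil p" unfolding w_def by (rule single_in_vil) (use p2 in auto)
  then have "w \<in> vball p vil_zero (- m)" using i by (auto simp: vball_def vil_zero_def w_def)
  moreover have "vpair x w = x i"
  proof -
    have "vpair x w = (\<Sum>j\<in>{i}. x j * w (1 - j))"
      unfolding vpair_def by (rule Sum_any.expand_superset) (auto simp: w_def)
    then show ?thesis by (simp add: w_def)
  qed
  moreover have "\<not> p dvd s * x i"
    using i vil_bounds[OF assms(1), of i] zdvd_not_zless[of "x i" p] assms(3) by auto
  ultimately show ?thesis using that[of w] by (simp add: vch_def vroot_eq_1_iff)
qed

end

context vilenkin
begin

text \<open>Joint measurability is what Fubini requires. The windowed exponentials depend on
  finitely many digits and are at each point eventually equal to the character.\<close>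

lemma measurable_vch_pair: "(\<lambda>(x, w). vch p s x w) \<in> borel_measurable (M \<Otimes>\<^sub>M M)"
proof (rule borel_measurable_LIMSEQ_metric)
  let ?f = "\<lambda>n (x, w). exp (2 * complex_of_real pi * \<i> / of_int p *
    (of_int s * (\<Sum>j\<in>{- int n..int n}. of_int (x j) * of_int (w (1 - j)))))"
  have c: "(\<lambda>x. complex_of_int (x j)) \<in> borel_measurable M" for j
    by (rule measurable_compose[OF measurable_coord]) simp
  have 1: "(\<lambda>z. complex_of_int (fst z j)) \<in> borel_measurable (M \<Otimes>\<^sub>M M)" for j
    by (rule measurable_compose[OF measurable_fst c])
  have 2: "(\<lambda>z. complex_of_int (snd z j)) \<in> borel_measurable (M \<Otimes>\<^sub>M M)" for j
    by (rule measurable_compose[OF measurable_snd c])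
  have ex: "(\<lambda>z. exp (c * z)) \<in> borel_measurable borel" for c :: complex
    by (intro borel_measurable_continuous_onI continuous_intros)
  show "?f n \<in> borel_measurable (M \<Otimes>\<^sub>M M)" for n
    unfolding case_prod_beta
    by (rule measurable_compose[OF _ ex])
       (intro borel_measurable_times borel_measurable_sum 1 2 borel_measurable_const)
  fix z assume "z \<in> space (M \<Otimes>\<^sub>M M)"
  then obtain x w where z: "z = (x, w)" "x \<in> vil p" "w \<in> vil p" by (auto simp: space_pair_measure)
  obtain N where "\<forall>n\<ge>N. vpair x w = (\<Sum>j\<in>{- int n..int n}. x j * w (1 - j))"
    using vpair_window[OF z(2,3)] .
  then have "\<forall>n\<ge>N. ?f n z = vch p s x w" by (simp add: z vch_def vroot_def)
  then show "(\<lambda>n. ?f n z) \<longlonglongrightarrow> (\<lambda>(x, w). vch p s x w) z"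
    unfolding z by (intro tendsto_eventually) (auto simp: eventually_sequentially)
qed

lemma measurable_vch:
  assumes "x \<in> vil p"
  shows "vch p s x \<in> borel_measurable M"
  using measurable_compose[OF measurable_Pair1'[of x M M] measurable_vch_pair[of s]] assms by simp

lemma measurable_vch':
  assumes "w \<in> vil p"
  shows "(\<lambda>x. vch p s x w) \<in> borel_measurable M"
  using measurable_vch[OF assms] by (subst vch_commute)

lemma integrable_indicator_vball:
  assumes "a \<in> vil p"
  shows "integrable M (indicator (vball p a m) :: _ \<Rightarrow> complex)"
  by (rule integrable_indicator_complex) (use assms in \<open>auto simp: emeasure_vball\<close>)

lemma integrable_mult_vch:
  assumes "integrable M F" "x \<in> vil p"
  shows "integrable M (\<lambda>w. F w * vch p s x w)"
proof (rule Bochner_Integration.integrable_bound[OF assms(1)])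
  show "(\<lambda>w. F w * vch p s x w) \<in> borel_measurable M"
    using assms measurable_vch by (intro borel_measurable_times) auto
qed (simp add: norm_mult)

text \<open>Either the character is trivial on the ball, or translation by a point \<open>w0\<close>
  of the ball where its value is not 1 multiplies the integral by that value and so forces it to be
  0.\<close>

lemma integral_vch_vball:
  assumes a: "a \<in> vil p" and s: "s = 1 \<or> s = -1"
  shows "(LINT w|M. indicator (vball p vil_zero m) w * vch p s a w) =
    (if a \<in> vball p vil_zero (- m) then complex_of_real (real_of_int p powi m) else 0)"
proof (cases "a \<in> vball p vil_zero (- m)")
  case True
  have "(LINT w|M. indicator (vball p vil_zero m) w * vch p s a w) =
      (LINT w|M. indicator (vball p vil_zero m) w)"
  proof (rule Bochner_Integration.integral_cong[OF refl])
    fix w show "indicator (vball p vil_zero m) w * vch p s a w = indicator (vball p vil_zero m) w"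
      using vch_eq_1[OF True, of w s] by (simp add: indicator_def)
  qed
  also have "\<dots> = complex_of_real (measure M (vball p vil_zero m))"
  proof -
    have "(LINT w|M. indicator (vball p vil_zero m) w) =
        (LINT w|M. complex_of_real (indicator (vball p vil_zero m) w))"
      by (rule Bochner_Integration.integral_cong) (simp_all add: indicator_def)
    also have "\<dots> = complex_of_real (LINT w|M. indicator (vball p vil_zero m) w)"
      by (rule integral_complex_of_real)
    finally show ?thesis using vball_sub_vil[of vil_zero m] by (simp add: Int_absorb2)
  qed
  also have "measure M (vball p vil_zero m) = real_of_int p powi m"
    using p_pos by (simp add: measure_def emeasure_vball)
  finally show ?thesis using True by simp
next
  case False
  obtain w0 where w0: "w0 \<in> vball p vil_zero m" "vch p s a w0 \<noteq> 1"
    using vch_neq_1[OF a False s] by auto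
  have w0v: "w0 \<in> vil p" using w0(1) by (rule vball_vil)
  let ?h = "\<lambda>w. indicator (vball p vil_zero m) w * vch p s a w"
  have hm: "?h \<in> borel_measurable M" using measurable_vch[OF a] vball_sets[OF vil_zero_in]
    by (intro borel_measurable_times borel_measurable_indicator)
  have inv: "(LINT w|M. ?h (vil_add p w0 w)) = (real_of_int p powi 0) *\<^sub>R (LINT w|M. ?h w)"
    by (rule integral_vil_map[OF vil_add_in[OF w0v] vil_add_pre[OF w0v] hm])
  have "(LINT w|M. ?h (vil_add p w0 w)) = (LINT w|M. vch p s a w0 * ?h w)"
  proof (rule Bochner_Integration.integral_cong[OF refl])
    fix w assume "w \<in> space M"
    then have w: "w \<in> vil p" by simp
    \<comment> \<open>The ball about 0 is a subgroup, hence invariant under translation by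
      \<open>w0\<close>.\<close>
    have "vil_add p w0 w \<in> vball p vil_zero m \<longleftrightarrow> vil_zero \<in> vball p (vil_add p w w0) m"
      using w w0v by (auto simp: vball_def vil_add_commute)
    also have "\<dots> \<longleftrightarrow> vil_sub p vil_zero w0 \<in> vball p w m" using vball_sub_iff[OF vil_zero_in w0v w] by simp
    also have "\<dots> \<longleftrightarrow> w \<in> vball p vil_zero m"
      using w w0v w0(1) vil_sub_in[OF vil_zero_in w0v] by (auto simp: vball_def vil_sub_def vil_zero_def)
    finally have "indicator (vball p vil_zero m) (vil_add p w0 w) = (indicator (vball p vil_zero m) w :: complex)"
      by (simp add: indicator_def)
    moreover have "vch p s a (vil_add p w0 w) = vch p s a w0 * vch p s a w"
      using vch_add[OF w0v w a, of s] by (simp add: vch_commute[of s a])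
    ultimately show "?h (vil_add p w0 w) = vch p s a w0 * ?h w" by simp
  qed
  then have "(LINT w|M. ?h w) = vch p s a w0 * (LINT w|M. ?h w)" using inv by simp
  then have "(1 - vch p s a w0) * (LINT w|M. ?h w) = 0" by (simp add: left_diff_distrib)
  then show ?thesis using False w0 by simp
qed

subsection \<open>The Fourier transform\<close>

definition fou :: "int \<Rightarrow> (vseq \<Rightarrow> complex) \<Rightarrow> vseq \<Rightarrow> complex" where
  "fou s f w = (LINT x|M. f x * vch p s x w)"

lemma vil_fourier_eq: "vil_fourier p M = fou (-1)"
  by (simp add: fun_eq_iff vil_fourier_def fou_def vil_chi_eq cnj_vch)

lemma vil_inv_fourier_eq: "vil_inv_fourier p M = fou 1"
  by (simp add: fun_eq_iff vil_inv_fourier_def fou_def vil_chi_eq vch_commute)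

lemma measurable_fou:
  assumes "f \<in> borel_measurable M"
  shows "fou s f \<in> borel_measurable M"
proof -
  have "(\<lambda>(w, x). f x * vch p s x w) \<in> borel_measurable (M \<Otimes>\<^sub>M M)"
  proof -
    have "(\<lambda>z. f (snd z) * (case z of (x, w) \<Rightarrow> vch p s x w)) \<in> borel_measurable (M \<Otimes>\<^sub>M M)"
      by (intro borel_measurable_times measurable_vch_pair measurable_compose[OF measurable_snd assms])
    then show ?thesis by (simp add: case_prod_beta vch_commute)
  qed
  from borel_measurable_lebesgue_integral[OF this] show ?thesis by (simp add: fou_def[abs_def])
qed

lemma fou_add:
  assumes "integrable M f" "integrable M g" "w \<in> vil p"
  shows "fou s (\<lambda>x. f x + g x) w = fou s f w + fou s g w"
  unfolding fou_def
  using integrable_mult_vch[OF assms(1,3), of s] integrable_mult_vch[OF assms(2,3), of s]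
  by (simp add: distrib_right vch_commute[of s _ w])

lemma fou_scale: "fou s (\<lambda>x. c * f x) w = c * fou s f w"
  unfolding fou_def by (simp add: mult.assoc)

lemma fou_cong: "(\<And>x. x \<in> vil p \<Longrightarrow> f x = g x) \<Longrightarrow> fou s f w = fou s g w"
  unfolding fou_def by (rule Bochner_Integration.integral_cong) simp_all

text \<open>Fubini for a kernel of modulus \<open>cmod (F x) * cmod (G w)\<close>. After conjugation
  it makes \<open>fou (- s)\<close> the adjoint of \<open>fou s\<close>.\<close>

lemma fou_multiplication:
  assumes F: "integrable M F" and G: "integrable M G"
  shows "(LINT w|M. fou s F w * G w) = (LINT x|M. F x * fou s G x)"
proof -
  interpret PP: pair_sigma_finite M M ..
  let ?h = "\<lambda>x w. F x * vch p s x w * G w"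
  have hm: "case_prod ?h \<in> borel_measurable (M \<Otimes>\<^sub>M M)"
  proof -
    have "(\<lambda>z. F (fst z) * (case z of (x, w) \<Rightarrow> vch p s x w) * G (snd z)) \<in> borel_measurable (M \<Otimes>\<^sub>M M)"
      by (intro borel_measurable_times measurable_vch_pair measurable_compose[OF measurable_fst borel_measurable_integrable[OF F]]
          measurable_compose[OF measurable_snd borel_measurable_integrable[OF G]])
    then show ?thesis by (simp add: case_prod_beta)
  qed
  have int: "integrable (M \<Otimes>\<^sub>M M) (case_prod ?h)"
  proof (rule PP.Fubini_integrable[OF hm])
    show "integrable M (\<lambda>x. LINT w|M. norm (case (x, w) of (x, w) \<Rightarrow> ?h x w))"
      using F by (simp add: norm_mult)
    have "integrable M (\<lambda>w. case (x, w) of (x, w) \<Rightarrow> ?h x w)" if "x \<in> space M" for x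
    proof -
      have "integrable M (\<lambda>w. F x * (G w * vch p s x w))"
        using integrable_mult_vch[OF G, of x s] that by (intro integrable_mult_right) simp
      then show ?thesis by (simp add: mult.commute mult.left_commute)
    qed
    then show "AE x in M. integrable M (\<lambda>w. case (x, w) of (x, w) \<Rightarrow> ?h x w)" by (rule AE_I2)
  qed
  have "(LINT w|M. fou s F w * G w) = (LINT w|M. LINT x|M. ?h x w)"
  proof (rule Bochner_Integration.integral_cong[OF refl])
    fix w assume "w \<in> space M"
    then have "integrable M (\<lambda>x. F x * vch p s x w)"
      using integrable_mult_vch[OF F, of w s] by (simp add: vch_commute[of s _ w])
    then show "fou s F w * G w = (LINT x|M. ?h x w)"
      unfolding fou_def by simp
  qed
  also have "\<dots> = (LINT x|M. LINT w|M. ?h x w)" by (rule PP.Fubini_integral[OF int])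
  also have "\<dots> = (LINT x|M. F x * fou s G x)"
  proof (rule Bochner_Integration.integral_cong[OF refl])
    fix x assume "x \<in> space M"
    have "(LINT w|M. ?h x w) = (LINT w|M. F x * (G w * vch p s w x))"
      by (rule Bochner_Integration.integral_cong) (simp_all add: vch_commute[of s x] mult_ac)
    then show "(LINT w|M. ?h x w) = F x * fou s G x" by (simp add: fou_def)
  qed
  finally show ?thesis .
qed

lemma cnj_fou: "cnj (fou s G x) = fou (- s) (\<lambda>x. cnj (G x)) x"
  unfolding fou_def by (simp flip: Bochner_Integration.integral_cnj add: cnj_vch)

lemma fou_inner:
  assumes F: "integrable M F" and G: "integrable M G"
  shows "L2_inner M (fou s F) G = L2_inner M F (fou (- s) G)"
  using fou_multiplication[OF F, of "\<lambda>x. cnj (G x)" s] G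
  by (simp add: L2_inner_def cnj_fou)

text \<open>Centring the ball by a substitution leaves the integral of a character over a ball about
  0. The result is again a multiple of a ball indicator times a character, so inversion can be
  verified by direct computation.\<close>

lemma fou_vball:
  assumes a: "a \<in> vil p" and w: "w \<in> vil p" and s: "s = 1 \<or> s = -1"
  shows "fou s (indicator (vball p a m)) w =
    complex_of_real (real_of_int p powi m) * vch p s a w * indicator (vball p vil_zero (- m)) w"
proof -
  let ?h = "\<lambda>x. indicator (vball p a m) x * vch p s x w"
  have hm: "?h \<in> borel_measurable M"
    using measurable_vch'[OF w] vball_sets[OF a] by (intro borel_measurable_times borel_measurable_indicator)
  have "fou s (indicator (vball p a m)) w = (LINT x|M. ?h (vil_add p a x))"
    using integral_vil_map[OF vil_add_in[OF a] vil_add_pre[OF a] hm] by (simp add: fou_def)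
  also have "\<dots> = (LINT x|M. vch p s a w * (indicator (vball p vil_zero m) x * vch p s w x))"
  proof (rule Bochner_Integration.integral_cong[OF refl])
    fix x assume "x \<in> space M"
    then have x: "x \<in> vil p" by simp
    have "vil_add p a x \<in> vball p a m \<longleftrightarrow> x \<in> vball p vil_zero m"
      using vball_zero_sub_iff[OF vil_add_in[OF a x] a, of m] x by (simp add: vil_add_commute)
    then show "?h (vil_add p a x) = vch p s a w * (indicator (vball p vil_zero m) x * vch p s w x)"
      by (simp add: indicator_def vch_add[OF a x w] vch_commute[of s w])
  qed
  also have "\<dots> = vch p s a w * (LINT x|M. indicator (vball p vil_zero m) x * vch p s w x)" by simp
  finally show ?thesis unfolding integral_vch_vball[OF w s] by (simp add: indicator_def)
qed

text \<open>The character with index \<open>vil_sub p a x\<close> has a nonzero integral over the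
  dual ball exactly when \<open>x\<close> lies in the original ball, and then the factors p^m and
  p^(-m) cancel.\<close>

lemma fou_fou_vball:
  assumes a: "a \<in> vil p" and x: "x \<in> vil p" and s: "s = 1 \<or> s = -1"
  shows "fou (- s) (fou s (indicator (vball p a m))) x = indicator (vball p a m) x"
proof -
  have "fou (- s) (fou s (indicator (vball p a m))) x =
      (LINT w|M. complex_of_real (real_of_int p powi m) *
        (indicator (vball p vil_zero (- m)) w * vch p s (vil_sub p a x) w))"
    unfolding fou_def[of "- s"]
  proof (rule Bochner_Integration.integral_cong[OF refl])
    fix w assume "w \<in> space M"
    then have w: "w \<in> vil p" by simp
    show "fou s (indicator (vball p a m)) w * vch p (- s) w x =
      complex_of_real (real_of_int p powi m) * (indicator (vball p vil_zero (- m)) w * vch p s (vil_sub p a x) w)"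
      unfolding fou_vball[OF a w s] vch_sub[OF a x w] by (simp add: vch_commute[of "- s" w])
  qed
  also have "\<dots> = complex_of_real (real_of_int p powi m) *
      (if vil_sub p a x \<in> vball p vil_zero m then complex_of_real (real_of_int p powi - m) else 0)"
    using integral_vch_vball[OF vil_sub_in[OF a x] s, of "- m"] by simp
  also have "\<dots> = (if a \<in> vball p x m then 1 else 0)"
    using p_pos vball_zero_sub_iff[OF a x, of m] by (simp add: power_int_minus flip: of_real_mult)
  also have "\<dots> = indicator (vball p a m) x" using a x by (auto simp: vball_def indicator_def)
  finally show ?thesis .
qed

end

subsection \<open>Plancherel theorem\<close>

lemma L2_tendsto_add:
  assumes "L2_tendsto M F f" "L2_tendsto M G g"
  shows "L2_tendsto M (\<lambda>k x. F k x + G k x) (\<lambda>x. f x + g x)"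
proof -
  have F: "F k \<in> L2_space M" "f \<in> L2_space M" "(\<lambda>k. L2_norm M (\<lambda>x. F k x - f x)) \<longlonglongrightarrow> 0"
    and G: "G k \<in> L2_space M" "g \<in> L2_space M" "(\<lambda>k. L2_norm M (\<lambda>x. G k x - g x)) \<longlonglongrightarrow> 0" for k
    using assms by (auto simp: L2_tendsto_def)
  have "(\<lambda>k. L2_norm M (\<lambda>x. (F k x + G k x) - (f x + g x))) \<longlonglongrightarrow> 0"
  proof (rule Lim_null_comparison)
    show "(\<lambda>k. L2_norm M (\<lambda>x. F k x - f x) + L2_norm M (\<lambda>x. G k x - g x)) \<longlonglongrightarrow> 0"
      using tendsto_add[OF F(3) G(3)] by simp
    have "L2_norm M (\<lambda>x. (F k x + G k x) - (f x + g x)) \<le>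
        L2_norm M (\<lambda>x. F k x - f x) + L2_norm M (\<lambda>x. G k x - g x)" for k
      using L2_norm_triangle[OF L2_diff[OF F(1,2)] L2_diff[OF G(1,2)], of k k] by (simp add: algebra_simps)
    then show "\<forall>\<^sub>F k in sequentially. norm (L2_norm M (\<lambda>x. (F k x + G k x) - (f x + g x)))
        \<le> L2_norm M (\<lambda>x. F k x - f x) + L2_norm M (\<lambda>x. G k x - g x)"
      by simp
  qed
  then show ?thesis using L2_add[OF F(1) G(1)] L2_add[OF F(2) G(2)] by (simp add: L2_tendsto_def)
qed

lemma L2_tendsto_scale:
  assumes "L2_tendsto M F f"
  shows "L2_tendsto M (\<lambda>k x. c * F k x) (\<lambda>x. c * f x)"
proof -
  have F: "F k \<in> L2_space M" "f \<in> L2_space M" "(\<lambda>k. L2_norm M (\<lambda>x. F k x - f x)) \<longlonglongrightarrow> 0" for k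
    using assms by (auto simp: L2_tendsto_def)
  have "L2_norm M (\<lambda>x. c * F k x - c * f x) = cmod c * L2_norm M (\<lambda>x. F k x - f x)" for k
    unfolding right_diff_distrib[symmetric] L2_norm_scale ..
  then have "(\<lambda>k. L2_norm M (\<lambda>x. c * F k x - c * f x)) \<longlonglongrightarrow> 0"
    using tendsto_mult_left[OF F(3), of "cmod c"] by simp
  then show ?thesis using L2_scale[OF F(1)] L2_scale[OF F(2)] by (simp add: L2_tendsto_def)
qed

lemma L2_tendsto_cong_AE:
  assumes "L2_tendsto M F f" "\<And>k. F' k \<in> borel_measurable M" "f' \<in> borel_measurable M"
    and "\<And>k. AE x in M. F k x = F' k x" "AE x in M. f x = f' x"
  shows "L2_tendsto M F' f'"
proof -
  have F: "F k \<in> L2_space M" "f \<in> L2_space M" "(\<lambda>k. L2_norm M (\<lambda>x. F k x - f x)) \<longlonglongrightarrow> 0" for k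
    using assms by (auto simp: L2_tendsto_def)
  have F': "F' k \<in> L2_space M" "f' \<in> L2_space M" for k
    using L2_space_cong_AE[OF F(1) assms(2,4)] L2_space_cong_AE[OF F(2) assms(3,5)] by auto
  have "L2_norm M (\<lambda>x. F k x - f x) = L2_norm M (\<lambda>x. F' k x - f' x)" for k
  proof (rule L2_norm_cong_AE)
    show "(\<lambda>x. F k x - f x) \<in> borel_measurable M" using L2_diff[OF F(1,2)] by (rule L2_spaceD)
    show "(\<lambda>x. F' k x - f' x) \<in> borel_measurable M" using L2_diff[OF F'(1,2)] by (rule L2_spaceD)
    show "AE x in M. cmod (F k x - f x) = cmod (F' k x - f' x)"
      using assms(4)[of k] assms(5) by eventually_elim simp
  qed
  then show ?thesis using F F' by (simp add: L2_tendsto_def)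
qed

context vilenkin
begin

text \<open>Indicators of sets of finite measure suffice; inside one large ball the Dynkin argument
  starts from intersections of balls, which are balls or empty.\<close>

lemma L2_closed_span_vballs:
  "L2_closed_span M (vil p \<times> UNIV) (\<lambda>(a, m). indicator (vball p a m)) = L2_space M"
  (is "?V = _")
proof
  show "?V \<subseteq> L2_space M" using L2_closed_span_space by blast
  have b: "(case i of (a, m) \<Rightarrow> indicator (vball p a m)) \<in> L2_space M" if "i \<in> vil p \<times> UNIV" for i
    using that by (auto intro!: L2_indicator simp: emeasure_vball)
  have V: "L2_closed_subspace M ?V" by (rule L2_closed_subspace_closed_span[OF b])
  have vb: "(indicator (vball p a m) :: _ \<Rightarrow> complex) \<in> ?V" if "a \<in> vil p" for a m
  proof -
    have i: "(a, m) \<in> vil p \<times> UNIV" using that by simp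
    show ?thesis using L2_closed_span_base[where b="\<lambda>(a, m). indicator (vball p a m)", OF b[OF i] i] by simp
  qed
  have "L2_supp M (space M) \<subseteq> ?V"
  proof (rule L2_supp_subset_if_indicators[OF V])
    fix C assume C: "C \<in> sets M" "emeasure M C < \<infinity>"
    \<comment> \<open>Cutting with growing balls provides what the Dynkin argument asks for: an
      ambient set of finite measure whose indicator is in the span.\<close>
    let ?D = "\<lambda>n. vball p vil_zero (int n) \<inter> C"
    have U: "(\<Union>n. ?D n) = C" using UN_vball_zero sets.sets_into_space[OF C(1)] by auto
    have "(indicator (\<Union>n. ?D n) :: _ \<Rightarrow> complex) \<in> ?V"
    proof (rule L2_closed_subspace_indicator_UN[OF V])
      show "?D n \<in> sets M" for n using C by auto
      show "incseq ?D" unfolding incseq_def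
      proof (intro allI impI)
        fix m n :: nat assume "m \<le> n"
        then have "vball p vil_zero (int m) \<subseteq> vball p vil_zero (int n)" by (intro vball_mono) simp
        then show "?D m \<subseteq> ?D n" by blast
      qed
      show "emeasure M (\<Union>n. ?D n) < \<infinity>" unfolding U by (rule C(2))
      fix n
      let ?B = "vball p vil_zero (int n)"
      have "(indicator (?B \<inter> (\<lambda>x. x) -` C) :: _ \<Rightarrow> complex) \<in> ?V"
      proof (rule L2_indicator_Dynkin[OF V _ _ measurable_ident_sets[OF refl, of M], where G="vballs p"])
        show "sets M = sigma_sets (space M) (vballs p)" by (simp add: sets_M)
        show "vballs p \<subseteq> Pow (space M)" using vballs_Pow by simp
        fix A assume "A \<in> vballs p"
        then have "?B \<inter> A \<in> vballs p"
          using Int_stable_vballs by (auto simp: Int_stable_def)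
        then consider "?B \<inter> A = {}" | a m where "?B \<inter> A = vball p a m" "a \<in> vil p"
          unfolding vballs_def by blast
        then have "(indicator (?B \<inter> A) :: _ \<Rightarrow> complex) \<in> ?V"
        proof cases
          case 1
          then have "(indicator (?B \<inter> A) :: _ \<Rightarrow> complex) = (\<lambda>x. 0)"
            by (simp add: fun_eq_iff)
          then show ?thesis using L2_closed_subspaceD(2)[OF V] by (simp only:)
        next
          case 2 then show ?thesis using vb by simp
        qed
        then show "(indicator (?B \<inter> (\<lambda>x. x) -` A) :: _ \<Rightarrow> complex) \<in> ?V" by simp
      qed (use C vb in \<open>auto simp: emeasure_vball Int_stable_vballs\<close>)
      then show "(indicator (?D n) :: _ \<Rightarrow> complex) \<in> ?V" by simp
    qed
    then show "(indicator C :: _ \<Rightarrow> complex) \<in> ?V" unfolding U .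
  qed (rule sets.top)
  then show "L2_space M \<subseteq> ?V" by (simp only: L2_supp_space)
qed

text \<open>Functions for which both transforms are genuine integrals and inversion holds at every
  point of the group. They include the ball indicators and their linear combinations, hence are
  dense, and Plancherel is elementary for them.\<close>

definition fstep :: "int \<Rightarrow> (vseq \<Rightarrow> complex) \<Rightarrow> bool" where
  "fstep s S \<longleftrightarrow> integrable M S \<and> S \<in> L2_space M \<and> integrable M (fou s S) \<and> fou s S \<in> L2_space M \<and>
     (\<forall>x\<in>vil p. fou (- s) (fou s S) x = S x)"

lemma fstep_add:
  assumes "fstep s S" "fstep s T"
  shows "fstep s (\<lambda>x. S x + T x)"
proof -
  have i: "integrable M S" "integrable M T" "integrable M (fou s S)" "integrable M (fou s T)"
    and l: "S \<in> L2_space M" "T \<in> L2_space M" "fou s S \<in> L2_space M" "fou s T \<in> L2_space M"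
    using assms by (auto simp: fstep_def)
  have eq: "fou s (\<lambda>x. S x + T x) w = fou s S w + fou s T w" if "w \<in> vil p" for w
    by (rule fou_add[OF i(1,2) that])
  have m: "fou s (\<lambda>x. S x + T x) \<in> borel_measurable M"
    by (rule measurable_fou) (use i in auto)
  have "integrable M (fou s (\<lambda>x. S x + T x))"
    using Bochner_Integration.integrable_add[OF i(3,4)] by (rule Bochner_Integration.integrable_cong[THEN iffD1, rotated 2]) (simp_all add: eq)
  moreover have "fou s (\<lambda>x. S x + T x) \<in> L2_space M"
    by (rule L2_space_cong_AE[OF L2_add[OF l(3,4)] m], rule AE_I2) (simp add: eq)
  moreover have "fou (- s) (fou s (\<lambda>x. S x + T x)) x = S x + T x" if "x \<in> vil p" for x
  proof -
    have "fou (- s) (fou s (\<lambda>x. S x + T x)) x = fou (- s) (\<lambda>w. fou s S w + fou s T w) x"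
      by (rule fou_cong) (rule eq)
    also have "\<dots> = S x + T x" using fou_add[OF i(3,4) that] assms that by (simp add: fstep_def)
    finally show ?thesis .
  qed
  ultimately show ?thesis using i l L2_add[OF l(1,2)] by (simp add: fstep_def)
qed

lemma fstep_scale:
  assumes "fstep s S"
  shows "fstep s (\<lambda>x. c * S x)"
proof -
  have i: "integrable M S" "integrable M (fou s S)"
    and l: "S \<in> L2_space M" "fou s S \<in> L2_space M"
    using assms by (auto simp: fstep_def)
  have eq: "fou s (\<lambda>x. c * S x) = (\<lambda>w. c * fou s S w)" by (simp add: fun_eq_iff fou_scale)
  show ?thesis using i L2_scale[OF l(1)] L2_scale[OF l(2)] assms
    unfolding fstep_def eq fou_scale by simp
qed

lemma fstep_vball:
  assumes a: "a \<in> vil p" and s: "s = 1 \<or> s = -1"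
  shows "fstep s (indicator (vball p a m))"
proof -
  let ?S = "indicator (vball p a m) :: _ \<Rightarrow> complex"
  let ?T = "\<lambda>w. complex_of_real (real_of_int p powi m) * (indicator (vball p vil_zero (- m)) w * vch p s a w)"
  have eq: "fou s ?S w = ?T w" if "w \<in> vil p" for w
    using fou_vball[OF a that s] by simp
  have m: "fou s ?S \<in> borel_measurable M"
    using vball_sets[OF a] by (intro measurable_fou borel_measurable_indicator)
  have T1: "integrable M ?T"
    using integrable_mult_vch[OF integrable_indicator_vball[OF vil_zero_in] a] by (intro integrable_mult_right)
  have T2: "?T \<in> L2_space M"
    using measurable_vch[OF a]
    by (intro L2_scale L2_mult_bounded L2_indicator) (auto simp: emeasure_vball)
  have "integrable M (fou s ?S)"
    using T1 by (rule Bochner_Integration.integrable_cong[THEN iffD1, rotated 2]) (simp_all add: eq)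
  moreover have "fou s ?S \<in> L2_space M"
    by (rule L2_space_cong_AE[OF T2 m], rule AE_I2) (simp add: eq)
  moreover have "?S \<in> L2_space M" using a by (intro L2_indicator) (auto simp: emeasure_vball)
  ultimately show ?thesis
    using integrable_indicator_vball[OF a] fou_fou_vball[OF a _ s] by (simp add: fstep_def)
qed

lemma fstep_zero: "fstep s (\<lambda>x. 0)"
  by (simp add: fstep_def fou_def[abs_def])

text \<open>Adjointness moves one transform to the other side, where inversion removes it.\<close>

lemma fstep_norm:
  assumes "fstep s S"
  shows "L2_norm M (fou s S) = L2_norm M S"
proof -
  have "L2_inner M (fou s S) (fou s S) = L2_inner M S (fou (- s) (fou s S))"
    by (rule fou_inner) (use assms in \<open>auto simp: fstep_def\<close>)
  also have "\<dots> = L2_inner M S S"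
    unfolding L2_inner_def
    by (rule Bochner_Integration.integral_cong) (use assms in \<open>auto simp: fstep_def\<close>)
  finally have "(L2_norm M (fou s S))\<^sup>2 = (L2_norm M S)\<^sup>2"
    unfolding L2_inner_self by (simp only: of_real_eq_iff)
  then show ?thesis by (simp add: power2_eq_iff_nonneg)
qed

lemma fstep_dense:
  assumes f: "f \<in> L2_space M" and s: "s = 1 \<or> s = -1"
  obtains S where "\<forall>k. fstep s (S k)" "L2_tendsto M S f"
proof -
  have "\<exists>T. fstep s T \<and> L2_norm M (\<lambda>x. T x - f x) < inverse (real (Suc k))" for k
  proof -
    have e: "inverse (real (Suc k)) > 0" by simp
    have f': "f \<in> L2_closed_span M (vil p \<times> UNIV) (\<lambda>(a, m). indicator (vball p a m))"
      using f by (simp only: L2_closed_span_vballs)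
    obtain F c where F: "finite F" "F \<subseteq> vil p \<times> UNIV"
      "L2_norm M (\<lambda>x. f x - (\<Sum>i\<in>F. c i * (case i of (a, m) \<Rightarrow> indicator (vball p a m)) x)) < inverse (real (Suc k))"
      using L2_closed_spanE[OF f' e] .
    have "fstep s (\<lambda>x. \<Sum>i\<in>F. c i * (case i of (a, m) \<Rightarrow> indicator (vball p a m)) x)"
      using F(1,2)
    proof (induction F rule: finite_induct)
      case empty then show ?case by (simp add: fstep_zero)
    next
      case (insert i F)
      obtain a m where i: "i = (a, m)" by (cases i)
      have "fstep s (\<lambda>x. c i * indicator (vball p a m) x + (\<Sum>i\<in>F. c i * (case i of (a, m) \<Rightarrow> indicator (vball p a m)) x))"
        using insert i by (intro fstep_add fstep_scale fstep_vball s) auto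
      then show ?case using insert(1,2) i by simp
    qed
    then show ?thesis using F(3)
      by (intro exI[of _ "\<lambda>x. \<Sum>i\<in>F. c i * (case i of (a, m) \<Rightarrow> indicator (vball p a m)) x"])
         (simp only: L2_norm_minus_commute[of M f] simp_thms)
  qed
  then obtain S where S: "\<And>k. fstep s (S k)" "\<And>k. L2_norm M (\<lambda>x. S k x - f x) < inverse (real (Suc k))"
    by metis
  have "(\<lambda>k. L2_norm M (\<lambda>x. S k x - f x)) \<longlonglongrightarrow> 0"
  proof (rule Lim_null_comparison[OF _ LIMSEQ_inverse_real_of_nat])
    have "norm (L2_norm M (\<lambda>x. S k x - f x)) \<le> inverse (real (Suc k))" for k
      using S(2)[of k] unfolding real_norm_def abs_of_nonneg[OF L2_norm_nonneg] by (rule less_imp_le)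
    then show "\<forall>\<^sub>F k in sequentially. norm (L2_norm M (\<lambda>x. S k x - f x)) \<le> inverse (real (Suc k))"
      by (rule always_eventually[OF allI])
  qed
  then have "L2_tendsto M S f" using S(1) f by (simp add: L2_tendsto_def fstep_def)
  then show ?thesis using S(1) that by blast
qed

text \<open>The relation behind \<open>L2_extension\<close> when both measures are \<open>M\<close>.
  Working with it instead of a chosen value confines \<open>SOME\<close> to
  \<open>vil_fourier_L2_fext\<close> and \<open>vil_inv_fourier_L2_fext\<close>.\<close>

definition fext :: "int \<Rightarrow> (vseq \<Rightarrow> complex) \<Rightarrow> (vseq \<Rightarrow> complex) \<Rightarrow> bool" where
  "fext s f g \<longleftrightarrow> (\<exists>F. (\<forall>k. integrable M (F k)) \<and> L2_tendsto M F f \<and> L2_tendsto M (\<lambda>k. fou s (F k)) g)"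

lemma fextI:
  assumes "\<And>k. integrable M (F k)" "L2_tendsto M F f" "L2_tendsto M (\<lambda>k. fou s (F k)) g"
  shows "fext s f g"
  unfolding fext_def using assms by (intro exI[of _ F]) simp

lemma fext_space:
  assumes "fext s f g"
  shows "f \<in> L2_space M" "g \<in> L2_space M"
  using assms by (auto simp: fext_def L2_tendsto_def)

lemma fext_add:
  assumes "fext s f g" "fext s f' g'"
  shows "fext s (\<lambda>x. f x + f' x) (\<lambda>x. g x + g' x)"
proof -
  obtain F where F: "\<forall>k. integrable M (F k)" "L2_tendsto M F f" "L2_tendsto M (\<lambda>k. fou s (F k)) g"
    using assms(1) by (auto simp: fext_def)
  obtain F' where F': "\<forall>k. integrable M (F' k)" "L2_tendsto M F' f'" "L2_tendsto M (\<lambda>k. fou s (F' k)) g'"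
    using assms(2) by (auto simp: fext_def)
  let ?F = "\<lambda>k x. F k x + F' k x"
  have i: "integrable M (?F k)" for k using F F' by simp
  have "L2_tendsto M (\<lambda>k. fou s (?F k)) (\<lambda>x. g x + g' x)"
  proof (rule L2_tendsto_cong_AE[OF L2_tendsto_add[OF F(3) F'(3)]])
    show "fou s (?F k) \<in> borel_measurable M" for k
      by (rule measurable_fou[OF borel_measurable_integrable[OF i]])
    show "(\<lambda>x. g x + g' x) \<in> borel_measurable M"
      using L2_spaceD(1)[OF L2_add[OF fext_space(2)[OF assms(1)] fext_space(2)[OF assms(2)]]] .
    show "AE x in M. fou s (F k) x + fou s (F' k) x = fou s (?F k) x" for k
      by (rule AE_I2, subst fou_add) (use F F' in auto)
  qed simp
  then show ?thesis by (rule fextI[OF i L2_tendsto_add[OF F(2) F'(2)]])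
qed

lemma fext_scale:
  assumes "fext s f g"
  shows "fext s (\<lambda>x. c * f x) (\<lambda>x. c * g x)"
proof -
  obtain F where F: "\<forall>k. integrable M (F k)" "L2_tendsto M F f" "L2_tendsto M (\<lambda>k. fou s (F k)) g"
    using assms(1) by (auto simp: fext_def)
  have eq: "fou s (\<lambda>x. c * F k x) = (\<lambda>w. c * fou s (F k) w)" for k by (simp add: fun_eq_iff fou_scale)
  show ?thesis unfolding fext_def
    by (rule exI[of _ "\<lambda>k x. c * F k x"], unfold eq)
       (use F(1) L2_tendsto_scale[OF F(2)] L2_tendsto_scale[OF F(3)] in simp)
qed

lemma fext_diff:
  assumes "fext s f g" "fext s f' g'"
  shows "fext s (\<lambda>x. f x - f' x) (\<lambda>x. g x - g' x)"
  using fext_add[OF assms(1) fext_scale[OF assms(2), of "-1"]] by simp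

lemma fext_sum:
  assumes "\<And>i. i \<in> F \<Longrightarrow> fext s (b i) (b' i)"
  shows "fext s (\<lambda>x. \<Sum>i\<in>F. c i * b i x) (\<lambda>x. \<Sum>i\<in>F. c i * b' i x)"
  using assms
proof (induction F rule: infinite_finite_induct)
  case (insert i F)
  then have "fext s (\<lambda>x. c i * b i x + (\<Sum>i\<in>F. c i * b i x)) (\<lambda>x. c i * b' i x + (\<Sum>i\<in>F. c i * b' i x))"
    by (intro fext_add fext_scale) auto
  then show ?case using insert by simp
qed (auto simp: fext_def L2_tendsto_def fou_def[abs_def] intro!: exI[of _ "\<lambda>k x. 0"])

lemma fext_cong_AE:
  assumes "fext s f g" "f' \<in> borel_measurable M" "g' \<in> borel_measurable M"
    "AE x in M. f x = f' x" "AE x in M. g x = g' x"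
  shows "fext s f' g'"
proof -
  obtain F where F: "\<forall>k. integrable M (F k)" "L2_tendsto M F f" "L2_tendsto M (\<lambda>k. fou s (F k)) g"
    using assms(1) by (auto simp: fext_def)
  have m: "F k \<in> borel_measurable M" for k using F(1) by (simp add: borel_measurable_integrable)
  have "L2_tendsto M F f'" by (rule L2_tendsto_cong_AE[OF F(2) m assms(2) _ assms(4)]) simp
  moreover have "L2_tendsto M (\<lambda>k. fou s (F k)) g'"
    by (rule L2_tendsto_cong_AE[OF F(3) measurable_fou[OF m] assms(3) _ assms(5)]) simp
  ultimately show ?thesis using F(1) by (intro fextI[where F=F]) simp_all
qed

text \<open>Transforms of approximating step functions form a Cauchy sequence by isometry. The same
  pairs of functions, read backwards, witness the inverse relation.\<close>

lemma fext_total_inverse: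
  assumes f: "f \<in> L2_space M" and s: "s = 1 \<or> s = -1"
  obtains g where "fext s f g" "fext (- s) g f" "L2_norm M g = L2_norm M f"
proof -
  obtain S where S': "\<forall>k. fstep s (S k)" and S2: "L2_tendsto M S f" using fstep_dense[OF f s] .
  then have S: "\<And>k. fstep s (S k)" "L2_tendsto M S f" by auto
  have i: "integrable M (S k)" "integrable M (fou s (S k))"
    and l: "S k \<in> L2_space M" "fou s (S k) \<in> L2_space M"
    and inv: "\<And>x. x \<in> vil p \<Longrightarrow> fou (- s) (fou s (S k)) x = S k x" for k
    using S(1)[of k] by (auto simp: fstep_def)
  have diff: "L2_norm M (\<lambda>x. fou s (S m) x - fou s (S n) x) = L2_norm M (\<lambda>x. S m x - S n x)" for m n
  proof -
    have st: "fstep s (\<lambda>x. S m x + -1 * S n x)"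
      by (rule fstep_add[OF S(1) fstep_scale[OF S(1)]])
    have "L2_norm M (\<lambda>x. fou s (S m) x - fou s (S n) x) = L2_norm M (fou s (\<lambda>x. S m x + -1 * S n x))"
    proof (rule L2_norm_cong_AE)
      show "(\<lambda>x. fou s (S m) x - fou s (S n) x) \<in> borel_measurable M"
        using L2_spaceD(1)[OF L2_diff[OF l(2) l(2)]] .
      show "fou s (\<lambda>x. S m x + -1 * S n x) \<in> borel_measurable M"
        using st by (auto simp: fstep_def)
      show "AE x in M. cmod (fou s (S m) x - fou s (S n) x) = cmod (fou s (\<lambda>x. S m x + -1 * S n x) x)"
      proof (rule AE_I2)
        fix x assume "x \<in> space M"
        then have "fou s (\<lambda>x. S m x + -1 * S n x) x = fou s (S m) x + fou s (\<lambda>x. -1 * S n x) x"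
          by (intro fou_add integrable_mult_right i) auto
        then show "cmod (fou s (S m) x - fou s (S n) x) = cmod (fou s (\<lambda>x. S m x + -1 * S n x) x)"
          by (simp only: fou_scale) simp
      qed
    qed
    also have "\<dots> = L2_norm M (\<lambda>x. S m x - S n x)" using fstep_norm[OF st] by simp
    finally show ?thesis .
  qed
  obtain g where g: "L2_tendsto M (\<lambda>k. fou s (S k)) g"
  proof (rule L2_complete[OF l(2)])
    fix e :: real assume "e > 0"
    then have e2: "e / 2 > 0" by simp
    have "(\<lambda>k. L2_norm M (\<lambda>x. S k x - f x)) \<longlonglongrightarrow> 0" using S(2) by (simp add: L2_tendsto_def)
    from LIMSEQ_D[OF this e2] obtain K where K: "\<And>k. k \<ge> K \<Longrightarrow> L2_norm M (\<lambda>x. S k x - f x) < e/2" by auto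
    have "L2_norm M (\<lambda>x. fou s (S m) x - fou s (S n) x) < e" if "m \<ge> K" "n \<ge> K" for m n
      using K[OF that(1)] K[OF that(2)] L2_norm_triangle_diff[OF l(1)[of m] f l(1)[of n]]
      unfolding diff L2_norm_minus_commute[of M f] by linarith
    then show "\<exists>K. \<forall>m\<ge>K. \<forall>n\<ge>K. L2_norm M (\<lambda>x. fou s (S m) x - fou s (S n) x) < e" by blast
  qed
  have 1: "fext s f g" by (rule fextI[OF i(1) S(2) g])
  have "L2_tendsto M (\<lambda>k. fou (- s) (fou s (S k))) f"
  proof (rule L2_tendsto_cong_AE[OF S(2)])
    show "fou (- s) (fou s (S k)) \<in> borel_measurable M" for k
      by (rule measurable_fou[OF L2_spaceD(1)[OF l(2)]])
    show "AE x in M. S k x = fou (- s) (fou s (S k)) x" for k by (rule AE_I2) (simp add: inv)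
  qed (use f in auto)
  then have 2: "fext (- s) g f" by (rule fextI[OF i(2) g])
  have "(\<lambda>k. L2_norm M (fou s (S k))) \<longlonglongrightarrow> L2_norm M f"
    using L2_norm_limit[OF S(2)] fstep_norm[OF S(1)] by simp
  then have "L2_norm M g = L2_norm M f" using L2_norm_limit[OF g] LIMSEQ_unique by blast
  then show ?thesis using that 1 2 by blast
qed

text \<open>The approximating sequences in \<open>fext\<close> need not consist of step functions,
  so \<open>fstep_norm\<close> does not apply to them. Testing against a ball indicator moves the
  transform onto the indicator, and the result depends on \<open>f\<close> alone.\<close>

lemma fext_unique:
  assumes "fext s f g" "fext s f g'" and s: "s = 1 \<or> s = -1"
  shows "AE x in M. g x = g' x"
proof -
  have ip: "L2_inner M g (indicator (vball p a m)) = L2_inner M f (fou (- s) (indicator (vball p a m)))"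
    if g: "fext s f g" and a: "a \<in> vil p" for g a m
  proof -
    have s': "- s = 1 \<or> - s = -1" using s by auto
    obtain F where F: "\<forall>k. integrable M (F k)" "L2_tendsto M F f" "L2_tendsto M (\<lambda>k. fou s (F k)) g"
      using g by (auto simp: fext_def)
    have st: "fstep (- s) (indicator (vball p a m))" by (rule fstep_vball[OF a s'])
    have "(\<lambda>k. L2_inner M (fou s (F k)) (indicator (vball p a m))) \<longlonglongrightarrow> L2_inner M g (indicator (vball p a m))"
      by (rule L2_inner_limit[OF F(3)]) (use st in \<open>simp add: fstep_def\<close>)
    moreover have "L2_inner M (fou s (F k)) (indicator (vball p a m)) =
        L2_inner M (F k) (fou (- s) (indicator (vball p a m)))" for k
      by (rule fou_inner) (use F st in \<open>auto simp: fstep_def\<close>)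
    moreover have "(\<lambda>k. L2_inner M (F k) (fou (- s) (indicator (vball p a m)))) \<longlonglongrightarrow>
        L2_inner M f (fou (- s) (indicator (vball p a m)))"
      by (rule L2_inner_limit[OF F(2)]) (use st in \<open>simp add: fstep_def\<close>)
    ultimately show ?thesis using LIMSEQ_unique by fastforce
  qed
  let ?d = "\<lambda>x. g x - g' x"
  have gL: "g \<in> L2_space M" "g' \<in> L2_space M" using fext_space assms by auto
  have "AE x in M. ?d x = 0"
  proof (rule L2_orthogonal_self[where I="vil p \<times> UNIV" and b="\<lambda>(a, m). indicator (vball p a m)"])
    fix i :: "vseq \<times> int" assume "i \<in> vil p \<times> UNIV"
    then obtain a m where i: "i = (a, m)" "a \<in> vil p" by auto
    show b: "(case i of (a, m) \<Rightarrow> indicator (vball p a m)) \<in> L2_space M"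
      using i by (auto intro!: L2_indicator simp: emeasure_vball)
    show "L2_inner M ?d (case i of (a, m) \<Rightarrow> indicator (vball p a m)) = 0"
      using b ip[OF assms(1) i(2)] ip[OF assms(2) i(2)] by (simp add: i L2_inner_diff_left[OF gL])
  next
    show "?d \<in> L2_closed_span M (vil p \<times> UNIV) (\<lambda>(a, m). indicator (vball p a m))"
      unfolding L2_closed_span_vballs by (rule L2_diff[OF gL])
  qed
  then show ?thesis by simp
qed

lemma fext_norm:
  assumes "fext s f g" and s: "s = 1 \<or> s = -1"
  shows "L2_norm M g = L2_norm M f"
proof -
  have f: "f \<in> L2_space M" and g: "g \<in> L2_space M" using fext_space[OF assms(1)] .
  obtain g' where g': "fext s f g'" "L2_norm M g' = L2_norm M f" using fext_total_inverse[OF f s] .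
  have "AE x in M. g x = g' x" using fext_unique[OF assms(1) g'(1) s] .
  then have "L2_norm M g = L2_norm M g'"
    using g fext_space(2)[OF g'(1)] by (intro L2_norm_cong_AE) (auto elim!: eventually_mono)
  then show ?thesis using g' by simp
qed

lemma fext_inverse:
  assumes "fext s f g" and s: "s = 1 \<or> s = -1"
  shows "fext (- s) g f"
proof -
  have f: "f \<in> L2_space M" and g: "g \<in> L2_space M" using fext_space[OF assms(1)] .
  obtain g' where g': "fext s f g'" "fext (- s) g' f" using fext_total_inverse[OF f s] .
  have "AE x in M. g' x = g x" using fext_unique[OF g'(1) assms(1) s] .
  then show ?thesis using fext_cong_AE[OF g'(2)] f g by auto
qed

lemma fext_inner:
  assumes "fext s f g" "fext s f' g'" and s: "s = 1 \<or> s = -1"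
  shows "L2_inner M g g' = L2_inner M f f'"
proof -
  have f: "f \<in> L2_space M" "f' \<in> L2_space M" and g: "g \<in> L2_space M" "g' \<in> L2_space M"
    using fext_space assms by auto
  have Re_eq: "Re (L2_inner M g h') = Re (L2_inner M f h)" if h: "fext s h h'" for h h'
  proof -
    have hL: "h \<in> L2_space M" "h' \<in> L2_space M" using fext_space[OF h] .
    have "(L2_norm M (\<lambda>x. g x - h' x))\<^sup>2 = (L2_norm M (\<lambda>x. f x - h x))\<^sup>2"
      using fext_norm[OF fext_diff[OF assms(1) h] s] by simp
    then show ?thesis
      unfolding L2_norm_diff_expand[OF g(1) hL(2)] L2_norm_diff_expand[OF f(1) hL(1)]
      using fext_norm[OF assms(1) s] fext_norm[OF h s] by simp
  qed
  \<comment> \<open>Equal norms of differences give equal real parts of inner products; multiplying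
    the second argument by the imaginary unit recovers the imaginary parts.\<close>
  have "Re (cnj \<i> * L2_inner M g g') = Re (cnj \<i> * L2_inner M f f')"
    using Re_eq[OF fext_scale[OF assms(2), of \<i>]] by (simp only: L2_inner_scale_right)
  then show ?thesis using Re_eq[OF assms(2)] by (simp add: complex_eq_iff)
qed

text \<open>The same coefficients give the same approximation error on both sides, because the
  transform is linear and isometric.\<close>

lemma L2_closed_span_fext:
  assumes b: "\<And>i. i \<in> I \<Longrightarrow> fext s (b i) (b' i)" and fg: "fext s f g" and s: "s = 1 \<or> s = -1"
  shows "f \<in> L2_closed_span M I b \<longleftrightarrow> g \<in> L2_closed_span M I b'"
proof -
  have "L2_norm M (\<lambda>x. f x - (\<Sum>i\<in>F. c i * b i x)) = L2_norm M (\<lambda>x. g x - (\<Sum>i\<in>F. c i * b' i x))"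
    if "F \<subseteq> I" for F c
  proof -
    have "fext s (\<lambda>x. \<Sum>i\<in>F. c i * b i x) (\<lambda>x. \<Sum>i\<in>F. c i * b' i x)"
      by (rule fext_sum) (use that b in auto)
    from fext_norm[OF fext_diff[OF fg this] s] show ?thesis by simp
  qed
  then show ?thesis using fext_space[OF fg] unfolding L2_closed_span_def by (simp cong: conj_cong)
qed

lemma L2_orthonormal_fext:
  assumes b: "\<And>i. i \<in> I \<Longrightarrow> fext s (b i) (b' i)" and s: "s = 1 \<or> s = -1"
  shows "L2_orthonormal M I b \<longleftrightarrow> L2_orthonormal M I b'"
  using fext_space[OF b] fext_inner[OF b b s] by (auto simp: L2_orthonormal_def)

lemma vil_fourier_L2_fext:
  assumes "f \<in> L2_space M"
  shows "fext (-1) f (vil_fourier_L2 p M M f)"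
proof -
  obtain g where "fext (-1) f g" using fext_total_inverse[OF assms, of "-1"] by auto
  then have "fext (-1) f (SOME g. fext (-1) f g)" by (rule someI[of "fext (-1) f"])
  then show ?thesis by (simp only: vil_fourier_L2_def L2_extension_def vil_fourier_eq fext_def)
qed

lemma vil_inv_fourier_L2_fext:
  assumes "g \<in> L2_space M"
  shows "fext (-1) (vil_inv_fourier_L2 p M M g) g"
proof -
  obtain f where "fext 1 g f" using fext_total_inverse[OF assms, of "1"] by auto
  then have "fext 1 g (SOME f. fext 1 g f)" by (rule someI[of "fext 1 g"])
  then have "fext 1 g (vil_inv_fourier_L2 p M M g)"
    by (simp only: vil_inv_fourier_L2_def L2_extension_def vil_inv_fourier_eq fext_def)
  from fext_inverse[OF this] show ?thesis by simp
qed

subsection \<open>Dilations\<close>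

text \<open>The transform of \<open>vil_dil p j n f\<close> when \<open>g\<close> is the transform
  of \<open>f\<close>: the substitution contributes p^(-j), the normalization p^(j/2), and the
  translation the conjugate character.\<close>

definition fdil :: "int \<Rightarrow> vseq \<Rightarrow> (vseq \<Rightarrow> complex) \<Rightarrow> vseq \<Rightarrow> complex" where
  "fdil j n g = (\<lambda>w. complex_of_real (real_of_int p powr (- real_of_int j / 2)) *
     (g (rho_pow (- j) w) * vch p (-1) n (rho_pow (- j) w)))"

lemma dil_pre:
  assumes "n \<in> vil p" "b \<in> vil p"
  shows "\<exists>b'\<in>vil p. {x \<in> vil p. vil_sub p (rho_pow j x) n \<in> vball p b m} = vball p b' (m + - j)"
proof -
  have "{x \<in> vil p. vil_sub p (rho_pow j x) n \<in> vball p b m} = {x \<in> vil p. rho_pow j x \<in> vball p (vil_add p b n) m}"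
    using assms by (simp add: vball_sub_iff cong: conj_cong)
  then show ?thesis using rho_pow_pre[OF vil_add_in[OF assms(2,1)], of j m] by simp
qed

lemma dil_in: "n \<in> vil p \<Longrightarrow> x \<in> vil p \<Longrightarrow> vil_sub p (rho_pow j x) n \<in> vil p"
  by simp

lemma powr_half_sq: "(real_of_int p powr (real_of_int j / 2))\<^sup>2 = real_of_int p powi j"
  using p_pos by (simp add: power2_eq_square powr_add[symmetric] powr_real_of_int')

lemma L2_vil_dil:
  assumes f: "f \<in> L2_space M" and n: "n \<in> vil p"
  shows "vil_dil p j n f \<in> L2_space M" "L2_norm M (vil_dil p j n f) = L2_norm M f"
proof -
  let ?t = "\<lambda>x. vil_sub p (rho_pow j x) n"
  have fm: "f \<in> borel_measurable M" and fi: "integrable M (\<lambda>x. (cmod (f x))\<^sup>2)" using f by auto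
  have tm: "?t \<in> measurable M M" by (rule measurable_vil_map[OF dil_in[OF n] dil_pre[OF n]])
  have "integrable M (\<lambda>x. (cmod (f (?t x)))\<^sup>2)"
    by (rule integrable_vil_map[OF dil_in[OF n] dil_pre[OF n] fi])
  then have "(\<lambda>x. f (?t x)) \<in> L2_space M" using measurable_compose[OF tm fm] by (simp add: L2_space_def)
  then show "vil_dil p j n f \<in> L2_space M" unfolding vil_dil_def by (rule L2_scale)
  have "(L2_norm M (vil_dil p j n f))\<^sup>2 = (LINT x|M. real_of_int p powi j * (cmod (f (?t x)))\<^sup>2)"
    unfolding L2_norm_sq vil_dil_def by (simp add: norm_mult power_mult_distrib powr_half_sq)
  also have "\<dots> = real_of_int p powi j * (LINT x|M. (cmod (f (?t x)))\<^sup>2)" by simp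
  also have "(LINT x|M. (cmod (f (?t x)))\<^sup>2) = real_of_int p powi (- j) *\<^sub>R (LINT x|M. (cmod (f x))\<^sup>2)"
    by (rule integral_vil_map[OF dil_in[OF n] dil_pre[OF n]]) (use fi in auto)
  also have "real_of_int p powi j * \<dots> = (L2_norm M f)\<^sup>2"
    using p_pos by (simp add: L2_norm_sq power_int_minus)
  finally show "L2_norm M (vil_dil p j n f) = L2_norm M f"
    by (simp add: power2_eq_iff_nonneg)
qed

lemma L2_fdil:
  assumes g: "g \<in> L2_space M" and n: "n \<in> vil p"
  shows "fdil j n g \<in> L2_space M" "L2_norm M (fdil j n g) = L2_norm M g"
proof -
  have gv: "(\<lambda>w. g w * vch p (-1) n w) \<in> L2_space M"
    by (rule L2_mult_bounded[OF g measurable_vch[OF n]]) simp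
  \<comment> \<open>On the group, \<open>fdil j n g\<close> is the dilation by \<open>- j\<close> of
    \<open>g\<close> times a unimodular character, so the results for \<open>vil_dil\<close> carry
    over.\<close>
  have eq: "fdil j n g w = vil_dil p (- j) vil_zero (\<lambda>w. g w * vch p (-1) n w) w" if "w \<in> vil p" for w
    using that by (simp add: fdil_def vil_dil_def)
  note d = L2_vil_dil[OF gv vil_zero_in, of "- j"]
  have m: "fdil j n g \<in> borel_measurable M"
    using L2_spaceD(1)[OF d(1)] by (rule measurable_cong[THEN iffD1, rotated]) (simp add: eq)
  show "fdil j n g \<in> L2_space M"
    by (rule L2_space_cong_AE[OF d(1) m], rule AE_I2) (simp add: eq)
  have "L2_norm M (fdil j n g) = L2_norm M (vil_dil p (- j) vil_zero (\<lambda>w. g w * vch p (-1) n w))"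
    by (rule L2_norm_cong_AE[OF m L2_spaceD(1)[OF d(1)]], rule AE_I2) (simp add: eq)
  also have "\<dots> = L2_norm M (\<lambda>w. g w * vch p (-1) n w)" by (rule d(2))
  also have "\<dots> = L2_norm M g" by (simp add: L2_norm_def norm_mult)
  finally show "L2_norm M (fdil j n g) = L2_norm M g" .
qed

lemma fou_vil_dil:
  assumes F: "integrable M F" and n: "n \<in> vil p" and w: "w \<in> vil p"
  shows "integrable M (vil_dil p j n F)" "fou (-1) (vil_dil p j n F) w = fdil j n (fou (-1) F) w"
proof -
  let ?t = "\<lambda>x. vil_sub p (rho_pow j x) n"
  have "integrable M (\<lambda>x. F (?t x))" by (rule integrable_vil_map[OF dil_in[OF n] dil_pre[OF n] F])
  then show "integrable M (vil_dil p j n F)" unfolding vil_dil_def by (rule integrable_mult_right)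
  let ?w = "rho_pow (- j) w"
  let ?h = "\<lambda>y. complex_of_real (real_of_int p powr (real_of_int j / 2)) * vch p (-1) n ?w * (F y * vch p (-1) y ?w)"
  have wv: "?w \<in> vil p" using w by simp
  have hm: "?h \<in> borel_measurable M"
    using measurable_vch'[OF wv] borel_measurable_integrable[OF F] by (intro borel_measurable_times borel_measurable_const)
  have "fou (-1) (vil_dil p j n F) w = (LINT x|M. ?h (?t x))"
    unfolding fou_def
  proof (rule Bochner_Integration.integral_cong[OF refl])
    fix x assume "x \<in> space M"
    then have x: "x \<in> vil p" by simp
    \<comment> \<open>A power of \<open>rho\<close> can be moved from one argument of the pairing to
      the other, so opposite powers in the two arguments cancel.\<close>
    have "vch p (-1) x w = vch p (-1) (rho_pow j x) ?w" by (simp add: vch_rho_pow)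
    also have "\<dots> = vch p (-1) (vil_add p n (?t x)) ?w" using x by simp
    also have "\<dots> = vch p (-1) n ?w * vch p (-1) (?t x) ?w"
      by (rule vch_add[OF n dil_in[OF n x] wv])
    finally show "vil_dil p j n F x * vch p (-1) x w = ?h (?t x)" by (simp add: vil_dil_def)
  qed
  also have "\<dots> = (real_of_int p powi (- j)) *\<^sub>R (LINT y|M. ?h y)"
    by (rule integral_vil_map[OF dil_in[OF n] dil_pre[OF n] hm])
  also have "(LINT y|M. ?h y) = complex_of_real (real_of_int p powr (real_of_int j / 2)) * vch p (-1) n ?w * fou (-1) F ?w"
    by (simp add: fou_def)
  also have "(real_of_int p powi (- j)) *\<^sub>R (complex_of_real (real_of_int p powr (real_of_int j / 2)) * vch p (-1) n ?w * fou (-1) F ?w)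
      = complex_of_real (real_of_int p powi (- j) * real_of_int p powr (real_of_int j / 2)) * (fou (-1) F ?w * vch p (-1) n ?w)"
    by (simp add: scaleR_conv_of_real)
  also have "real_of_int p powi (- j) * real_of_int p powr (real_of_int j / 2) = real_of_int p powr (- real_of_int j / 2)"
    unfolding powr_half_sq[symmetric] using p_pos by (simp add: power2_eq_square powr_add[symmetric])
  finally show "fou (-1) (vil_dil p j n F) w = fdil j n (fou (-1) F) w" by (simp add: fdil_def)
qed

text \<open>\<open>vil_dil\<close> and \<open>fdil\<close> are linear isometries that correspond
  under the integral transform, so they carry an approximating sequence for \<open>f\<close> to one
  for its dilate.\<close>

lemma fext_vil_dil:
  assumes fg: "fext (-1) f g" and n: "n \<in> vil p"
  shows "fext (-1) (vil_dil p j n f) (fdil j n g)"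
proof -
  obtain F where F: "\<forall>k. integrable M (F k)" "L2_tendsto M F f" "L2_tendsto M (\<lambda>k. fou (-1) (F k)) g"
    using fg by (auto simp: fext_def)
  have f: "f \<in> L2_space M" and g: "g \<in> L2_space M" using fext_space[OF fg] .
  have FL: "F k \<in> L2_space M" "fou (-1) (F k) \<in> L2_space M" for k using F by (auto simp: L2_tendsto_def)
  have i: "integrable M (vil_dil p j n (F k))" for k
    using fou_vil_dil(1)[OF _ n vil_zero_in] F by auto
  have d1: "(\<lambda>x. vil_dil p j n (F k) x - vil_dil p j n f x) = vil_dil p j n (\<lambda>x. F k x - f x)" for k
    by (simp add: vil_dil_def fun_eq_iff right_diff_distrib)
  have d2: "(\<lambda>x. fdil j n (fou (-1) (F k)) x - fdil j n g x) = fdil j n (\<lambda>x. fou (-1) (F k) x - g x)" for k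
    by (simp add: fdil_def fun_eq_iff algebra_simps)
  have "L2_tendsto M (\<lambda>k. vil_dil p j n (F k)) (vil_dil p j n f)"
    using F(2) L2_vil_dil(1)[OF FL(1) n] L2_vil_dil(1)[OF f n] L2_vil_dil(2)[OF L2_diff[OF FL(1) f] n]
    by (simp add: L2_tendsto_def d1)
  moreover have "L2_tendsto M (\<lambda>k. fdil j n (fou (-1) (F k))) (fdil j n g)"
    using F(3) L2_fdil(1)[OF FL(2) n] L2_fdil(1)[OF g n] L2_fdil(2)[OF L2_diff[OF FL(2) g] n]
    by (simp add: L2_tendsto_def d2)
  then have "L2_tendsto M (\<lambda>k. fou (-1) (vil_dil p j n (F k))) (fdil j n g)"
  proof (rule L2_tendsto_cong_AE)
    show "fou (-1) (vil_dil p j n (F k)) \<in> borel_measurable M" for k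
      by (rule measurable_fou[OF borel_measurable_integrable[OF i]])
    show "fdil j n g \<in> borel_measurable M" using L2_fdil(1)[OF g n] by (rule L2_spaceD)
    show "AE x in M. fdil j n (fou (-1) (F k)) x = fou (-1) (vil_dil p j n (F k)) x" for k
      by (rule AE_I2) (use F(1) fou_vil_dil(2)[OF _ n] in simp)
  qed simp
  ultimately show ?thesis by (intro fextI[OF i])
qed

end

subsection \<open>Tiles\<close>

context vilenkin_base
begin

text \<open>The fractional part: the representative in \<open>vil_U p\<close> of the class of
  \<open>w\<close> modulo \<open>vil_Lambda p\<close>.\<close>

definition vfrac :: "vseq \<Rightarrow> vseq" where
  "vfrac w = (\<lambda>j. if j > 0 then w j else 0)"

text \<open>A finite subgroup of \<open>vil_Lambda p\<close>; for \<open>m \<le> 0\<close> it is the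
  character group of \<open>vil_U p\<close> modulo the ball of exponent \<open>m\<close>, and for
  \<open>m \<ge> 0\<close> it is trivial.\<close>

definition vLam :: "int \<Rightarrow> vseq set" where
  "vLam m = {n \<in> vil p. \<forall>j. n j \<noteq> 0 \<longrightarrow> j \<in> {m+1..0}}"

lemma vfrac_in [simp]: "w \<in> vil p \<Longrightarrow> vfrac w \<in> vil p"
  using p_pos by (auto simp: vfrac_def vil_def)

lemma vfrac_U: "w \<in> vil p \<Longrightarrow> vfrac w \<in> vball p vil_zero 0"
  using vfrac_in[of w] by (simp add: vball_def vfrac_def vil_zero_def)

lemma vfrac_id: "w \<in> vball p vil_zero 0 \<Longrightarrow> vfrac w = w"
  by (auto simp: vball_def vfrac_def vil_zero_def fun_eq_iff not_less)

lemma vint_in: "w \<in> vil p \<Longrightarrow> vil_sub p w (vfrac w) \<in> vil_Lambda p"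
  using vil_sub_in[OF _ vfrac_in, of w w] by (simp add: vil_Lambda_def) (simp add: vil_sub_def vfrac_def)

lemma Lambda_vil: "n \<in> vil_Lambda p \<Longrightarrow> n \<in> vil p"
  by (simp add: vil_Lambda_def)

lemma zero_Lambda [simp]: "vil_zero \<in> vil_Lambda p"
  by (simp add: vil_Lambda_def vil_zero_def[abs_def] vil_zero_in[unfolded vil_zero_def])

lemma Lambda_sub: "n \<in> vil_Lambda p \<Longrightarrow> k \<in> vil_Lambda p \<Longrightarrow> vil_sub p n k \<in> vil_Lambda p"
  using vil_sub_in[of n k] by (simp add: vil_Lambda_def) (simp add: vil_sub_def)

lemma Lambda_add: "n \<in> vil_Lambda p \<Longrightarrow> k \<in> vil_Lambda p \<Longrightarrow> vil_add p n k \<in> vil_Lambda p"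
  using vil_add_in[of n k] by (simp add: vil_Lambda_def) (simp add: vil_add_def)

lemma vil_sub_eq_zero_iff:
  assumes "x \<in> vil p" "y \<in> vil p"
  shows "vil_sub p x y = vil_zero \<longleftrightarrow> x = y"
proof
  assume h: "vil_sub p x y = vil_zero"
  have "x = vil_add p y (vil_sub p x y)" using assms by simp
  also have "\<dots> = y" unfolding h using assms by (simp add: vil_add_def vil_zero_def)
  finally show "x = y" .
qed (simp add: vil_sub_def vil_zero_def)

lemma Lambda_U_iff: "n \<in> vil_Lambda p \<Longrightarrow> n \<in> vball p vil_zero 0 \<longleftrightarrow> n = vil_zero"
  by (auto simp: vball_def vil_Lambda_def vil_zero_def fun_eq_iff) (metis not_le)

lemma vfrac_add_Lambda:
  assumes "w \<in> vil p" "n \<in> vil_Lambda p"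
  shows "vfrac (vil_add p w n) = vfrac w"
  using assms by (auto simp: vfrac_def vil_add_def vil_Lambda_def fun_eq_iff)

text \<open>The ball of exponent 0 about \<open>k\<close> is the coset of \<open>vil_U p\<close> on
  which the integer part is \<open>k\<close>; these cosets are the cells into which sets are cut
  below.\<close>

lemma vball_Lambda_iff:
  assumes "w \<in> vil p" "k \<in> vil_Lambda p"
  shows "w \<in> vball p k 0 \<longleftrightarrow> vil_sub p w (vfrac w) = k"
  using assms by (auto simp: vball_def vil_sub_def vfrac_def vil_Lambda_def fun_eq_iff)

lemma vfrac_vball:
  assumes "w \<in> vball p k 0" "k \<in> vil_Lambda p"
  shows "vil_add p k (vfrac w) = w"
proof -
  have w: "w \<in> vil p" using assms(1) by (rule vball_vil)
  then have "k = vil_sub p w (vfrac w)" using assms vball_Lambda_iff by simp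
  then show ?thesis using w vil_add_sub_cancel[OF w, of "vfrac w"] by (simp add: vil_add_commute)
qed

lemma vil_add_Lambda_vball:
  assumes "x \<in> vball p vil_zero 0" "k \<in> vil_Lambda p"
  shows "vil_add p k x \<in> vball p k 0" "vfrac (vil_add p k x) = x"
proof -
  have x: "x \<in> vil p" using assms(1) by (rule vball_vil)
  have k: "k \<in> vil p" using assms(2) by (rule Lambda_vil)
  have "\<forall>j\<le>0. vil_add p k x j = k j" using assms(1) k by (simp add: vball_def vil_add_def vil_zero_def)
  then show "vil_add p k x \<in> vball p k 0" using vil_add_in[OF k x] by (simp add: vball_def)
  show "vfrac (vil_add p k x) = x"
    using vfrac_add_Lambda[OF x assms(2)] vfrac_id[OF assms(1)] by (simp add: vil_add_commute)
qed

lemma UN_vball_Lambda: "(\<Union>k\<in>vil_Lambda p. vball p k 0) = vil p"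
proof
  show "vil p \<subseteq> (\<Union>k\<in>vil_Lambda p. vball p k 0)"
  proof
    fix w assume w: "w \<in> vil p"
    then have "w \<in> vball p (vil_sub p w (vfrac w)) 0" using vball_Lambda_iff[OF w vint_in[OF w]] by simp
    then show "w \<in> (\<Union>k\<in>vil_Lambda p. vball p k 0)" using vint_in[OF w] by blast
  qed
qed (use vball_sub_vil in blast)

lemma vball_Lambda_disjoint:
  assumes "k \<in> vil_Lambda p" "l \<in> vil_Lambda p" "w \<in> vball p k 0" "w \<in> vball p l 0"
  shows "k = l"
  using assms vball_Lambda_iff[OF vball_vil[OF assms(3)]] by metis

text \<open>Split \<open>w\<close> into fractional and integer part; the integer part contributes 1
  because \<open>vil_Lambda p\<close> annihilates itself.\<close>

lemma vch_vfrac: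
  assumes "w \<in> vil p" "n \<in> vil_Lambda p"
  shows "vch p s n (vfrac w) = vch p s n w"
proof -
  have n: "n \<in> vil p" using assms(2) by (rule Lambda_vil)
  have "vch p s n w = vch p s (vil_add p (vfrac w) (vil_sub p w (vfrac w))) n"
    using assms by (simp add: vch_commute[of s n])
  also have "\<dots> = vch p s (vfrac w) n * vch p s (vil_sub p w (vfrac w)) n"
    using assms n by (intro vch_add) auto
  also have "vch p s (vil_sub p w (vfrac w)) n = 1"
    by (rule vch_Lambda_eq_1[OF vint_in[OF assms(1)] assms(2)])
  finally show ?thesis by (simp add: vch_commute[of s n])
qed

lemma finite_vLam: "finite (vLam m)"
  unfolding vLam_def by (rule finite_vil_bounded_support)

lemma vLam_Lambda: "n \<in> vLam m \<Longrightarrow> n \<in> vil_Lambda p"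
  by (simp add: vLam_def vil_Lambda_def) (metis not_le)

lemma zero_vLam: "vil_zero \<in> vLam m"
  using vil_zero_in by (simp add: vLam_def) (simp add: vil_zero_def)

lemma vLam_add:
  assumes "n \<in> vLam m" "k \<in> vLam m"
  shows "vil_add p n k \<in> vLam m"
proof -
  have "j \<in> {m+1..0}" if "vil_add p n k j \<noteq> 0" for j
  proof -
    have "n j \<noteq> 0 \<or> k j \<noteq> 0" using that by (auto simp: vil_add_def)
    then show ?thesis using assms unfolding vLam_def by blast
  qed
  then show ?thesis using assms vil_add_in[of n k] by (simp add: vLam_def)
qed

lemma vLam_sub:
  assumes "n \<in> vLam m" "k \<in> vLam m"
  shows "vil_sub p n k \<in> vLam m"
proof -
  have "j \<in> {m+1..0}" if "vil_sub p n k j \<noteq> 0" for j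
  proof -
    have "n j \<noteq> 0 \<or> k j \<noteq> 0" using that by (auto simp: vil_sub_def)
    then show ?thesis using assms unfolding vLam_def by blast
  qed
  then show ?thesis using assms vil_sub_in[of n k] by (simp add: vLam_def)
qed

text \<open>Orthogonality for a finite character group: either all terms are 1, or translating the
  summation index by a suitable \<open>n0\<close> multiplies the sum by a value different from
  1.\<close>

lemma sum_vch_vLam:
  assumes c: "c \<in> vil p"
  shows "(\<Sum>n\<in>vLam m. vch p 1 n c) = (if vfrac c \<in> vball p vil_zero m then of_nat (card (vLam m)) else 0)"
proof (cases "vfrac c \<in> vball p vil_zero m")
  case True
  have "vch p 1 n c = 1" if n: "n \<in> vLam m" for n
  proof -
    have "n j * c (1 - j) = 0" for j
    proof (cases "n j = 0")
      case False
      then have "j \<in> {m+1..0}" using n by (simp add: vLam_def)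
      then show ?thesis using True by (auto simp: vball_def vfrac_def vil_zero_def split: if_splits)
    qed simp
    then have "vpair n c = 0" unfolding vpair_def by (simp only: Sum_any.neutral)
    then show ?thesis by (simp add: vch_def)
  qed
  then show ?thesis using True by simp
next
  case False
  then obtain i where i: "i \<le> - m" "vfrac c i \<noteq> 0" using c by (auto simp: vball_def vil_zero_def)
  then have i0: "i > 0" "c i \<noteq> 0" by (auto simp: vfrac_def split: if_splits)
  \<comment> \<open>Here \<open>i\<close> lies in \<open>{1..-m}\<close>, so \<open>1 - i\<close> is
    an admissible position in \<open>{m+1..0}\<close>; the digit 1 there picks out
    \<open>c i\<close>.\<close>
  define n0 where "n0 = (\<lambda>j. if j = 1 - i then 1 else 0 :: int)"
  have n0v: "n0 \<in> vil p" unfolding n0_def by (rule single_in_vil) (use p2 in auto)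
  have n0: "n0 \<in> vLam m" using n0v i i0 by (auto simp: vLam_def n0_def)
  have "vpair n0 c = (\<Sum>j\<in>{1 - i}. n0 j * c (1 - j))"
    unfolding vpair_def by (rule Sum_any.expand_superset) (auto simp: n0_def)
  then have "vpair n0 c = c i" by (simp add: n0_def)
  then have ne: "vch p 1 n0 c \<noteq> 1"
    using i0 vil_bounds[OF c, of i] zdvd_not_zless[of "c i" p] by (auto simp: vch_def vroot_eq_1_iff)
  have vL: "n \<in> vil p" if "n \<in> vLam m" for n using that by (simp add: vLam_def)
  have "(\<Sum>n\<in>vLam m. vch p 1 n c) = (\<Sum>n\<in>vLam m. vch p 1 (vil_add p n0 n) c)"
  proof (rule sum.reindex_bij_witness[where i="\<lambda>n. vil_add p n0 n" and j="\<lambda>n. vil_sub p n n0"])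
    fix n assume n: "n \<in> vLam m"
    show "vil_add p n0 (vil_sub p n n0) = n" using vL[OF n] by simp
    show "vil_sub p n n0 \<in> vLam m" by (rule vLam_sub[OF n n0])
    show "vil_sub p (vil_add p n0 n) n0 = n" using vL[OF n] by simp
    show "vil_add p n0 n \<in> vLam m" by (rule vLam_add[OF n0 n])
    show "vch p 1 (vil_add p n0 (vil_sub p n n0)) c = vch p 1 n c" using vL[OF n] by simp
  qed
  also have "\<dots> = vch p 1 n0 c * (\<Sum>n\<in>vLam m. vch p 1 n c)"
    unfolding sum_distrib_left by (rule sum.cong[OF refl]) (use vL vch_add[OF n0v _ c] in auto)
  finally have "(1 - vch p 1 n0 c) * (\<Sum>n\<in>vLam m. vch p 1 n c) = 0" by (simp add: left_diff_distrib)
  then show ?thesis using ne False by simp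
qed

text \<open>Finite Fourier inversion on \<open>vil_U p\<close> modulo a ball: averaging the
  characters at \<open>vil_sub p b w\<close> detects whether the fractional part of \<open>w\<close>
  lies in the ball. It feeds both the passage from orthonormality to folding and the completeness of
  the exponentials of a tile.\<close>

lemma indicator_vfrac_vball:
  assumes b: "b \<in> vball p vil_zero 0" and w: "w \<in> vil p"
  shows "(indicator (vball p b m) (vfrac w) :: complex) =
    (\<Sum>n\<in>vLam m. (vch p 1 n b / of_nat (card (vLam m))) * vch p (-1) n w)"
proof -
  have bv: "b \<in> vil p" using b by (rule vball_vil)
  have K: "card (vLam m) \<noteq> 0" using finite_vLam zero_vLam by auto
  have "(\<Sum>n\<in>vLam m. (vch p 1 n b / of_nat (card (vLam m))) * vch p (-1) n w) =
      (\<Sum>n\<in>vLam m. vch p 1 n (vil_sub p b w)) / of_nat (card (vLam m))"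
    unfolding sum_divide_distrib
  proof (rule sum.cong[OF refl])
    fix n assume "n \<in> vLam m"
    then have "n \<in> vil p" by (simp add: vLam_def)
    then have "vch p 1 n (vil_sub p b w) = vch p 1 n b * vch p (-1) n w"
      using vch_sub[OF bv w, of n 1] by (simp add: vch_commute[of _ n])
    then show "(vch p 1 n b / of_nat (card (vLam m))) * vch p (-1) n w =
        vch p 1 n (vil_sub p b w) / of_nat (card (vLam m))" by simp
  qed
  also have "\<dots> = (if vfrac (vil_sub p b w) \<in> vball p vil_zero m then 1 else 0)"
    using sum_vch_vLam[OF vil_sub_in[OF bv w], of m] K by simp
  also have "vfrac (vil_sub p b w) \<in> vball p vil_zero m \<longleftrightarrow> vfrac w \<in> vball p b m"
  proof -
    have e: "vfrac (vil_sub p b w) = vil_sub p b (vfrac w)"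
      using b by (auto simp: vfrac_def vil_sub_def vball_def vil_zero_def fun_eq_iff)
    have "vil_sub p b (vfrac w) \<in> vball p vil_zero m \<longleftrightarrow> b \<in> vball p (vfrac w) m"
      using vball_zero_sub_iff[OF bv vfrac_in[OF w]] .
    also have "\<dots> \<longleftrightarrow> vfrac w \<in> vball p b m" using bv w by (auto simp: vball_def)
    finally show ?thesis unfolding e .
  qed
  finally show ?thesis by (simp add: indicator_def)
qed

end

context vilenkin
begin

section \<open>Folding, tiles and orthonormal exponentials\<close>

abbreviation vU :: "vseq set" where "vU \<equiv> vball p vil_zero 0"

lemma measurable_vfrac: "vfrac \<in> measurable M M"
proof (rule measurable_sigma_sets[OF sets_M vballs_Pow])
  fix S assume S: "S \<in> vballs p"
  show "vfrac -` S \<inter> space M \<in> sets M"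
  proof (rule sets_locally_ball)
    fix x assume x: "x \<in> vfrac -` S \<inter> space M"
    then obtain b m where b: "S = vball p b m" using S by (auto simp: vballs_def)
    have "vball p x m \<subseteq> vfrac -` S \<inter> space M"
    proof
      fix y assume y: "y \<in> vball p x m"
      then have yv: "y \<in> vil p" by (rule vball_vil)
      have "vfrac y \<in> vball p b m" using x y vfrac_in[OF yv] by (auto simp: b vball_def vfrac_def)
      then show "y \<in> vfrac -` S \<inter> space M" using yv b by simp
    qed
    then show "\<exists>m. vball p x m \<subseteq> vfrac -` S \<inter> space M" ..
  qed auto
qed auto

definition vil_tile :: "vseq set \<Rightarrow> bool" where
  "vil_tile E \<longleftrightarrow> E \<in> sets M \<and>
     (\<forall>n\<in>vil_Lambda p. emeasure M (E \<inter> (\<lambda>w. vil_add p w n) ` E) = (if n = vil_zero then 1 else 0))"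

text \<open>Folding \<open>E\<close> into \<open>vil_U p\<close> along \<open>vil_Lambda p\<close> is measure preserving.\<close>

definition vil_fold :: "vseq set \<Rightarrow> bool" where
  "vil_fold E \<longleftrightarrow> E \<in> sets M \<and> (\<forall>A\<in>sets M. emeasure M (E \<inter> vfrac -` A) = emeasure M (vU \<inter> A))"

lemma sets_vfrac_vimage:
  assumes "E \<in> sets M" "A \<in> sets M"
  shows "E \<inter> vfrac -` A \<in> sets M"
proof -
  have "E \<inter> (vfrac -` A \<inter> space M) \<in> sets M" using assms measurable_sets[OF measurable_vfrac] by blast
  moreover have "E \<inter> (vfrac -` A \<inter> space M) = E \<inter> vfrac -` A" using sets.sets_into_space[OF assms(1)] by blast
  ultimately show ?thesis by simp
qed

lemma vil_add_image': 
  assumes "E \<in> sets M" "n \<in> vil p"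
  shows "(\<lambda>w. vil_add p w n) ` E = {w \<in> vil p. vil_sub p w n \<in> E}"
  using vil_add_image[OF assms(2), of E] sets.sets_into_space[OF assms(1)] by (simp add: vil_add_commute[of _ n])

lemma sets_vil_add_image:
  assumes "E \<in> sets M" "n \<in> vil p"
  shows "(\<lambda>w. vil_add p w n) ` E \<in> sets M"
proof -
  have "(\<lambda>w. vil_sub p w n) \<in> measurable M M"
    by (rule measurable_vil_map[OF vil_sub_in[OF _ assms(2)] vil_sub_pre[OF assms(2)]])
  from measurable_sets[OF this assms(1)] show ?thesis
    unfolding vil_add_image'[OF assms] by (simp add: vimage_def Int_def conj_commute)
qed

text \<open>Since \<open>C\<close> lies in the cell of \<open>k\<close>, the set in
  \<open>vil_U p\<close> is its full preimage under one translation, so the measure is kept.\<close>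

lemma vil_tile_cell:
  assumes C: "C \<in> sets M" "C \<subseteq> vball p k 0" and k: "k \<in> vil_Lambda p"
  shows "{x \<in> vU. vil_add p k x \<in> C} \<in> sets M"
    and "emeasure M {x \<in> vU. vil_add p k x \<in> C} = emeasure M C"
proof -
  have kv: "k \<in> vil p" using k by (rule Lambda_vil)
  have eq: "{x \<in> vU. vil_add p k x \<in> C} = {x \<in> vil p. vil_add p k x \<in> C}"
  proof (intro set_eqI iffI)
    fix x assume x: "x \<in> {x \<in> vil p. vil_add p k x \<in> C}"
    then have "vil_add p k x \<in> vball p k 0" using C by blast
    then have "x \<in> vball p (vil_sub p k k) 0" using x vball_add_iff[OF _ kv kv] by simp
    moreover have "vil_sub p k k = vil_zero" by (simp add: vil_sub_def vil_zero_def)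
    ultimately show "x \<in> {x \<in> vU. vil_add p k x \<in> C}" using x by simp
  qed (auto dest: vball_vil)
  have m: "vil_add p k \<in> measurable M M" by (rule measurable_vil_map[OF vil_add_in[OF kv] vil_add_pre[OF kv]])
  show "{x \<in> vU. vil_add p k x \<in> C} \<in> sets M"
    unfolding eq using measurable_sets[OF m C(1)] by (simp add: vimage_def Int_def conj_commute)
  show "emeasure M {x \<in> vU. vil_add p k x \<in> C} = emeasure M C"
    unfolding eq using emeasure_vil_map[OF vil_add_in[OF kv] vil_add_pre[OF kv] C(1)] by simp
qed

lemma emeasure_vU [simp]: "emeasure M vU = 1"
  by (simp add: emeasure_vball)

text \<open>If no two points of \<open>E\<close> are congruent modulo \<open>vil_Lambda p\<close>, then folding is injective.\<close>

lemma emeasure_fold_le: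
  assumes E: "E \<in> sets M" and A: "A \<in> sets M"
    and inj: "\<And>n. n \<in> vil_Lambda p \<Longrightarrow> n \<noteq> vil_zero \<Longrightarrow> E \<inter> (\<lambda>w. vil_add p w n) ` E = {}"
  shows "emeasure M (E \<inter> vfrac -` A) \<le> emeasure M (vU \<inter> A)"
proof -
  let ?S = "\<lambda>k. E \<inter> vfrac -` A \<inter> vball p k 0"
  let ?D = "\<lambda>k. {x \<in> vU. vil_add p k x \<in> ?S k}"
  have S: "?S k \<in> sets M" if "k \<in> vil_Lambda p" for k
    using sets_vfrac_vimage[OF E A] vball_sets[OF Lambda_vil[OF that]] by blast
  have U: "E \<inter> vfrac -` A = (\<Union>k\<in>vil_Lambda p. ?S k)"
    using UN_vball_Lambda sets.sets_into_space[OF E] by auto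
  have dj: "disjoint_family_on ?S (vil_Lambda p)"
    unfolding disjoint_family_on_def
  proof (intro ballI impI)
    fix k l assume "k \<in> vil_Lambda p" "l \<in> vil_Lambda p" "k \<noteq> l"
    then have "vball p k 0 \<inter> vball p l 0 = {}" using vball_Lambda_disjoint[of k l] by blast
    then show "?S k \<inter> ?S l = {}" by blast
  qed
  have "emeasure M (E \<inter> vfrac -` A) = (\<integral>\<^sup>+k. emeasure M (?S k) \<partial>count_space (vil_Lambda p))"
    using emeasure_UN_countable[OF S countable_vil_Lambda dj] unfolding U[symmetric] .
  also have "\<dots> = (\<integral>\<^sup>+k. emeasure M (?D k) \<partial>count_space (vil_Lambda p))"
    by (rule nn_integral_cong) (use vil_tile_cell(2)[OF S] in auto)
  also have "\<dots> = emeasure M (\<Union>k\<in>vil_Lambda p. ?D k)"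
  proof (rule emeasure_UN_countable[symmetric, OF _ countable_vil_Lambda])
    show "?D k \<in> sets M" if "k \<in> vil_Lambda p" for k by (rule vil_tile_cell(1)[OF S[OF that] _ that]) blast
    show "disjoint_family_on ?D (vil_Lambda p)"
      unfolding disjoint_family_on_def
    proof (intro ballI impI)
      fix k l assume kl: "k \<in> vil_Lambda p" "l \<in> vil_Lambda p" "k \<noteq> l"
      have kv: "k \<in> vil p" "l \<in> vil p" using kl Lambda_vil by auto
      have ne: "vil_sub p k l \<noteq> vil_zero" using kl vil_sub_eq_zero_iff[OF kv] by simp
      show "?D k \<inter> ?D l = {}"
      proof (rule ccontr)
        assume "?D k \<inter> ?D l \<noteq> {}"
        then obtain x where x: "x \<in> vU" "vil_add p k x \<in> E" "vil_add p l x \<in> E" by auto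
        have xv: "x \<in> vil p" using x(1) by (rule vball_vil)
        \<comment> \<open>Two points of \<open>E\<close> over the same \<open>x\<close> differ by
          the nonzero element \<open>vil_sub p k l\<close> of \<open>vil_Lambda p\<close>, which
          \<open>inj\<close> excludes.\<close>
        have "vil_add p (vil_add p l x) (vil_sub p k l) = vil_add p k x"
          by (simp add: vil_add_def vil_sub_def fun_eq_iff mod_simps add.commute)
        then have "vil_add p k x \<in> (\<lambda>w. vil_add p w (vil_sub p k l)) ` E" using x(3) by (metis imageI)
        then show False using inj[OF Lambda_sub[OF kl(1,2)] ne] x(2) by blast
      qed
    qed
  qed
  also have "\<dots> \<le> emeasure M (vU \<inter> A)"
  proof (rule emeasure_mono)
    show "(\<Union>k\<in>vil_Lambda p. ?D k) \<subseteq> vU \<inter> A"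
      using vil_add_Lambda_vball(2) by fastforce
    show "vU \<inter> A \<in> sets M" using A by auto
  qed
  finally show ?thesis .
qed

lemma vil_tile_null:
  assumes "vil_tile E"
  shows "(\<Union>n\<in>vil_Lambda p - {vil_zero}. E \<inter> (\<lambda>w. vil_add p w n) ` E) \<in> null_sets M"
proof (rule null_sets_UN')
  show "countable (vil_Lambda p - {vil_zero})" using countable_vil_Lambda by simp
  show "E \<inter> (\<lambda>w. vil_add p w n) ` E \<in> null_sets M" if "n \<in> vil_Lambda p - {vil_zero}" for n
    using that assms sets_vil_add_image[OF _ Lambda_vil[of n], of E]
    unfolding vil_tile_def by (auto intro!: null_setsI)
qed

text \<open>Off a null set no two points of \<open>E\<close> are congruent, so the folded measure of
  every set is at most its measure in \<open>vil_U p\<close>. Both measures have total mass 1, and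
  the bound for the complement turns this into equality.\<close>

lemma vil_tile_imp_fold:
  assumes "vil_tile E"
  shows "vil_fold E"
proof -
  have E: "E \<in> sets M" and tile: "\<And>n. n \<in> vil_Lambda p \<Longrightarrow>
      emeasure M (E \<inter> (\<lambda>w. vil_add p w n) ` E) = (if n = vil_zero then 1 else 0)"
    using assms by (auto simp: vil_tile_def)
  define Z where "Z = (\<Union>n\<in>vil_Lambda p - {vil_zero}. E \<inter> (\<lambda>w. vil_add p w n) ` E)"
  have Z: "Z \<in> null_sets M" unfolding Z_def by (rule vil_tile_null[OF assms])
  let ?E = "E - Z"
  have E': "?E \<in> sets M" using E Z by auto
  have inj: "?E \<inter> (\<lambda>w. vil_add p w n) ` ?E = {}" if "n \<in> vil_Lambda p" "n \<noteq> vil_zero" for n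
    using that by (auto simp: Z_def)
  have same: "emeasure M (?E \<inter> vfrac -` A) = emeasure M (E \<inter> vfrac -` A)" if "A \<in> sets M" for A
  proof -
    have "?E \<inter> vfrac -` A = (E \<inter> vfrac -` A) - Z" by blast
    then show ?thesis using emeasure_Diff_null_set[OF Z sets_vfrac_vimage[OF E that]] by simp
  qed
  have le: "emeasure M (E \<inter> vfrac -` A) \<le> emeasure M (vU \<inter> A)" if "A \<in> sets M" for A
    using emeasure_fold_le[OF E' that inj] same[OF that] by simp
  have z: "(\<lambda>w. vil_add p w vil_zero) ` E = E"
    using vil_add_image'[OF E vil_zero_in] sets.sets_into_space[OF E] by auto
  have E1: "emeasure M E = 1" using tile[OF zero_Lambda] by (simp add: z)
  have "emeasure M (E \<inter> vfrac -` A) = emeasure M (vU \<inter> A)" if A: "A \<in> sets M" for A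
  proof -
    have A': "vil p - A \<in> sets M" using A sets.compl_sets[of A M] by simp
    have EM: "E \<subseteq> vil p" using sets.sets_into_space[OF E] by simp
    have "emeasure M (E \<inter> vfrac -` A) + emeasure M (E \<inter> vfrac -` (vil p - A)) =
        emeasure M ((E \<inter> vfrac -` A) \<union> (E \<inter> vfrac -` (vil p - A)))"
      by (rule plus_emeasure) (use sets_vfrac_vimage[OF E] A A' in auto)
    also have "(E \<inter> vfrac -` A) \<union> (E \<inter> vfrac -` (vil p - A)) = E" using EM by auto
    finally have 1: "emeasure M (E \<inter> vfrac -` A) + emeasure M (E \<inter> vfrac -` (vil p - A)) = 1"
      using E1 by simp
    have "emeasure M (vU \<inter> A) + emeasure M (vU \<inter> (vil p - A)) = emeasure M ((vU \<inter> A) \<union> (vU \<inter> (vil p - A)))"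
      by (rule plus_emeasure) (use A A' in auto)
    also have "(vU \<inter> A) \<union> (vU \<inter> (vil p - A)) = vU" using vball_sub_vil by blast
    finally have 2: "emeasure M (vU \<inter> A) + emeasure M (vU \<inter> (vil p - A)) = 1" by simp
    have fin: "emeasure M (E \<inter> vfrac -` (vil p - A)) \<noteq> \<infinity>" "emeasure M (vU \<inter> (vil p - A)) \<noteq> \<infinity>"
      using 1 2 by (metis ennreal_add_eq_top ennreal_one_neq_top infinity_ennreal_def)+
    have "emeasure M (vU \<inter> A) + emeasure M (vU \<inter> (vil p - A)) \<le>
        emeasure M (E \<inter> vfrac -` A) + emeasure M (vU \<inter> (vil p - A))"
      unfolding 2 1[symmetric] by (rule add_left_mono[OF le[OF A']])
    then have "emeasure M (vU \<inter> A) \<le> emeasure M (E \<inter> vfrac -` A)"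
      using fin(2) by (simp add: ennreal_add_left_cancel_le add.commute)
    then show ?thesis using le[OF A] by simp
  qed
  then show ?thesis using E by (simp add: vil_fold_def)
qed

text \<open>The part of \<open>E\<close> in one cell already accounts for the whole mass over its
  trace \<open>?D k\<close> in \<open>vil_U p\<close>, so the rest \<open>?R k\<close> of
  \<open>E\<close> over that trace is null. If two different points of \<open>E\<close> are
  congruent, each lies in such a rest.\<close>

lemma vil_fold_imp_tile:
  assumes "vil_fold E"
  shows "vil_tile E"
proof -
  have E: "E \<in> sets M" and fold: "\<And>A. A \<in> sets M \<Longrightarrow> emeasure M (E \<inter> vfrac -` A) = emeasure M (vU \<inter> A)"
    using assms by (auto simp: vil_fold_def)
  have EM: "E \<subseteq> vil p" using sets.sets_into_space[OF E] by simp
  let ?C = "\<lambda>k. E \<inter> vball p k 0"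
  let ?D = "\<lambda>k. {x \<in> vU. vil_add p k x \<in> ?C k}"
  let ?R = "\<lambda>k. (E \<inter> vfrac -` ?D k) - vball p k 0"
  have C: "?C k \<in> sets M" if "k \<in> vil_Lambda p" for k using E vball_sets[OF Lambda_vil[OF that]] by blast
  have R: "?R k \<in> null_sets M" if k: "k \<in> vil_Lambda p" for k
  proof -
    have D: "?D k \<in> sets M" by (rule vil_tile_cell(1)[OF C[OF k] _ k]) blast
    have Dm: "emeasure M (?D k) = emeasure M (?C k)" by (rule vil_tile_cell(2)[OF C[OF k] _ k]) blast
    have RS: "?R k \<in> sets M" using sets_vfrac_vimage[OF E D] vball_sets[OF Lambda_vil[OF k]] by blast
    have sub: "?C k \<subseteq> E \<inter> vfrac -` ?D k"
    proof
      fix w assume w: "w \<in> ?C k"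
      then have "vil_add p k (vfrac w) = w" using vfrac_vball[OF _ k] by simp
      then show "w \<in> E \<inter> vfrac -` ?D k" using w vfrac_U[of w] EM by auto
    qed
    have "emeasure M (?C k) + emeasure M (?R k) = emeasure M (?C k \<union> ?R k)"
      by (rule plus_emeasure[OF C[OF k] RS]) blast
    also have "?C k \<union> ?R k = E \<inter> vfrac -` ?D k" using sub by blast
    also have "emeasure M \<dots> = emeasure M (?C k)"
      using fold[OF D] Dm by (simp add: Int_absorb1 Int_commute[of vU]) (metis (no_types, lifting) Int_absorb2 mem_Collect_eq subsetI)
    finally have eq: "emeasure M (?C k) + emeasure M (?R k) = emeasure M (?C k)" .
    have "emeasure M (?C k) \<le> emeasure M (vball p k 0)"
      using Lambda_vil[OF k] by (intro emeasure_mono) auto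
    \<comment> \<open>Finiteness of this mass is what permits cancelling it in the extended
      reals.\<close>
    then have "emeasure M (?C k) \<noteq> \<infinity>" using emeasure_vball[OF Lambda_vil[OF k], of 0] by (auto simp: top_unique)
    then have "emeasure M (?R k) = 0"
      using eq ennreal_add_left_cancel[of "emeasure M (?C k)" "emeasure M (?R k)" 0] by simp
    then show ?thesis using RS by (simp add: null_setsI)
  qed
  have "emeasure M (E \<inter> (\<lambda>w. vil_add p w n) ` E) = (if n = vil_zero then 1 else 0)"
    if n: "n \<in> vil_Lambda p" for n
  proof (cases "n = vil_zero")
    case True
    have z: "(\<lambda>w. vil_add p w vil_zero) ` E = E"
      using vil_add_image'[OF E vil_zero_in] EM by auto
    have "E \<inter> vfrac -` vil p = E" using EM by auto
    then have "emeasure M E = emeasure M (vU \<inter> vil p)" using fold[OF sets.top] by simp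
    also have "vU \<inter> vil p = vU" using vball_sub_vil by blast
    finally show ?thesis by (simp add: True z)
  next
    case False
    have nR: "(\<Union>k\<in>vil_Lambda p. ?R k) \<in> null_sets M"
      by (rule null_sets_UN'[OF countable_vil_Lambda R])
    have sub: "E \<inter> (\<lambda>w. vil_add p w n) ` E \<subseteq> (\<Union>k\<in>vil_Lambda p. ?R k)"
    proof
      fix w assume "w \<in> E \<inter> (\<lambda>w. vil_add p w n) ` E"
      then obtain v where v: "w \<in> E" "v \<in> E" "w = vil_add p v n" by blast
      have vv: "v \<in> vil p" "w \<in> vil p" using v EM by auto
      define k where "k = vil_sub p v (vfrac v)"
      have k: "k \<in> vil_Lambda p" unfolding k_def by (rule vint_in[OF vv(1)])
      have vk: "v \<in> vball p k 0" using vball_Lambda_iff[OF vv(1) k] k_def by simp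
      have fr: "vfrac w = vfrac v" unfolding v(3) by (rule vfrac_add_Lambda[OF vv(1) n])
      \<comment> \<open>\<open>w\<close> has the fractional part of \<open>v\<close>, hence lies
        over the trace of the cell of \<open>v\<close>; being a different point, it must lie in
        another cell.\<close>
      have "vfrac w \<in> ?D k" using fr vfrac_vball[OF vk k] v vk vfrac_U[OF vv(1)] by simp
      moreover have "w \<notin> vball p k 0"
      proof
        assume "w \<in> vball p k 0"
        then have "vil_sub p w (vfrac w) = k" using vball_Lambda_iff[OF vv(2) k] by simp
        then have "w = vil_add p k (vfrac w)" using vil_add_sub_cancel[OF vv(2), of "vfrac w"] by (simp add: vil_add_commute)
        also have "\<dots> = v" using fr vfrac_vball[OF vk k] by simp
        finally have "w = v" .
        then have "n = vil_zero" using v(3) vil_sub_add_cancel[OF Lambda_vil[OF n], of v]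
          by (simp add: vil_sub_def vil_zero_def)
        then show False using False by simp
      qed
      ultimately show "w \<in> (\<Union>k\<in>vil_Lambda p. ?R k)" using k v(1) by blast
    qed
    have "E \<inter> (\<lambda>w. vil_add p w n) ` E \<in> null_sets M"
      by (rule null_sets_subset[OF nR sets.Int[OF E sets_vil_add_image[OF E Lambda_vil[OF n]]] sub])
    then show ?thesis using False by (simp add: null_setsD1)
  qed
  then show ?thesis using E by (simp add: vil_tile_def)
qed

lemma vil_tile_emeasure:
  assumes "vil_tile E"
  shows "E \<in> sets M" "emeasure M E = 1"
proof -
  show E: "E \<in> sets M" using assms by (simp add: vil_tile_def)
  have "(\<lambda>w. vil_add p w vil_zero) ` E = E"
    using vil_add_image'[OF E vil_zero_in] sets.sets_into_space[OF E] by auto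
  moreover have "emeasure M (E \<inter> (\<lambda>w. vil_add p w vil_zero) ` E) = 1"
    using assms zero_Lambda unfolding vil_tile_def by (metis (full_types))
  ultimately show "emeasure M E = 1" by simp
qed

text \<open>The cells themselves are tiles; their exponentials are the reference basis in
  \<open>vech_basis_modulus\<close>.\<close>

lemma vil_tile_vball:
  assumes k: "k \<in> vil_Lambda p"
  shows "vil_tile (vball p k 0)"
proof -
  have kv: "k \<in> vil p" using k by (rule Lambda_vil)
  have "emeasure M (vball p k 0 \<inter> (\<lambda>w. vil_add p w n) ` vball p k 0) = (if n = vil_zero then 1 else 0)"
    if n: "n \<in> vil_Lambda p" for n
  proof -
    have nv: "n \<in> vil p" using n by (rule Lambda_vil)
    have im: "(\<lambda>w. vil_add p w n) ` vball p k 0 = vball p (vil_add p k n) 0"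
      unfolding vil_add_image'[OF vball_sets[OF kv] nv]
      using vball_sub_vil[of "vil_add p k n" 0] by (auto simp: vball_sub_iff kv nv)
    show ?thesis
    proof (cases "n = vil_zero")
      case True
      then have "vil_add p k n = k" using kv by (simp add: vil_add_def vil_zero_def)
      then show ?thesis unfolding im using True by (simp add: emeasure_vball kv)
    next
      case False
      have "vball p k 0 \<inter> vball p (vil_add p k n) 0 = {}"
      proof (rule ccontr)
        assume "vball p k 0 \<inter> vball p (vil_add p k n) 0 \<noteq> {}"
        then have "k = vil_add p k n" using vball_Lambda_disjoint[OF k Lambda_add[OF k n]] by blast
        then have "n = vil_sub p k k" using vil_sub_add_cancel[OF nv, of k] by simp
        then show False using False by (simp add: vil_sub_def vil_zero_def)
      qed
      then show ?thesis using False by (simp add: im)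
    qed
  qed
  then show ?thesis using kv by (simp add: vil_tile_def)
qed

text \<open>If \<open>h\<close> is the transform of \<open>f\<close>, this is the transform of the
  translate of \<open>f\<close> by \<open>n\<close>, as \<open>fdil_0\<close> and
  \<open>fext_vil_dil\<close> show.\<close>

definition vech :: "(vseq \<Rightarrow> complex) \<Rightarrow> vseq \<Rightarrow> vseq \<Rightarrow> complex" where
  "vech h n w = h w * vch p (-1) n w"

lemma vech_space:
  assumes "h \<in> L2_space M" "n \<in> vil_Lambda p"
  shows "vech h n \<in> L2_space M"
  unfolding vech_def[abs_def]
  by (rule L2_mult_bounded[OF assms(1) measurable_vch[OF Lambda_vil[OF assms(2)]]]) simp

text \<open>Only the squared modulus of \<open>h\<close> and the difference of the indices enter, so
  orthonormality becomes a statement on the Fourier coefficients of the squared modulus.\<close>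

lemma inner_vech:
  assumes "n \<in> vil_Lambda p" "k \<in> vil_Lambda p"
  shows "L2_inner M (vech h n) (vech h k) = (LINT w|M. of_real ((cmod (h w))\<^sup>2) * vch p (-1) (vil_sub p n k) w)"
  unfolding L2_inner_def
proof (rule Bochner_Integration.integral_cong[OF refl])
  fix w assume "w \<in> space M"
  then have "vch p (-1) (vil_sub p n k) w = vch p (-1) n w * vch p 1 k w"
    using vch_sub[OF Lambda_vil[OF assms(1)] Lambda_vil[OF assms(2)], of w "-1"] by simp
  then show "vech h n w * cnj (vech h k w) = of_real ((cmod (h w))\<^sup>2) * vch p (-1) (vil_sub p n k) w"
    by (simp only: vech_def complex_cnj_mult cnj_vch complex_norm_square) (simp add: mult_ac)
qed

lemma emeasure_distr_vfrac:
  assumes E: "E \<in> sets M" and A: "A \<in> sets M"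
  shows "emeasure (distr (density M (indicator E)) M vfrac) A = emeasure M (E \<inter> vfrac -` A)"
proof -
  have v: "vfrac -` A \<inter> space M \<in> sets M" by (rule measurable_sets[OF measurable_vfrac A])
  have "emeasure (distr (density M (indicator E)) M vfrac) A = emeasure M (E \<inter> (vfrac -` A \<inter> space M))"
    using measurable_vfrac A E v
    by (subst emeasure_distr) (simp_all add: emeasure_density indicator_inter_arith[symmetric])
  also have "E \<inter> (vfrac -` A \<inter> space M) = E \<inter> vfrac -` A" using sets.sets_into_space[OF E] by auto
  finally show ?thesis .
qed

text \<open>Characters with index in \<open>vil_Lambda p\<close> factor through
  \<open>vfrac\<close>, so their integral over \<open>E\<close> is one over the folded measure, that
  is over \<open>vil_U p\<close>, where they are orthogonal. Any phase of \<open>h\<close>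
  cancels.\<close>

lemma vil_fold_orthonormal:
  assumes fold: "vil_fold E" and h: "h \<in> L2_space M"
    and abs: "AE w in M. cmod (h w) = indicator E w"
  shows "L2_orthonormal M (vil_Lambda p) (vech h)"
proof -
  have E: "E \<in> sets M" and fold: "\<And>A. A \<in> sets M \<Longrightarrow> emeasure M (E \<inter> vfrac -` A) = emeasure M (vU \<inter> A)"
    using assms by (auto simp: vil_fold_def)
  have EM: "E \<subseteq> vil p" using sets.sets_into_space[OF E] by simp
  have hm: "h \<in> borel_measurable M" using h by (rule L2_spaceD)
  have meq: "distr (density M (indicator E)) M vfrac = density M (indicator vU)"
  proof (rule measure_eqI)
    fix A assume "A \<in> sets (distr (density M (indicator E)) M vfrac)"
    then have A: "A \<in> sets M" by simp
    show "emeasure (distr (density M (indicator E)) M vfrac) A = emeasure (density M (indicator vU)) A"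
      unfolding emeasure_distr_vfrac[OF E A] emeasure_restricted[OF vball_sets[OF vil_zero_in] A]
      by (rule fold[OF A])
  qed simp
  have int: "(LINT w|M. of_real ((cmod (h w))\<^sup>2) * vch p (-1) n w) = (if n = vil_zero then 1 else 0)"
    if n: "n \<in> vil_Lambda p" for n
  proof -
    have nv: "n \<in> vil p" using n by (rule Lambda_vil)
    note cm = measurable_vch[OF nv, of "-1"]
    have "(LINT w|M. of_real ((cmod (h w))\<^sup>2) * vch p (-1) n w) = (LINT w|M. indicator E w *\<^sub>R vch p (-1) n (vfrac w))"
    proof (rule integral_cong_AE)
      show "(\<lambda>w. of_real ((cmod (h w))\<^sup>2) * vch p (-1) n w) \<in> borel_measurable M" using hm cm by measurable
      show "(\<lambda>w. indicator E w *\<^sub>R vch p (-1) n (vfrac w)) \<in> borel_measurable M"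
        using measurable_compose[OF measurable_vfrac cm] E by measurable
      show "AE w in M. of_real ((cmod (h w))\<^sup>2) * vch p (-1) n w = indicator E w *\<^sub>R vch p (-1) n (vfrac w)"
        using abs AE_space
      proof eventually_elim
        case (elim w)
        then show ?case using vch_vfrac[of w n "-1"] n by (simp add: indicator_def)
      qed
    qed
    also have "\<dots> = (LINT w|density M (indicator E). vch p (-1) n (vfrac w))"
      using measurable_compose[OF measurable_vfrac cm] E
      by (subst integral_density[where g="\<lambda>w. indicator E w", symmetric]) (auto simp: ennreal_indicator)
    also have "\<dots> = (LINT w|distr (density M (indicator E)) M vfrac. vch p (-1) n w)"
      using measurable_vfrac cm by (subst integral_distr) auto
    also have "\<dots> = (LINT w|density M (indicator vU). vch p (-1) n w)" by (simp only: meq)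
    also have "\<dots> = (LINT w|M. indicator vU w *\<^sub>R vch p (-1) n w)"
      using cm vball_sets[OF vil_zero_in, of 0]
      by (subst integral_density[where g="\<lambda>w. indicator vU w", symmetric])
         (auto simp: ennreal_indicator intro!: borel_measurable_indicator)
    also have "\<dots> = (LINT w|M. indicator vU w * vch p (-1) n w)"
      by (rule Bochner_Integration.integral_cong) (simp_all add: indicator_def)
    also have "\<dots> = (if n \<in> vU then 1 else 0)" using integral_vch_vball[OF nv, of "-1" 0] by simp
    also have "n \<in> vU \<longleftrightarrow> n = vil_zero" by (rule Lambda_U_iff[OF n])
    finally show ?thesis .
  qed
  show ?thesis unfolding L2_orthonormal_def
  proof (intro conjI ballI)
    fix n k assume nk: "n \<in> vil_Lambda p" "k \<in> vil_Lambda p"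
    then show "L2_inner M (vech h n) (vech h k) = (if n = k then 1 else 0)"
      using inner_vech[OF nk] int[OF Lambda_sub[OF nk]] vil_sub_eq_zero_iff[OF Lambda_vil[OF nk(1)] Lambda_vil[OF nk(2)]]
      by simp
  qed (rule vech_space[OF h])
qed

text \<open>Orthonormality gives the indicator of \<open>E\<close> the same coefficients at
  \<open>vil_Lambda p\<close> as the indicator of \<open>vil_U p\<close>. Finite averages of
  characters then give equal folded mass of balls, and balls determine the measure.\<close>

lemma vil_fold_if_orthonormal:
  assumes E: "E \<in> sets M" and fin: "emeasure M E < \<infinity>" and h: "h \<in> L2_space M"
    and abs: "AE w in M. cmod (h w) = indicator E w"
    and on: "L2_orthonormal M (vil_Lambda p) (vech h)"
  shows "vil_fold E"
proof -
  have EM: "E \<subseteq> vil p" using sets.sets_into_space[OF E] by simp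
  have hm: "h \<in> borel_measurable M" using h by (rule L2_spaceD)
  have iE: "integrable M (indicator E :: _ \<Rightarrow> complex)" by (rule integrable_indicator_complex[OF E fin])
  have coef: "(LINT w|M. indicator E w * vch p (-1) n w) = (if n = vil_zero then 1 else 0)"
    if n: "n \<in> vil_Lambda p" for n
  proof -
    have "vil_sub p n vil_zero = n" using Lambda_vil[OF n] by simp
    then have "(if n = vil_zero then 1 else 0) = (LINT w|M. of_real ((cmod (h w))\<^sup>2) * vch p (-1) n w)"
      using inner_vech[OF n zero_Lambda, of h] L2_orthonormal_inner[OF on n zero_Lambda] by simp
    also have "\<dots> = (LINT w|M. indicator E w * vch p (-1) n w)"
    proof (rule integral_cong_AE)
      show "(\<lambda>w. of_real ((cmod (h w))\<^sup>2) * vch p (-1) n w) \<in> borel_measurable M"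
        using hm measurable_vch[OF Lambda_vil[OF n], of "-1"] by measurable
      show "(\<lambda>w. indicator E w * vch p (-1) n w) \<in> borel_measurable M"
        using measurable_vch[OF Lambda_vil[OF n], of "-1"] E by (intro borel_measurable_times borel_measurable_indicator)
      show "AE w in M. of_real ((cmod (h w))\<^sup>2) * vch p (-1) n w = indicator E w * vch p (-1) n w"
        using abs by eventually_elim (simp add: indicator_def)
    qed
    finally show ?thesis by simp
  qed
  have coefU: "(LINT w|M. indicator vU w * vch p (-1) n w) = (if n = vil_zero then 1 else 0)"
    if n: "n \<in> vil_Lambda p" for n
    using integral_vch_vball[OF Lambda_vil[OF n], of "-1" 0] by (simp add: Lambda_U_iff[OF n])
  have ball: "emeasure M (E \<inter> vfrac -` vball p b m) = emeasure M (vU \<inter> vball p b m)" if b: "b \<in> vU" for b m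
  proof -
    have bv: "b \<in> vil p" using b by (rule vball_vil)
    let ?c = "\<lambda>n. vch p 1 n b / of_nat (card (vLam m))"
    \<comment> \<open>Formulated for any set \<open>F\<close> with these coefficients: only the term
      at \<open>vil_zero\<close> of the finite average survives, so the value does not depend on
      \<open>F\<close>.\<close>
    have key: "(LINT w|M. indicator F w * indicator (vball p b m) (vfrac w)) = ?c vil_zero"
      if F: "integrable M (indicator F :: _ \<Rightarrow> complex)"
        "\<And>n. n \<in> vil_Lambda p \<Longrightarrow> (LINT w|M. indicator F w * vch p (-1) n w) = (if n = vil_zero then 1 else 0)" for F
    proof -
      have "(LINT w|M. indicator F w * indicator (vball p b m) (vfrac w)) =
          (LINT w|M. (\<Sum>n\<in>vLam m. ?c n * (indicator F w * vch p (-1) n w)))"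
        by (rule Bochner_Integration.integral_cong[OF refl])
           (simp add: indicator_vfrac_vball[OF b] sum_distrib_left mult_ac)
      also have "\<dots> = (\<Sum>n\<in>vLam m. (LINT w|M. ?c n * (indicator F w * vch p (-1) n w)))"
        by (intro Bochner_Integration.integral_sum integrable_mult_right integrable_mult_vch F(1))
           (simp add: vLam_def)
      also have "\<dots> = (\<Sum>n\<in>vLam m. if n = vil_zero then ?c n else 0)"
      proof (rule sum.cong[OF refl])
        fix n assume n: "n \<in> vLam m"
        have "(LINT w|M. ?c n * (indicator F w * vch p (-1) n w)) = ?c n * (LINT w|M. indicator F w * vch p (-1) n w)"
          by (rule integral_mult_right_zero)
        also have "\<dots> = (if n = vil_zero then ?c n else 0)"
          unfolding F(2)[OF vLam_Lambda[OF n]] by simp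
        finally show "(LINT w|M. ?c n * (indicator F w * vch p (-1) n w)) = (if n = vil_zero then ?c n else 0)" .
      qed
      also have "\<dots> = ?c vil_zero" using finite_vLam zero_vLam by simp
      finally show ?thesis .
    qed
    have meas: "(LINT w|M. indicator F w * indicator (vball p b m) (vfrac w)) =
        complex_of_real (measure M (F \<inter> vfrac -` vball p b m))" if "F \<subseteq> vil p" for F
    proof -
      have "(LINT w|M. indicator F w * indicator (vball p b m) (vfrac w)) =
          (LINT w|M. complex_of_real (indicator (F \<inter> vfrac -` vball p b m) w))"
        by (rule Bochner_Integration.integral_cong) (auto simp: indicator_def)
      also have "\<dots> = complex_of_real (LINT w|M. indicator (F \<inter> vfrac -` vball p b m) w)"
        by (rule integral_complex_of_real)
      also have "(LINT w|M. indicator (F \<inter> vfrac -` vball p b m) w) = measure M (F \<inter> vfrac -` vball p b m)"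
      proof -
        have "F \<inter> vfrac -` vball p b m \<inter> space M = F \<inter> vfrac -` vball p b m" using that by auto
        then show ?thesis by simp
      qed
      finally show ?thesis .
    qed
    have "complex_of_real (measure M (E \<inter> vfrac -` vball p b m)) = ?c vil_zero"
      by (rule trans[OF meas[OF EM, symmetric] key[OF iE coef]])
    also have "\<dots> = complex_of_real (measure M (vU \<inter> vfrac -` vball p b m))"
      by (rule trans[OF key[OF integrable_indicator_vball[OF vil_zero_in] coefU, symmetric] meas[OF vball_sub_vil]])
    finally have "measure M (E \<inter> vfrac -` vball p b m) = measure M (vU \<inter> vfrac -` vball p b m)" by (simp only: of_real_eq_iff)
    moreover have "vU \<inter> vfrac -` vball p b m = vU \<inter> vball p b m" using vfrac_id by auto
    moreover have "emeasure M (E \<inter> vfrac -` vball p b m) \<noteq> \<infinity>"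
    proof -
      have "emeasure M (E \<inter> vfrac -` vball p b m) \<le> emeasure M E" using E by (intro emeasure_mono) auto
      then show ?thesis using fin by (auto simp: top_unique)
    qed
    moreover have "emeasure M (vU \<inter> vball p b m) \<noteq> \<infinity>"
    proof -
      have "emeasure M (vU \<inter> vball p b m) \<le> emeasure M vU" by (intro emeasure_mono) auto
      then show ?thesis by (auto simp: top_unique)
    qed
    ultimately show ?thesis by (simp add: emeasure_eq_ennreal_measure)
  qed
  have ball': "emeasure M (E \<inter> vfrac -` vball p b m) = emeasure M (vU \<inter> vball p b m)" if b: "b \<in> vil p" for b m
  proof -
    \<comment> \<open>A ball that meets \<open>vil_U p\<close> can be recentred at a point of
      \<open>vil_U p\<close>; any other ball contains no fractional parts.\<close>
    consider "vU \<inter> vball p b m = {}" | c where "c \<in> vU" "c \<in> vball p b m" by blast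
    then show ?thesis
    proof cases
      case 1
      then have "E \<inter> vfrac -` vball p b m = {}" using EM vfrac_U by auto
      then show ?thesis using 1 by (simp only:)
    next
      case (2 c)
      then show ?thesis using ball[of c m] vball_eq[of c b m] by simp
    qed
  qed
  let ?ME = "distr (density M (indicator E)) M vfrac"
  let ?MU = "density M (indicator vU)"
  note emE = emeasure_distr_vfrac[OF E]
  have emU: "emeasure ?MU A = emeasure M (vU \<inter> A)" if A: "A \<in> sets M" for A
    by (rule emeasure_restricted[OF vball_sets[OF vil_zero_in] A])
  have "?ME = ?MU"
  proof (rule measure_eqI_generator_eq[OF Int_stable_vballs vballs_Pow])
    fix X assume "X \<in> vballs p"
    then show "emeasure ?ME X = emeasure ?MU X"
      using ball' emE[OF vball_sets] emU[OF vball_sets] by (auto simp: vballs_def)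
  next
    fix i
    have "emeasure ?ME (vball p vil_zero (int i)) \<le> emeasure M E"
      unfolding emE[OF vball_sets[OF vil_zero_in]] using E by (intro emeasure_mono) auto
    then show "emeasure ?ME (vball p vil_zero (int i)) \<noteq> \<infinity>" using fin by (auto simp: top_unique)
  next
    show "range (\<lambda>n. vball p vil_zero (int n)) \<subseteq> vballs p" by auto
    show "(\<Union>n. vball p vil_zero (int n)) = vil p" by (rule UN_vball_zero)
  qed (simp_all add: sets_M)
  then show ?thesis using E emE emU by (simp add: vil_fold_def)
qed

end

lemma L2_closed_span_image:
  assumes "\<And>i. i \<in> I \<Longrightarrow> b (h i) \<in> L2_space M"
  shows "L2_closed_span M (h ` I) b = L2_closed_span M I (\<lambda>i. b (h i))"
proof
  have b: "b k \<in> L2_space M" if "k \<in> h ` I" for k using that assms by auto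
  show "L2_closed_span M (h ` I) b \<subseteq> L2_closed_span M I (\<lambda>i. b (h i))"
  proof (rule L2_closed_span_minimal[OF L2_closed_subspace_closed_span[OF assms]])
    fix k assume "k \<in> h ` I"
    then obtain i where i: "i \<in> I" "k = h i" by blast
    show "b k \<in> L2_closed_span M I (\<lambda>i. b (h i))"
      using L2_closed_span_base[where b="\<lambda>i. b (h i)", OF assms[OF i(1)] i(1)] i(2) by simp
  qed
  show "L2_closed_span M I (\<lambda>i. b (h i)) \<subseteq> L2_closed_span M (h ` I) b"
  proof (rule L2_closed_span_minimal[OF L2_closed_subspace_closed_span[OF b]])
    fix i assume "i \<in> I"
    then show "b (h i) \<in> L2_closed_span M (h ` I) b"
      using L2_closed_span_base[of b "h i" M "h ` I"] assms by simp
  qed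
qed

context vilenkin
begin

text \<open>The span contains the indicator of \<open>E\<close> cut with any set pulled back along
  \<open>vfrac\<close>. Since \<open>E\<close> meets each congruence class at most once up to a null
  set, every measurable part of \<open>E\<close> inside a cell is of this form almost
  everywhere.\<close>

lemma vil_tile_complete:
  assumes tile: "vil_tile E"
  shows "L2_supp M E \<subseteq> L2_closed_span M (vil_Lambda p) (vech (indicator E))"
    (is "_ \<subseteq> ?V")
proof -
  have E: "E \<in> sets M" "emeasure M E = 1" using vil_tile_emeasure[OF tile] .
  have EM: "E \<subseteq> vil p" using sets.sets_into_space[OF E(1)] by simp
  have iE: "(indicator E :: _ \<Rightarrow> complex) \<in> L2_space M" using E by (intro L2_indicator) auto
  have b: "vech (indicator E) n \<in> L2_space M" if "n \<in> vil_Lambda p" for n by (rule vech_space[OF iE that])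
  have V: "L2_closed_subspace M ?V" by (rule L2_closed_subspace_closed_span[OF b])
  have vb: "vech (indicator E) n \<in> ?V" if "n \<in> vil_Lambda p" for n by (rule L2_closed_span_base[where b="vech (indicator E)" and i=n, OF b[OF that] that])
  \<comment> \<open>Here no limit is taken: by \<open>indicator_vfrac_vball\<close> this indicator
    is a finite combination of the exponentials.\<close>
  have ball: "(indicator (E \<inter> vfrac -` vball p c m) :: _ \<Rightarrow> complex) \<in> ?V" if c: "c \<in> vU" for c m
  proof -
    have cm: "(indicator (E \<inter> vfrac -` vball p c m) :: _ \<Rightarrow> complex) \<in> borel_measurable M"
      using sets_vfrac_vimage[OF E(1) vball_sets[OF vball_vil[OF c]]] by (rule borel_measurable_indicator)
    have "(\<lambda>w. \<Sum>n\<in>vLam m. (vch p 1 n c / of_nat (card (vLam m))) * vech (indicator E) n w) \<in> ?V"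
      by (rule L2_closed_subspace_sum[OF V vb[OF vLam_Lambda]])
    then show ?thesis
    proof (rule L2_closed_subspace_cong_AE[OF V _ cm], intro AE_I2)
      fix w assume "w \<in> space M"
      then have "(indicator (vball p c m) (vfrac w) :: complex) =
          (\<Sum>n\<in>vLam m. (vch p 1 n c / of_nat (card (vLam m))) * vch p (-1) n w)"
        by (intro indicator_vfrac_vball[OF c]) simp
      then have "(\<Sum>n\<in>vLam m. (vch p 1 n c / of_nat (card (vLam m))) * vech (indicator E) n w) =
          indicator E w * indicator (vball p c m) (vfrac w)"
        by (simp add: vech_def sum_distrib_left mult_ac)
      then show "(\<Sum>n\<in>vLam m. (vch p 1 n c / of_nat (card (vLam m))) * vech (indicator E) n w) =
          indicator (E \<inter> vfrac -` vball p c m) w"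
        by (simp add: indicator_def)
    qed
  qed
  have memE: "(indicator E :: _ \<Rightarrow> complex) \<in> ?V"
  proof -
    have "E \<inter> vfrac -` vU = E" using vfrac_U EM by auto
    then show ?thesis using ball[of vil_zero 0] by simp
  qed
  have pull: "(indicator (E \<inter> vfrac -` A) :: _ \<Rightarrow> complex) \<in> ?V" if A: "A \<in> sets M" for A
  proof (rule L2_indicator_Dynkin[OF V E(1) _ measurable_vfrac _ Int_stable_vballs _ memE _ A])
    show "emeasure M E < \<infinity>" using E by simp
    show "vballs p \<subseteq> Pow (space M)" using vballs_Pow by simp
    show "sets M = sigma_sets (space M) (vballs p)" by (simp add: sets_M)
    fix B assume "B \<in> vballs p"
    then consider "vU \<inter> B = {}" | c a m where "c \<in> vU" "c \<in> B" "B = vball p a m" by (auto simp: vballs_def)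
    then show "(indicator (E \<inter> vfrac -` B) :: _ \<Rightarrow> complex) \<in> ?V"
    proof cases
      case 1
      then have "E \<inter> vfrac -` B = {}" using EM vfrac_U by auto
      then have "(indicator (E \<inter> vfrac -` B) :: _ \<Rightarrow> complex) = (\<lambda>x. 0)" by (simp add: fun_eq_iff)
      then show ?thesis using L2_closed_subspaceD(2)[OF V] by (simp only:)
    next
      case (2 c a m)
      then show ?thesis using ball[of c m] vball_eq[of c a m] by simp
    qed
  qed
  have cell: "(indicator C :: _ \<Rightarrow> complex) \<in> ?V"
    if C: "C \<in> sets M" "C \<subseteq> E" "C \<subseteq> vball p k 0" and k: "k \<in> vil_Lambda p" for C k
  proof -
    let ?D = "{x \<in> vU. vil_add p k x \<in> C}"
    have D: "?D \<in> sets M" by (rule vil_tile_cell(1)[OF C(1,3) k])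
    define Z where "Z = (\<Union>n\<in>vil_Lambda p - {vil_zero}. E \<inter> (\<lambda>w. vil_add p w n) ` E)"
    have Z: "Z \<in> null_sets M" unfolding Z_def by (rule vil_tile_null[OF tile])
    \<comment> \<open>A point of \<open>E\<close> over \<open>?D\<close> is congruent to a point
      \<open>v\<close> of \<open>C\<close>; outside the overlap set \<open>Z\<close> the two
      coincide.\<close>
    have eq: "w \<in> E \<inter> vfrac -` ?D \<longleftrightarrow> w \<in> C" if w: "w \<notin> Z" "w \<in> vil p" for w
    proof
      assume wC: "w \<in> C"
      then have "vil_add p k (vfrac w) = w" using vfrac_vball[OF _ k] C by blast
      then show "w \<in> E \<inter> vfrac -` ?D" using wC C(2) vfrac_U[OF w(2)] by auto
    next
      assume h: "w \<in> E \<inter> vfrac -` ?D"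
      define v where "v = vil_add p k (vfrac w)"
      have v: "v \<in> C" using h by (simp add: v_def)
      have kv: "k \<in> vil p" using k by (rule Lambda_vil)
      have vv: "v \<in> vil p" unfolding v_def using kv w by simp
      define n where "n = vil_sub p w v"
      have n: "n \<in> vil_Lambda p"
        unfolding n_def v_def using vil_sub_in[OF w(2) vil_add_in[OF kv vfrac_in[OF w(2)]]] k
        by (simp add: vil_Lambda_def) (simp add: vil_sub_def vil_add_def vfrac_def vil_bounds w)
      have "w = vil_add p v n" unfolding n_def using w by simp
      then have "w \<in> E \<inter> (\<lambda>w. vil_add p w n) ` E" using h v C(2) by blast
      then have "n = vil_zero" using w(1) n unfolding Z_def by blast
      then have "w = v" using vil_sub_eq_zero_iff[OF w(2) vv] by (simp add: n_def)
      then show "w \<in> C" using v by simp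
    qed
    show ?thesis
    proof (rule L2_closed_subspace_cong_AE[OF V pull[OF D] borel_measurable_indicator[OF C(1)]])
      show "AE w in M. (indicator (E \<inter> vfrac -` ?D) w :: complex) = indicator C w"
        using AE_not_in[OF Z] AE_space
      proof eventually_elim
        case (elim w)
        then show ?case using eq[of w] by (simp add: indicator_def)
      qed
    qed
  qed
  show ?thesis
  proof (rule L2_supp_subset_if_indicators[OF V E(1)])
    fix C assume C: "C \<in> sets M" "C \<subseteq> E" "emeasure M C < \<infinity>"
    define k where "k = from_nat_into (vil_Lambda p)"
    have ne: "vil_Lambda p \<noteq> {}" using zero_Lambda by blast
    have rk: "range k = vil_Lambda p" unfolding k_def by (rule range_from_nat_into[OF ne countable_vil_Lambda])
    \<comment> \<open>The union runs over the image of the enumeration, so that repeated values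
      cannot spoil disjointness.\<close>
    let ?D = "\<lambda>n. \<Union>l\<in>k ` {..<n}. C \<inter> vball p l 0"
    have U: "(\<Union>n. ?D n) = C"
    proof
      show "C \<subseteq> (\<Union>n. ?D n)"
      proof
        fix w assume w: "w \<in> C"
        then have "w \<in> vil p" using C EM by blast
        then obtain l where l: "l \<in> vil_Lambda p" "w \<in> vball p l 0" using UN_vball_Lambda by blast
        then obtain i where "l = k i" using rk by blast
        then have "w \<in> ?D (Suc i)" using w l by auto
        then show "w \<in> (\<Union>n. ?D n)" by blast
      qed
    qed blast
    have "(indicator (\<Union>n. ?D n) :: _ \<Rightarrow> complex) \<in> ?V"
    proof (rule L2_closed_subspace_indicator_UN[OF V])
      have kL: "l \<in> vil_Lambda p" if "l \<in> k ` {..<n}" for l n using rk that by blast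
      have Cl: "C \<inter> vball p l 0 \<in> sets M" if "l \<in> vil_Lambda p" for l
        using C(1) vball_sets[OF Lambda_vil[OF that]] by blast
      show "?D n \<in> sets M" for n using Cl kL by (intro sets.finite_UN) auto
      show "incseq ?D" by (rule incseq_SucI) (auto simp: less_Suc_eq)
      show "emeasure M (\<Union>n. ?D n) < \<infinity>" unfolding U by (rule C(3))
      fix n
      have "(indicator (?D n) :: _ \<Rightarrow> complex) = (\<lambda>x. \<Sum>l\<in>k ` {..<n}. 1 * indicator (C \<inter> vball p l 0) x)"
      proof
        fix x
        have "disjoint_family_on (\<lambda>l. C \<inter> vball p l 0) (k ` {..<n})"
          unfolding disjoint_family_on_def
        proof (intro ballI impI)
          fix a c assume "a \<in> k ` {..<n}" "c \<in> k ` {..<n}" "a \<noteq> c"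
          then have "vball p a 0 \<inter> vball p c 0 = {}" using vball_Lambda_disjoint[OF kL kL, of a n c n] by blast
          then show "(C \<inter> vball p a 0) \<inter> (C \<inter> vball p c 0) = {}" by blast
        qed
        then have "(indicator (?D n) x :: complex) = (\<Sum>l\<in>k ` {..<n}. indicator (C \<inter> vball p l 0) x)"
          by (intro indicator_UN_disjoint) auto
        then show "(indicator (?D n) x :: complex) = (\<Sum>l\<in>k ` {..<n}. 1 * indicator (C \<inter> vball p l 0) x)" by simp
      qed
      moreover have "(\<lambda>x. \<Sum>l\<in>k ` {..<n}. 1 * indicator (C \<inter> vball p l 0) x) \<in> ?V"
      proof (rule L2_closed_subspace_sum[OF V])
        fix l assume "l \<in> k ` {..<n}"
        then have l: "l \<in> vil_Lambda p" by (rule kL)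
        show "(indicator (C \<inter> vball p l 0) :: _ \<Rightarrow> complex) \<in> ?V"
          by (rule cell[OF Cl[OF l] _ _ l]) (use C(2) in auto)
      qed
      ultimately show "(indicator (?D n) :: _ \<Rightarrow> complex) \<in> ?V" by simp
    qed
    then show "(indicator C :: _ \<Rightarrow> complex) \<in> ?V" unfolding U .
  qed
qed

lemma vil_tile_orthonormal:
  assumes "vil_tile E"
  shows "L2_orthonormal M (vil_Lambda p) (vech (indicator E))"
proof (rule vil_fold_orthonormal[OF vil_tile_imp_fold[OF assms]])
  show "(indicator E :: _ \<Rightarrow> complex) \<in> L2_space M"
    using vil_tile_emeasure[OF assms] by (intro L2_indicator) auto
qed (simp add: indicator_def)

text \<open>Compare the coefficients of \<open>1\<^sub>C\<close> with respect to the given basis with those of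
  \<open>1\<^sub>C \<cdot> cnj \<phi>\<close> with respect to the characters on a coset of \<open>vil_U p\<close>.\<close>

lemma vech_basis_modulus:
  assumes E: "E \<in> sets M" and phi: "\<phi> \<in> L2_supp M E"
    and on: "L2_orthonormal M (vil_Lambda p) (vech \<phi>)"
    and complete: "L2_supp M E \<subseteq> L2_closed_span M (vil_Lambda p) (vech \<phi>)"
  shows "AE w in M. cmod (\<phi> w) = indicator E w"
proof -
  have pL: "\<phi> \<in> L2_space M" using phi by (simp add: L2_supp_def)
  have pm: "\<phi> \<in> borel_measurable M" using pL by (rule L2_spaceD)
  have nrm: "(LINT w|M. indicator C w) = (LINT w|M. indicator C w * (cmod (\<phi> w))\<^sup>2)"
    if C: "C \<in> sets M" "C \<subseteq> E" "C \<subseteq> vball p k 0" and k: "k \<in> vil_Lambda p" for C k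
  proof -
    have kv: "k \<in> vil p" using k by (rule Lambda_vil)
    have "emeasure M C \<le> emeasure M (vball p k 0)" using C kv by (intro emeasure_mono) auto
    then have fin: "emeasure M C < \<infinity>" using emeasure_vball[OF kv, of 0] by (simp add: le_less_trans)
    let ?f = "indicator C :: vseq \<Rightarrow> complex"
    let ?g = "\<lambda>w. cnj (\<phi> w) * indicator C w"
    have f: "?f \<in> L2_space M" by (rule L2_indicator[OF C(1) fin])
    have cp: "(\<lambda>w. cnj (\<phi> w)) \<in> L2_space M" using pL borel_measurable_cnj'[OF pm] by (simp add: L2_space_def)
    have g: "?g \<in> L2_space M" by (rule L2_restrict[OF cp C(1)])
    have t: "vil_tile (vball p k 0)" by (rule vil_tile_vball[OF k])
    \<comment> \<open>As \<open>C\<close> lies in the cell of \<open>k\<close>, the factor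
      \<open>cnj (\<phi> w)\<close> can be shifted to the first function, leaving the indicator of
      the cell in the second.\<close>
    have eq: "L2_inner M ?f (vech \<phi> n) = L2_inner M ?g (vech (indicator (vball p k 0)) n)" for n
      unfolding L2_inner_def
    proof (rule Bochner_Integration.integral_cong[OF refl])
      fix w
      show "?f w * cnj (vech \<phi> n w) = ?g w * cnj (vech (indicator (vball p k 0)) n w)"
        using C(3) by (auto simp: vech_def indicator_def)
    qed
    have fE: "?f \<in> L2_closed_span M (vil_Lambda p) (vech \<phi>)"
    proof (rule subsetD[OF complete])
      show "?f \<in> L2_supp M E" unfolding L2_supp_def using f C(2) by (auto simp: indicator_def intro!: AE_I2)
    qed
    have gB: "?g \<in> L2_closed_span M (vil_Lambda p) (vech (indicator (vball p k 0)))"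
    proof (rule subsetD[OF vil_tile_complete[OF t]])
      show "?g \<in> L2_supp M (vball p k 0)"
        unfolding L2_supp_def using g C(3) by (auto simp: indicator_def intro!: AE_I2)
    qed
    have "L2_norm M ?f = L2_norm M ?g"
    proof (rule antisym)
      show "L2_norm M ?f \<le> L2_norm M ?g"
        by (rule L2_norm_le_if_coeffs_eq[OF on vil_tile_orthonormal[OF t] fE g]) (simp only: eq)
      show "L2_norm M ?g \<le> L2_norm M ?f"
        by (rule L2_norm_le_if_coeffs_eq[OF vil_tile_orthonormal[OF t] on gB f]) (simp only: eq)
    qed
    then have "(L2_norm M ?f)\<^sup>2 = (L2_norm M ?g)\<^sup>2" by simp
    then have "(LINT w|M. (cmod (?f w))\<^sup>2) = (LINT w|M. (cmod (?g w))\<^sup>2)" unfolding L2_norm_sq .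
    moreover have "(LINT w|M. (cmod (?f w))\<^sup>2) = (LINT w|M. indicator C w)" by (simp only: cmod_indicator_sq)
    moreover have "(LINT w|M. (cmod (?g w))\<^sup>2) = (LINT w|M. indicator C w * (cmod (\<phi> w))\<^sup>2)"
      by (rule Bochner_Integration.integral_cong) (auto simp: indicator_def)
    ultimately show ?thesis by simp
  qed
  have cell: "AE w in M. w \<in> E \<inter> vball p k 0 \<longrightarrow> cmod (\<phi> w) = 1" if k: "k \<in> vil_Lambda p" for k
  proof -
    have kv: "k \<in> vil p" using k by (rule Lambda_vil)
    \<comment> \<open>By \<open>nrm\<close>, \<open>(cmod (\<phi> w))\<^sup>2 - 1\<close> integrates
      to 0 over every such \<open>C\<close>; if it has constant strict sign on \<open>C\<close>,
      then \<open>C\<close> is null.\<close>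
    have sgn: "AE w in M. w \<notin> C"
      if C: "C \<in> sets M" "C \<subseteq> E" "C \<subseteq> vball p k 0"
        and s: "s = 1 \<or> s = -1" "\<And>w. w \<in> C \<Longrightarrow> s * ((cmod (\<phi> w))\<^sup>2 - 1) > 0" for C and s :: real
    proof -
      have "emeasure M C \<le> emeasure M (vball p k 0)" using C kv by (intro emeasure_mono) auto
      then have fin: "emeasure M C < \<infinity>" using emeasure_vball[OF kv, of 0] by (simp add: le_less_trans)
      have i1: "integrable M (\<lambda>w. indicator C w :: real)" using C(1) fin by (rule integrable_real_indicator)
      have i2: "integrable M (\<lambda>w. indicator C w * (cmod (\<phi> w))\<^sup>2)"
      proof -
        have "integrable M (\<lambda>w. (cmod (\<phi> w * indicator C w))\<^sup>2)" by (rule L2_spaceD(2)[OF L2_restrict[OF pL C(1)]])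
        moreover have "(\<lambda>w. (cmod (\<phi> w * indicator C w))\<^sup>2) = (\<lambda>w. indicator C w * (cmod (\<phi> w))\<^sup>2)"
          by (auto simp: fun_eq_iff indicator_def)
        ultimately show ?thesis by simp
      qed
      let ?h = "\<lambda>w. s * (indicator C w * (cmod (\<phi> w))\<^sup>2 - indicator C w)"
      have ih: "integrable M ?h" by (intro integrable_mult_right Bochner_Integration.integrable_diff i1 i2)
      have "(LINT w|M. ?h w) = s * ((LINT w|M. indicator C w * (cmod (\<phi> w))\<^sup>2) - (LINT w|M. indicator C w))"
        using i1 i2 by simp
      then have "(LINT w|M. ?h w) = 0" using nrm[OF C k] by simp
      moreover have nn: "0 \<le> ?h w" for w
        using s(2)[of w] by (cases "w \<in> C") (auto intro: less_imp_le)
      ultimately have "AE w in M. ?h w = 0" using integral_nonneg_eq_0_iff_AE[OF ih] by simp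
      then show ?thesis
      proof eventually_elim
        case (elim w)
        show ?case
        proof
          assume "w \<in> C"
          then show False using s(2)[of w] elim by (auto simp: indicator_def)
        qed
      qed
    qed
    have B: "E \<inter> vball p k 0 \<in> sets M" using E kv by blast
    let ?P = "{w \<in> E \<inter> vball p k 0. cmod (\<phi> w) > 1}" and ?Q = "{w \<in> E \<inter> vball p k 0. cmod (\<phi> w) < 1}"
    have spc: "E \<inter> vball p k 0 \<subseteq> space M" using sets.sets_into_space[OF B] .
    have P: "?P \<in> sets M"
    proof -
      have "(E \<inter> vball p k 0) \<inter> {w \<in> space M. cmod (\<phi> w) > 1} \<in> sets M"
        by (rule sets.Int[OF B]) (use pm in measurable)
      moreover have "(E \<inter> vball p k 0) \<inter> {w \<in> space M. cmod (\<phi> w) > 1} = ?P" using spc by blast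
      ultimately show ?thesis by simp
    qed
    have Q: "?Q \<in> sets M"
    proof -
      have "(E \<inter> vball p k 0) \<inter> {w \<in> space M. cmod (\<phi> w) < 1} \<in> sets M"
        by (rule sets.Int[OF B]) (use pm in measurable)
      moreover have "(E \<inter> vball p k 0) \<inter> {w \<in> space M. cmod (\<phi> w) < 1} = ?Q" using spc by blast
      ultimately show ?thesis by simp
    qed
    have "AE w in M. w \<notin> ?P"
    proof (rule sgn[OF P, of 1])
      fix w assume "w \<in> ?P"
      then show "1 * ((cmod (\<phi> w))\<^sup>2 - 1) > 0" using one_less_power[of "cmod (\<phi> w)" 2] by simp
    qed auto
    moreover have "AE w in M. w \<notin> ?Q"
    proof (rule sgn[OF Q, of "-1"])
      fix w assume "w \<in> ?Q"
      then show "-1 * ((cmod (\<phi> w))\<^sup>2 - 1) > 0" using power_strict_mono[of "cmod (\<phi> w)" 1 2] by simp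
    qed auto
    ultimately show ?thesis by eventually_elim auto
  qed
  have "AE w in M. \<forall>k\<in>vil_Lambda p. w \<in> E \<inter> vball p k 0 \<longrightarrow> cmod (\<phi> w) = 1"
    unfolding AE_ball_countable[OF countable_vil_Lambda] by (intro ballI cell)
  moreover have "AE w in M. w \<notin> E \<longrightarrow> \<phi> w = 0" using phi by (simp add: L2_supp_def)
  ultimately show ?thesis using AE_space
  proof eventually_elim
    case (elim w)
    then obtain k where "k \<in> vil_Lambda p" "w \<in> vball p k 0" using UN_vball_Lambda by auto
    then show ?case using elim by (cases "w \<in> E") auto
  qed
qed

text \<open>Once the modulus is known, \<open>E\<close> has finite measure because its indicator is
  dominated by the modulus of \<open>\<phi>\<close>; the criterion for folding then applies.\<close>

lemma vil_tile_if_basis: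
  assumes E: "E \<in> sets M" and phi: "\<phi> \<in> L2_supp M E"
    and on: "L2_orthonormal M (vil_Lambda p) (vech \<phi>)"
    and complete: "L2_supp M E \<subseteq> L2_closed_span M (vil_Lambda p) (vech \<phi>)"
  shows "vil_tile E"
proof -
  have abs: "AE w in M. cmod (\<phi> w) = indicator E w" by (rule vech_basis_modulus[OF assms])
  have pL: "\<phi> \<in> L2_space M" using phi by (simp add: L2_supp_def)
  have "(indicator E :: _ \<Rightarrow> complex) \<in> L2_space M"
  proof (rule L2_space_bound[OF borel_measurable_indicator[OF E] L2_spaceD(2)[OF pL]])
    show "AE w in M. (cmod (indicator E w))\<^sup>2 \<le> (cmod (\<phi> w))\<^sup>2"
      using abs by eventually_elim (simp add: indicator_def)
  qed
  then have "emeasure M E < \<infinity>" by (rule L2_indicator_emeasure[OF E])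
  from vil_fold_imp_tile[OF vil_fold_if_orthonormal[OF E this pL abs on]] show ?thesis .
qed

subsection \<open>Dilated tiles\<close>

lemma vch_zero [simp]: "vch p s vil_zero w = 1"
  by (simp add: vch_def vpair_def vil_zero_def)

lemma fdil_0: "fdil 0 n h = vech h n"
  using p_pos by (simp add: fdil_def vech_def fun_eq_iff)

lemma fdil_0_vech: "fdil j vil_zero (vech h n) = fdil j n h"
  by (simp add: fdil_def vech_def fun_eq_iff)

lemma fdil_fdil_inverse: "fdil j vil_zero (fdil (- j) vil_zero g) = g"
  using p_pos by (simp add: fdil_def fun_eq_iff powr_add[symmetric] flip: of_real_mult mult.assoc)

lemma sets_rho_pow_image:
  assumes "E \<in> sets M"
  shows "rho_pow j ` E \<in> sets M"
proof -
  have "rho_pow (- j) \<in> measurable M M" by (rule measurable_vil_map[OF rho_pow_in rho_pow_pre])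
  from measurable_sets[OF this assms] show ?thesis
    using rho_pow_image[of E j] sets.sets_into_space[OF assms] by (simp add: vimage_def Int_def conj_commute)
qed

lemma rho_pow_image_mem_iff:
  assumes "E \<in> sets M"
  shows "w \<in> rho_pow j ` E \<longleftrightarrow> w \<in> vil p \<and> rho_pow (- j) w \<in> E"
  using rho_pow_image[of E j] sets.sets_into_space[OF assms] by simp

text \<open>The image of Haar measure under \<open>rho_pow j\<close> is a constant multiple of it,
  so null sets are respected.\<close>

lemma AE_rho_pow:
  assumes "AE w in M. P w"
  shows "AE w in M. P (rho_pow j w)"
proof -
  have d: "distr M M (rho_pow j) = density M (\<lambda>_. ennreal (real_of_int p powi (- j)))"
    by (rule distr_vil_map[OF rho_pow_in rho_pow_pre])
  have "AE w in distr M M (rho_pow j). P w"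
    unfolding d using assms by (subst AE_density) auto
  moreover have "rho_pow j \<in> measurable M M" by (rule measurable_vil_map[OF rho_pow_in rho_pow_pre])
  ultimately show ?thesis by (rule AE_distrD[rotated])
qed

lemma fdil_supp:
  assumes g: "g \<in> L2_supp M E" and E: "E \<in> sets M" and n: "n \<in> vil p"
  shows "fdil j n g \<in> L2_supp M (rho_pow j ` E)"
proof -
  have "AE w in M. w \<notin> E \<longrightarrow> g w = 0" using g by (simp add: L2_supp_def)
  from AE_rho_pow[OF this, of "- j"] AE_space
  have "AE w in M. w \<notin> rho_pow j ` E \<longrightarrow> fdil j n g w = 0"
    by eventually_elim (simp add: rho_pow_image_mem_iff[OF E] fdil_def)
  then show ?thesis using L2_fdil(1)[OF _ n] g by (simp add: L2_supp_def)
qed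

lemma rho_pow_image_image: "rho_pow j ` rho_pow k ` E = rho_pow (j + k) ` E"
  by (simp add: image_image)

text \<open>Dilating back is an isometry into the functions supported in \<open>E\<close>, where the
  exponentials are complete; dilating the approximation forward turns them into
  \<open>fdil j n\<close>.\<close>

lemma fdil_tile_complete:
  assumes tile: "vil_tile E"
  shows "L2_supp M (rho_pow j ` E) \<subseteq> L2_closed_span M (vil_Lambda p) (\<lambda>n. fdil j n (indicator E))"
proof
  fix g assume g: "g \<in> L2_supp M (rho_pow j ` E)"
  then have gL: "g \<in> L2_space M" by (simp add: L2_supp_def)
  have E: "E \<in> sets M" using vil_tile_emeasure[OF tile] by simp
  let ?g = "fdil (- j) vil_zero g"
  have gL': "?g \<in> L2_space M" by (rule L2_fdil(1)[OF gL vil_zero_in])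
  have "?g \<in> L2_supp M (rho_pow (- j) ` rho_pow j ` E)"
    by (rule fdil_supp[OF g sets_rho_pow_image[OF E] vil_zero_in])
  then have g': "?g \<in> L2_closed_span M (vil_Lambda p) (vech (indicator E))"
    using vil_tile_complete[OF tile] by (auto simp: rho_pow_image_image)
  have iE: "(indicator E :: _ \<Rightarrow> complex) \<in> L2_space M"
    using vil_tile_emeasure[OF tile] by (intro L2_indicator) auto
  show "g \<in> L2_closed_span M (vil_Lambda p) (\<lambda>n. fdil j n (indicator E))"
  proof (rule L2_closed_spanI[OF gL])
    fix e :: real assume "e > 0"
    from L2_closed_spanE[OF g' this] obtain F c where F: "finite F" "F \<subseteq> vil_Lambda p"
      "L2_norm M (\<lambda>x. ?g x - (\<Sum>i\<in>F. c i * vech (indicator E) i x)) < e" .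
    have s: "(\<lambda>x. \<Sum>i\<in>F. c i * vech (indicator E) i x) \<in> L2_space M"
      by (rule L2_sum, rule vech_space[OF iE], use F in blast)
    have "L2_norm M (\<lambda>x. ?g x - (\<Sum>i\<in>F. c i * vech (indicator E) i x)) =
        L2_norm M (fdil j vil_zero (\<lambda>x. ?g x - (\<Sum>i\<in>F. c i * vech (indicator E) i x)))"
      by (rule L2_fdil(2)[OF L2_diff[OF gL' s] vil_zero_in, symmetric])
    also have "fdil j vil_zero (\<lambda>x. ?g x - (\<Sum>i\<in>F. c i * vech (indicator E) i x)) =
        (\<lambda>x. fdil j vil_zero ?g x - (\<Sum>i\<in>F. c i * fdil j vil_zero (vech (indicator E) i) x))"
      by (simp add: fdil_def fun_eq_iff algebra_simps sum_distrib_left sum_distrib_right)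
    also have "\<dots> = (\<lambda>x. g x - (\<Sum>i\<in>F. c i * fdil j i (indicator E) x))"
      by (simp only: fdil_fdil_inverse fdil_0_vech)
    finally show "\<exists>F c. finite F \<and> F \<subseteq> vil_Lambda p \<and>
        L2_norm M (\<lambda>x. g x - (\<Sum>i\<in>F. c i * fdil j i (indicator E) x)) < e"
      using F by (intro exI[of _ F] exI[of _ c]) simp
  qed
qed

text \<open>The square of the normalizing factor is p^(-j) and cancels the factor p^j of the
  substitution.\<close>

lemma fdil_inner:
  assumes h: "h \<in> L2_space M" and n: "n \<in> vil_Lambda p" and k: "k \<in> vil_Lambda p"
  shows "L2_inner M (fdil j n h) (fdil j k h) = L2_inner M (vech h n) (vech h k)"
proof -
  let ?G = "\<lambda>w. vech h n w * cnj (vech h k w)"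
  have m: "?G \<in> borel_measurable M"
    using borel_measurable_integrable[OF integrable_L2_mult[OF vech_space[OF h n] vech_space[OF h k]]] .
  have pp: "real_of_int p > 0" using p_pos by simp
  have c: "real_of_int p powr (- real_of_int j / 2) * real_of_int p powr (- real_of_int j / 2) = real_of_int p powi (- j)"
    using powr_half_sq[of "- j"] by (simp add: power2_eq_square)
  have "L2_inner M (fdil j n h) (fdil j k h) =
      (LINT w|M. complex_of_real (real_of_int p powr (- real_of_int j / 2) * real_of_int p powr (- real_of_int j / 2)) * ?G (rho_pow (- j) w))"
    unfolding L2_inner_def
    by (rule Bochner_Integration.integral_cong[OF refl]) (simp add: fdil_def vech_def mult_ac)
  also have "\<dots> = complex_of_real (real_of_int p powi (- j)) * (LINT w|M. ?G (rho_pow (- j) w))"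
    unfolding c by (rule integral_mult_right_zero)
  also have "(LINT w|M. ?G (rho_pow (- j) w)) = (real_of_int p powi (- (- j))) *\<^sub>R (LINT w|M. ?G w)"
    by (rule integral_vil_map[OF rho_pow_in rho_pow_pre m])
  also have "complex_of_real (real_of_int p powi (- j)) * \<dots> = (LINT w|M. ?G w)"
    using pp by (simp add: scaleR_conv_of_real power_int_minus)
  finally show ?thesis by (simp add: L2_inner_def)
qed

lemma fdil_tile_orthonormal:
  assumes tile: "vil_tile E"
  shows "L2_orthonormal M (vil_Lambda p) (\<lambda>n. fdil j n (indicator E))"
proof -
  have iE: "(indicator E :: _ \<Rightarrow> complex) \<in> L2_space M"
    using vil_tile_emeasure[OF tile] by (intro L2_indicator) auto
  show ?thesis using vil_tile_orthonormal[OF tile] L2_fdil(1)[OF iE Lambda_vil]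
    by (simp add: L2_orthonormal_def fdil_inner[OF iE])
qed

end

subsection \<open>Wavelet sets\<close>

text \<open>The hypotheses of the theorem, expressed on the Fourier side.\<close>

locale vilenkin_wavelet = vilenkin +
  fixes \<Omega> :: "int \<Rightarrow> vseq set" and \<psi> :: "int \<Rightarrow> vseq \<Rightarrow> complex"
  assumes Omega_sets: "\<And>u. u \<in> {1..p-1} \<Longrightarrow> \<Omega> u \<in> sets M"
    and Omega_L2: "\<And>u. u \<in> {1..p-1} \<Longrightarrow> (indicator (\<Omega> u) :: _ \<Rightarrow> complex) \<in> L2_space M"
    and psi_fext: "\<And>u. u \<in> {1..p-1} \<Longrightarrow> fext (-1) (\<psi> u) (indicator (\<Omega> u))"
    and wavelet_onb: "L2_onb M (UNIV \<times> vil_Lambda p \<times> {1..p-1})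
      (\<lambda>(j, n, u). fdil j n (indicator (\<Omega> u))) (L2_space M)"
begin

abbreviation wav :: "int \<Rightarrow> vseq \<Rightarrow> int \<Rightarrow> vseq \<Rightarrow> complex" where
  "wav j n u \<equiv> fdil j n (indicator (\<Omega> u))"

definition wset :: "int \<Rightarrow> int \<Rightarrow> vseq set" where
  "wset j u = rho_pow j ` \<Omega> u"

text \<open>All dilates at scales below \<open>j\<close>: the expected frequency support of the
  space \<open>V j\<close>, with \<open>wunion 0\<close> being the set of the theorem.\<close>

definition wunion :: "int \<Rightarrow> vseq set" where
  "wunion j = (\<Union>u\<in>{1..p-1}. \<Union>i\<in>{..<j}. wset i u)"

lemma wav_orthonormal: "L2_orthonormal M (UNIV \<times> vil_Lambda p \<times> {1..p-1}) (\<lambda>(j, n, u). wav j n u)"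
  and wav_complete: "L2_closed_span M (UNIV \<times> vil_Lambda p \<times> {1..p-1}) (\<lambda>(j, n, u). wav j n u) = L2_space M"
  using wavelet_onb by (simp_all add: L2_onb_iff)

lemma wav_L2: "n \<in> vil_Lambda p \<Longrightarrow> u \<in> {1..p-1} \<Longrightarrow> wav j n u \<in> L2_space M"
  by (rule L2_fdil(1)[OF Omega_L2 Lambda_vil])

lemma wav_inner:
  assumes "n \<in> vil_Lambda p" "u \<in> {1..p-1}" "n' \<in> vil_Lambda p" "u' \<in> {1..p-1}"
  shows "L2_inner M (wav j n u) (wav j' n' u') = (if (j, n, u) = (j', n', u') then 1 else 0)"
  using L2_orthonormal_inner[OF wav_orthonormal, of "(j, n, u)" "(j', n', u')"] assms by simp

lemma wset_sets: "u \<in> {1..p-1} \<Longrightarrow> wset j u \<in> sets M"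
  unfolding wset_def by (rule sets_rho_pow_image[OF Omega_sets])

lemma wunion_sets: "wunion j \<in> sets M"
  unfolding wunion_def by (intro sets.countable_UN'' sets.finite_UN) (auto intro: wset_sets)

lemma wset_wunion: "u \<in> {1..p-1} \<Longrightarrow> i < j \<Longrightarrow> wset i u \<subseteq> wunion j"
  unfolding wunion_def by blast

lemma wunion_mono: "i \<le> j \<Longrightarrow> wunion i \<subseteq> wunion j"
  unfolding wunion_def by fastforce

lemma rho_pow_wset: "rho_pow k ` wset j u = wset (k + j) u"
  by (simp add: wset_def rho_pow_image_image)

lemma rho_pow_wunion: "rho_pow k ` wunion j = wunion (k + j)"
proof -
  have "rho_pow k ` wunion j = (\<Union>u\<in>{1..p-1}. \<Union>i\<in>{..<j}. wset (k + i) u)"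
    unfolding wunion_def by (simp add: image_UN rho_pow_wset)
  also have "\<dots> = (\<Union>u\<in>{1..p-1}. \<Union>i\<in>(+) k ` {..<j}. wset i u)" by simp
  also have "(+) k ` {..<j} = {..<k + j}"
  proof
    show "{..<k + j} \<subseteq> (+) k ` {..<j}"
    proof
      fix i assume "i \<in> {..<k + j}"
      then show "i \<in> (+) k ` {..<j}" by (intro image_eqI[of _ _ "i - k"]) auto
    qed
  qed auto
  finally show ?thesis by (simp add: wunion_def)
qed

text \<open>\<open>sigma_shift\<close> is inverse to \<open>rho\<close>, so its powers with
  \<open>j \<ge> 1\<close> are the exponents below 0.\<close>

lemma Omega_Sigma_eq: "Omega_Sigma p \<Omega> = wunion 0"
proof -
  have "(\<Union>j\<in>{1..}. (sigma_shift ^^ j) ` \<Omega> u) = (\<Union>i\<in>{..<0}. wset i u)" for u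
  proof
    show "(\<Union>j\<in>{1..}. (sigma_shift ^^ j) ` \<Omega> u) \<subseteq> (\<Union>i\<in>{..<0}. wset i u)"
    proof
      fix x assume "x \<in> (\<Union>j\<in>{1..}. (sigma_shift ^^ j) ` \<Omega> u)"
      then obtain j where j: "j \<ge> 1" "x \<in> (sigma_shift ^^ j) ` \<Omega> u" by auto
      then have "x \<in> wset (- int j) u" by (simp add: wset_def rho_pow_uminus_of_nat)
      then show "x \<in> (\<Union>i\<in>{..<0}. wset i u)" using j(1) by (intro UN_I[of "- int j"]) auto
    qed
    show "(\<Union>i\<in>{..<0}. wset i u) \<subseteq> (\<Union>j\<in>{1..}. (sigma_shift ^^ j) ` \<Omega> u)"
    proof
      fix x assume "x \<in> (\<Union>i\<in>{..<0}. wset i u)"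
      then obtain i where i: "i < 0" "x \<in> wset i u" by auto
      then have "rho_pow i = sigma_shift ^^ nat (- i)" using rho_pow_uminus_of_nat[of "nat (- i)"] by simp
      then have "x \<in> (sigma_shift ^^ nat (- i)) ` \<Omega> u" using i by (simp add: wset_def)
      then show "x \<in> (\<Union>j\<in>{1..}. (sigma_shift ^^ j) ` \<Omega> u)" using i(1) by (intro UN_I[of "nat (- i)"]) auto
    qed
  qed
  then show ?thesis by (simp add: Omega_Sigma_def wunion_def)
qed

lemma Omega_supp: "u \<in> {1..p-1} \<Longrightarrow> (indicator (\<Omega> u) :: _ \<Rightarrow> complex) \<in> L2_supp M (\<Omega> u)"
  using Omega_L2 by (simp add: L2_supp_def)

lemma wav_supp:
  assumes "n \<in> vil_Lambda p" "u \<in> {1..p-1}"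
  shows "wav j n u \<in> L2_supp M (wset j u)"
  unfolding wset_def by (rule fdil_supp[OF Omega_supp[OF assms(2)] Omega_sets[OF assms(2)] Lambda_vil[OF assms(1)]])

lemma Omega_tile:
  assumes u: "u \<in> {1..p-1}"
  shows "vil_tile (\<Omega> u)"
proof (rule vil_fold_imp_tile[OF vil_fold_if_orthonormal[OF Omega_sets[OF u] _ Omega_L2[OF u]]])
  show "emeasure M (\<Omega> u) < \<infinity>" by (rule L2_indicator_emeasure[OF Omega_sets[OF u] Omega_L2[OF u]])
  show "L2_orthonormal M (vil_Lambda p) (vech (indicator (\<Omega> u)))"
    \<comment> \<open>Scale 0 with \<open>u\<close> fixed is a subfamily of the wavelet basis, and
      there the wavelets are the exponentials of the set.\<close>
    using wav_inner[OF _ u _ u, of _ _ 0 0] vech_space[OF Omega_L2[OF u]]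
    by (simp add: L2_orthonormal_def fdil_0)
qed (simp add: indicator_def)

lemma wset_complete:
  assumes "u \<in> {1..p-1}"
  shows "L2_supp M (wset j u) \<subseteq> L2_closed_span M (vil_Lambda p) (\<lambda>n. wav j n u)"
  unfolding wset_def by (rule fdil_tile_complete[OF Omega_tile[OF assms]])

text \<open>Dilated tiles have complete exponentials, so the indicator of the overlap lies in the
  spans of both families. These are orthogonal for different indices, or different scales, and the
  indicator is therefore orthogonal to itself.\<close>

lemma wset_disjoint:
  assumes u: "u \<in> {1..p-1}" "u' \<in> {1..p-1}" and ne: "(j, u) \<noteq> (j', u')"
  shows "AE w in M. w \<notin> wset j u \<or> w \<notin> wset j' u'"
proof -
  let ?C = "wset j u \<inter> wset j' u'"
  let ?f = "indicator ?C :: vseq \<Rightarrow> complex"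
  have C: "?C \<in> sets M" using wset_sets[OF u(1)] wset_sets[OF u(2)] by blast
  have "emeasure M (wset j u) < \<infinity>"
  proof -
    have eq: "wset j u = {w \<in> vil p. rho_pow (- j) w \<in> \<Omega> u}"
      using rho_pow_image_mem_iff[OF Omega_sets[OF u(1)]] by (auto simp: wset_def)
    have "emeasure M (wset j u) = ennreal (real_of_int p powi (- (- j))) * emeasure M (\<Omega> u)"
      unfolding eq by (rule emeasure_vil_map[OF rho_pow_in rho_pow_pre Omega_sets[OF u(1)]])
    then show ?thesis using vil_tile_emeasure(2)[OF Omega_tile[OF u(1)]] by simp
  qed
  moreover have "emeasure M ?C \<le> emeasure M (wset j u)"
    using wset_sets[OF u(1)] by (intro emeasure_mono) auto
  ultimately have fL: "?f \<in> L2_space M" by (intro L2_indicator[OF C]) (rule le_less_trans)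
  have f1: "?f \<in> L2_closed_span M (vil_Lambda p) (\<lambda>n. wav j n u)"
    by (rule subsetD[OF wset_complete[OF u(1)]]) (use fL in \<open>auto simp: L2_supp_def\<close>)
  have f2: "?f \<in> L2_closed_span M (vil_Lambda p) (\<lambda>n. wav j' n u')"
    by (rule subsetD[OF wset_complete[OF u(2)]]) (use fL in \<open>auto simp: L2_supp_def\<close>)
  have orth: "L2_inner M ?f (wav j' n' u') = 0" if n': "n' \<in> vil_Lambda p" for n'
  proof -
    have "L2_inner M (wav j' n' u') ?f = 0"
    proof (rule L2_orthogonal_closed_span[OF _ wav_L2[OF n' u(2)] _ f1])
      fix n assume n: "n \<in> vil_Lambda p"
      show "wav j n u \<in> L2_space M" by (rule wav_L2[OF n u(1)])
      show "L2_inner M (wav j' n' u') (wav j n u) = 0"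
        using wav_inner[OF n' u(2) n u(1)] ne by auto
    qed
    then show ?thesis using L2_inner_cnj[of M ?f "wav j' n' u'"] by simp
  qed
  have "AE w in M. ?f w = 0"
  proof (rule L2_orthogonal_self[OF _ f2])
    fix n' assume n': "n' \<in> vil_Lambda p"
    show "wav j' n' u' \<in> L2_space M" by (rule wav_L2[OF n' u(2)])
    show "L2_inner M ?f (wav j' n' u') = 0" by (rule orth[OF n'])
  qed
  then show ?thesis by eventually_elim (auto simp: indicator_def split: if_splits)
qed

lemma wset_wunion_disjoint:
  assumes u: "u \<in> {1..p-1}" and ij: "j \<le> i"
  shows "AE w in M. w \<notin> wset i u \<or> w \<notin> wunion j"
proof -
  have "AE w in M. \<forall>k\<in>{..<j} \<times> {1..p-1}. w \<notin> wset i u \<or> w \<notin> wset (fst k) (snd k)"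
    unfolding AE_ball_countable[OF countableI_type]
  proof
    fix k assume "k \<in> {..<j} \<times> {1..p-1}"
    then show "AE w in M. w \<notin> wset i u \<or> w \<notin> wset (fst k) (snd k)"
      using ij by (intro wset_disjoint u) auto
  qed
  then show ?thesis by eventually_elim (auto simp: wunion_def)
qed

text \<open>A function supported in the uncovered set is orthogonal to all wavelets, which are
  complete.\<close>

lemma wset_cover: "AE w in M. \<exists>j. \<exists>u\<in>{1..p-1}. w \<in> wset j u"
proof -
  let ?X = "space M - (\<Union>j. wunion j)"
  have X: "?X \<in> sets M"
    by (intro sets.Diff sets.top sets.countable_UN'') (auto intro: wunion_sets)
  \<comment> \<open>Cutting with balls makes the indicator square-integrable.\<close>
  have null: "AE w in M. w \<notin> ?X \<inter> vball p vil_zero (int k)" for k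
  proof -
    let ?f = "indicator (?X \<inter> vball p vil_zero (int k)) :: vseq \<Rightarrow> complex"
    have S: "?X \<inter> vball p vil_zero (int k) \<in> sets M" using X by blast
    have "emeasure M (?X \<inter> vball p vil_zero (int k)) \<le> emeasure M (vball p vil_zero (int k))"
      by (intro emeasure_mono) auto
    then have fL: "?f \<in> L2_space M"
      by (intro L2_indicator[OF S]) (auto simp: emeasure_vball intro: le_less_trans)
    have "AE w in M. ?f w = 0"
    proof (rule L2_orthogonal_self[where I="UNIV \<times> vil_Lambda p \<times> {1..p-1}" and b="\<lambda>(j, n, u). wav j n u"])
      fix i assume "i \<in> (UNIV :: int set) \<times> vil_Lambda p \<times> {1..p-1}"
      then obtain j n u where i: "i = (j, n, u)" "n \<in> vil_Lambda p" "u \<in> {1..p-1}" by auto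
      show "(case i of (j, n, u) \<Rightarrow> wav j n u) \<in> L2_space M" using i wav_L2 by simp
      have "L2_inner M ?f (wav j n u) = 0"
      proof (rule L2_inner_disjoint_supp[OF _ wav_supp[OF i(2,3)]])
        show "?f \<in> L2_supp M ?X" using fL by (auto simp: L2_supp_def)
        show "AE w in M. w \<notin> ?X \<or> w \<notin> wset j u"
          using wset_wunion[OF i(3), of j "j + 1"] by (intro AE_I2) auto
      qed
      then show "L2_inner M ?f (case i of (j, n, u) \<Rightarrow> wav j n u) = 0" by (simp add: i)
    next
      show "?f \<in> L2_closed_span M (UNIV \<times> vil_Lambda p \<times> {1..p-1}) (\<lambda>(j, n, u). wav j n u)"
        unfolding wav_complete by (rule fL)
    qed
    then show ?thesis by eventually_elim (auto simp: indicator_def split: if_splits)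
  qed
  have "AE w in M. \<forall>k. w \<notin> ?X \<inter> vball p vil_zero (int k)"
    unfolding AE_all_countable by (intro allI null)
  then show ?thesis using AE_space
  proof eventually_elim
    case (elim w)
    then obtain k where "w \<in> vball p vil_zero (int k)" using UN_vball_zero by auto
    then have "w \<notin> ?X" using elim by blast
    then obtain j where "w \<in> wunion j" using elim by blast
    then show ?case unfolding wunion_def by blast
  qed
qed

section \<open>Transport of the wavelet basis to the group side\<close>

lemma dil_psi_fext:
  assumes "n \<in> vil_Lambda p" "u \<in> {1..p-1}"
  shows "fext (-1) (vil_dil p j n (\<psi> u)) (wav j n u)"
  by (rule fext_vil_dil[OF psi_fext[OF assms(2)] Lambda_vil[OF assms(1)]])

lemma dil_psi_orthonormal:
  "L2_orthonormal M (UNIV \<times> vil_Lambda p \<times> {1..p-1}) (\<lambda>(j, n, u). vil_dil p j n (\<psi> u))"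
proof -
  let ?I = "UNIV \<times> vil_Lambda p \<times> {1..p-1}"
  have "L2_orthonormal M ?I (\<lambda>(j, n, u). vil_dil p j n (\<psi> u)) \<longleftrightarrow> L2_orthonormal M ?I (\<lambda>(j, n, u). wav j n u)"
    by (rule L2_orthonormal_fext[where s="-1"]) (auto intro: dil_psi_fext)
  then show ?thesis using wav_orthonormal by simp
qed

lemma dil_psi_complete:
  "L2_closed_span M (UNIV \<times> vil_Lambda p \<times> {1..p-1}) (\<lambda>(j, n, u). vil_dil p j n (\<psi> u)) = L2_space M"
proof
  show "L2_space M \<subseteq> L2_closed_span M (UNIV \<times> vil_Lambda p \<times> {1..p-1}) (\<lambda>(j, n, u). vil_dil p j n (\<psi> u))"
  proof
    fix f assume f: "f \<in> L2_space M"
    have g: "fext (-1) f (vil_fourier_L2 p M M f)" by (rule vil_fourier_L2_fext[OF f])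
    have "f \<in> L2_closed_span M (UNIV \<times> vil_Lambda p \<times> {1..p-1}) (\<lambda>(j, n, u). vil_dil p j n (\<psi> u)) \<longleftrightarrow>
        vil_fourier_L2 p M M f \<in> L2_closed_span M (UNIV \<times> vil_Lambda p \<times> {1..p-1}) (\<lambda>(j, n, u). wav j n u)"
      by (rule L2_closed_span_fext[OF _ g]) (auto intro: dil_psi_fext)
    then show "f \<in> L2_closed_span M (UNIV \<times> vil_Lambda p \<times> {1..p-1}) (\<lambda>(j, n, u). vil_dil p j n (\<psi> u))"
      using fext_space(2)[OF g] by (simp add: wav_complete)
  qed
qed (use L2_closed_span_space in blast)

lemma dil_psi_L2: "n \<in> vil_Lambda p \<Longrightarrow> u \<in> {1..p-1} \<Longrightarrow> vil_dil p j n (\<psi> u) \<in> L2_space M"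
  by (rule fext_space(1)[OF dil_psi_fext])

subsection \<open>From an MRA to the tiling condition\<close>

lemma tile_if_associated:
  assumes "associated_with_mra p M \<psi>"
  shows "vil_tile (wunion 0)"
proof -
  obtain V \<phi> where mra: "mra p M V" and onbV: "\<And>j. L2_onb M (vil_Lambda p) (\<lambda>n. vil_dil p j n \<phi>) (V j)"
    and onbW: "\<And>j. L2_onb M (vil_Lambda p \<times> {1..p-1}) (\<lambda>(n, u). vil_dil p j n (\<psi> u)) (mra_W M V j)"
    and phi: "\<phi> \<in> L2_space M"
    using assms unfolding associated_with_mra_def scaling_function_def by blast
  have Vcl: "L2_closed_subspace M (V j)" and Vstep: "V j \<subseteq> V (j + 1)" for j
    using mra by (auto simp: mra_def)
  have Vmono: "V i \<subseteq> V j" if "i \<le> j" for i j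
    using that
  proof (induction j rule: int_ge_induct)
    case (step j) then show ?case using Vstep[of j] by blast
  qed simp
  have psiW: "vil_dil p j n (\<psi> u) \<in> mra_W M V j" if n: "n \<in> vil_Lambda p" and u: "u \<in> {1..p-1}" for j n u
  proof -
    have "(case (n, u) of (n, u) \<Rightarrow> vil_dil p j n (\<psi> u)) \<in>
        L2_closed_span M (vil_Lambda p \<times> {1..p-1}) (\<lambda>(n, u). vil_dil p j n (\<psi> u))"
      by (rule L2_closed_span_base[where b="\<lambda>(n, u). vil_dil p j n (\<psi> u)" and i="(n, u)"])
         (use dil_psi_L2[OF n u] n u in auto)
    then show ?thesis using onbW[of j] by (simp add: L2_onb_iff)
  qed
  \<comment> \<open>Membership in \<open>V 0\<close> kills the coefficients at scales
    \<open>j \<ge> 0\<close>, since the wavelets there are orthogonal to \<open>V j\<close>, which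
    contains \<open>V 0\<close>. Conversely, wavelets at scales \<open>j < 0\<close> lie in
    \<open>V (j + 1)\<close>, hence in \<open>V 0\<close>.\<close>
  have V0: "f \<in> V 0 \<longleftrightarrow> g \<in> L2_supp M (wunion 0)" if fg: "fext (-1) f g" for f g
  proof -
    have fL: "f \<in> L2_space M" and gL: "g \<in> L2_space M" using fext_space[OF fg] .
    show ?thesis
    proof
      assume fV: "f \<in> V 0"
      let ?X = "space M - wunion 0"
      let ?h = "\<lambda>w. g w * indicator ?X w"
      have X: "?X \<in> sets M" using wunion_sets by blast
      have hL: "?h \<in> L2_space M" by (rule L2_restrict[OF gL X])
      \<comment> \<open>The part of \<open>g\<close> outside \<open>wunion 0\<close> is tested
        against the whole wavelet basis: scales below 0 are separated from it by support, the others
        by orthogonality to \<open>V j\<close>.\<close>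
      have "AE w in M. ?h w = 0"
      proof (rule L2_orthogonal_self[where I="UNIV \<times> vil_Lambda p \<times> {1..p-1}" and b="\<lambda>(j, n, u). wav j n u"])
        fix i assume "i \<in> (UNIV :: int set) \<times> vil_Lambda p \<times> {1..p-1}"
        then obtain j n u where i: "i = (j, n, u)" "n \<in> vil_Lambda p" "u \<in> {1..p-1}" by auto
        show "(case i of (j, n, u) \<Rightarrow> wav j n u) \<in> L2_space M" using i wav_L2 by simp
        have "L2_inner M ?h (wav j n u) = 0"
        proof (cases "j < 0")
          case True
          show ?thesis
          proof (rule L2_inner_disjoint_supp[OF L2_restrict_supp[OF gL X] wav_supp[OF i(2,3)]])
            show "AE w in M. w \<notin> ?X \<or> w \<notin> wset j u"
              using wset_wunion[OF i(3) True] by (intro AE_I2) auto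
          qed
        next
          case False
          have "L2_inner M ?h (wav j n u) = L2_inner M g (wav j n u)"
          proof (rule L2_inner_cong_AE)
            have "AE w in M. w \<notin> wset j u \<longrightarrow> wav j n u w = 0" using wav_supp[OF i(2,3)] by (simp add: L2_supp_def)
            moreover have "AE w in M. w \<notin> wset j u \<or> w \<notin> wunion 0"
              using False by (intro wset_wunion_disjoint[OF i(3)]) simp
            ultimately have "AE w in M. w \<notin> ?X \<longrightarrow> wav j n u w = 0"
              using AE_space by eventually_elim auto
            then show "AE w in M. ?h w * cnj (wav j n u w) = g w * cnj (wav j n u w)"
              by eventually_elim (auto simp: indicator_def)
          qed (use hL gL wav_L2[OF i(2,3)] in \<open>auto dest: L2_spaceD(1)\<close>)
          also have "\<dots> = L2_inner M f (vil_dil p j n (\<psi> u))"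
            by (rule fext_inner[OF fg dil_psi_fext[OF i(2,3)]]) simp
          also have "\<dots> = 0"
          proof -
            have "f \<in> V j" using fV Vmono[of 0 j] False by auto
            then have "L2_inner M (vil_dil p j n (\<psi> u)) f = 0"
              using psiW[OF i(2,3), of j] by (simp add: mra_W_def)
            then show ?thesis using L2_inner_cnj[of M f] by simp
          qed
          finally show ?thesis .
        qed
        then show "L2_inner M ?h (case i of (j, n, u) \<Rightarrow> wav j n u) = 0" by (simp add: i)
      next
        show "?h \<in> L2_closed_span M (UNIV \<times> vil_Lambda p \<times> {1..p-1}) (\<lambda>(j, n, u). wav j n u)"
          unfolding wav_complete by (rule hL)
      qed
      then have "AE w in M. w \<notin> wunion 0 \<longrightarrow> g w = 0"
        using AE_space by eventually_elim (auto simp: indicator_def split: if_splits)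
      then show "g \<in> L2_supp M (wunion 0)" using gL by (simp add: L2_supp_def)
    next
      assume gS: "g \<in> L2_supp M (wunion 0)"
      let ?I = "(UNIV :: int set) \<times> vil_Lambda p \<times> {1..p-1}" and ?J = "{..<0::int} \<times> vil_Lambda p \<times> {1..p-1}"
      \<comment> \<open>Coefficients at scales \<open>j \<ge> 0\<close> vanish by disjointness of
        supports, which leaves the span of the scales below 0.\<close>
      have "f \<in> L2_closed_span M ?J (\<lambda>(j, n, u). vil_dil p j n (\<psi> u))"
      proof (rule L2_closed_span_subfamily[OF dil_psi_orthonormal])
        show "f \<in> L2_closed_span M ?I (\<lambda>(j, n, u). vil_dil p j n (\<psi> u))"
          unfolding dil_psi_complete by (rule fL)
        fix i assume iI: "i \<in> ?I - ?J"
        then obtain j n u where i': "i = (j, n, u)" "n \<in> vil_Lambda p" "u \<in> {1..p-1}" by auto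
        have "0 \<le> j" using iI i' by auto
        with i' have i: "i = (j, n, u)" "n \<in> vil_Lambda p" "u \<in> {1..p-1}" "0 \<le> j" by auto
        have "L2_inner M f (vil_dil p j n (\<psi> u)) = L2_inner M g (wav j n u)"
          by (rule fext_inner[OF fg dil_psi_fext[OF i(2,3)], symmetric]) simp
        also have "\<dots> = 0"
        proof (rule L2_inner_disjoint_supp[OF gS wav_supp[OF i(2,3)]])
          show "AE w in M. w \<notin> wunion 0 \<or> w \<notin> wset j u"
            using wset_wunion_disjoint[OF i(3,4)] by eventually_elim blast
        qed
        finally show "L2_inner M f (case i of (j, n, u) \<Rightarrow> vil_dil p j n (\<psi> u)) = 0" by (simp add: i)
      qed blast
      also have "\<dots> \<subseteq> V 0"
      proof (rule L2_closed_span_minimal[OF Vcl])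
        fix i assume "i \<in> ?J"
        then obtain j n u where i: "i = (j, n, u)" "n \<in> vil_Lambda p" "u \<in> {1..p-1}" "j < 0" by auto
        have "vil_dil p j n (\<psi> u) \<in> V (j + 1)" using psiW[OF i(2,3), of j] by (simp add: mra_W_def)
        then show "(case i of (j, n, u) \<Rightarrow> vil_dil p j n (\<psi> u)) \<in> V 0" using Vmono[of "j + 1" 0] i by auto
      qed
      finally show "f \<in> V 0" .
    qed
  qed
  \<comment> \<open>At scale 0 the translates of \<open>\<phi>\<close> become the exponentials of
    \<open>h\<close>; by \<open>V0\<close> their span is everything supported in
    \<open>wunion 0\<close>.\<close>
  define h where "h = vil_fourier_L2 p M M \<phi>"
  have fh: "fext (-1) \<phi> h" unfolding h_def by (rule vil_fourier_L2_fext[OF phi])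
  have dil: "fext (-1) (vil_dil p 0 n \<phi>) (vech h n)" if "n \<in> vil_Lambda p" for n
    using fext_vil_dil[OF fh Lambda_vil[OF that], of 0] by (simp add: fdil_0)
  have "L2_orthonormal M (vil_Lambda p) (\<lambda>n. vil_dil p 0 n \<phi>) \<longleftrightarrow> L2_orthonormal M (vil_Lambda p) (vech h)"
    by (rule L2_orthonormal_fext[where s="-1"]) (auto intro: dil)
  then have on: "L2_orthonormal M (vil_Lambda p) (vech h)" using onbV[of 0] by (simp add: L2_onb_iff)
  have span: "L2_closed_span M (vil_Lambda p) (\<lambda>n. vil_dil p 0 n \<phi>) = V 0" using onbV[of 0] by (simp add: L2_onb_iff)
  have hS: "h \<in> L2_supp M (wunion 0)"
  proof -
    have m: "vil_dil p 0 vil_zero \<phi> \<in> V 0"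
      unfolding span[symmetric]
      by (rule L2_closed_span_base[where b="\<lambda>n. vil_dil p 0 n \<phi>"]) (use fext_space(1)[OF dil] in auto)
    have "vech h vil_zero = h" by (simp add: vech_def fun_eq_iff)
    then show ?thesis using V0[OF dil[OF zero_Lambda]] m by simp
  qed
  have complete: "L2_supp M (wunion 0) \<subseteq> L2_closed_span M (vil_Lambda p) (vech h)"
  proof
    fix g assume g: "g \<in> L2_supp M (wunion 0)"
    then have gL: "g \<in> L2_space M" by (simp add: L2_supp_def)
    have fg: "fext (-1) (vil_inv_fourier_L2 p M M g) g" by (rule vil_inv_fourier_L2_fext[OF gL])
    have "vil_inv_fourier_L2 p M M g \<in> L2_closed_span M (vil_Lambda p) (\<lambda>n. vil_dil p 0 n \<phi>)"
      unfolding span using V0[OF fg] g by simp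
    moreover have "vil_inv_fourier_L2 p M M g \<in> L2_closed_span M (vil_Lambda p) (\<lambda>n. vil_dil p 0 n \<phi>) \<longleftrightarrow>
        g \<in> L2_closed_span M (vil_Lambda p) (vech h)"
      by (rule L2_closed_span_fext[OF _ fg]) (auto intro: dil)
    ultimately show "g \<in> L2_closed_span M (vil_Lambda p) (vech h)" by simp
  qed
  show ?thesis by (rule vil_tile_if_basis[OF wunion_sets hS on complete])
qed

subsection \<open>From the tiling condition to an MRA\<close>

text \<open>A function has many transforms, differing on null sets. One of them is asked to have the
  right support, and \<open>wV_iff\<close> shows that any other gives the same answer.\<close>

definition wV :: "int \<Rightarrow> (vseq \<Rightarrow> complex) set" where
  "wV j = {f. \<exists>g\<in>L2_supp M (wunion j). fext (-1) f g}"

lemma wV_iff: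
  assumes fg: "fext (-1) f g"
  shows "f \<in> wV j \<longleftrightarrow> g \<in> L2_supp M (wunion j)"
proof
  assume "f \<in> wV j"
  then obtain g' where g': "g' \<in> L2_supp M (wunion j)" "fext (-1) f g'" by (auto simp: wV_def)
  have "AE w in M. g' w = g w" using fext_unique[OF g'(2) fg] by simp
  moreover have "AE w in M. w \<notin> wunion j \<longrightarrow> g' w = 0" using g' by (simp add: L2_supp_def)
  ultimately have "AE w in M. w \<notin> wunion j \<longrightarrow> g w = 0" by eventually_elim simp
  then show "g \<in> L2_supp M (wunion j)" using fext_space[OF fg] by (simp add: L2_supp_def)
qed (use fg in \<open>auto simp: wV_def\<close>)

lemma wV_L2: "f \<in> wV j \<Longrightarrow> f \<in> L2_space M"
  using fext_space(1) by (auto simp: wV_def)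

lemma wV_closed: "L2_closed_subspace M (wV j)"
proof -
  have S: "L2_closed_subspace M (L2_supp M (wunion j))" by (rule L2_closed_subspace_supp[OF wunion_sets])
  show ?thesis
    unfolding L2_closed_subspace_def
  proof (intro conjI ballI allI impI)
    show "wV j \<subseteq> L2_space M" using wV_L2 by blast
    have "fext (-1) (\<lambda>x. 0) (\<lambda>x. 0)" using fext_sum[of "{}" "-1"] by simp
    then show "(\<lambda>x. 0) \<in> wV j" using L2_closed_subspaceD(2)[OF S] wV_iff by blast
  next
    fix f f' assume "f \<in> wV j" "f' \<in> wV j"
    then obtain g g' where g: "g \<in> L2_supp M (wunion j)" "fext (-1) f g" "g' \<in> L2_supp M (wunion j)" "fext (-1) f' g'"
      unfolding wV_def by blast
    show "(\<lambda>x. f x + f' x) \<in> wV j"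
      using wV_iff[OF fext_add[OF g(2,4)]] L2_closed_subspaceD(3)[OF S g(1,3)] by simp
  next
    fix c f assume "f \<in> wV j"
    then obtain g where g: "g \<in> L2_supp M (wunion j)" "fext (-1) f g" unfolding wV_def by blast
    show "(\<lambda>x. c * f x) \<in> wV j"
      using wV_iff[OF fext_scale[OF g(2)]] L2_closed_subspaceD(4)[OF S g(1)] by simp
  next
    fix f assume f: "f \<in> L2_space M" and ap: "\<forall>e>0. \<exists>h\<in>wV j. L2_norm M (\<lambda>x. f x - h x) < e"
    define g where "g = vil_fourier_L2 p M M f"
    have fg: "fext (-1) f g" unfolding g_def by (rule vil_fourier_L2_fext[OF f])
    have "g \<in> L2_supp M (wunion j)"
    proof (rule L2_closed_subspaceD(5)[OF S fext_space(2)[OF fg]])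
      fix e :: real assume "e > 0"
      then obtain h where h: "h \<in> wV j" "L2_norm M (\<lambda>x. f x - h x) < e" using ap by blast
      then obtain k where k: "k \<in> L2_supp M (wunion j)" "fext (-1) h k" unfolding wV_def by blast
      have "L2_norm M (\<lambda>x. g x - k x) < e" using fext_norm[OF fext_diff[OF fg k(2)]] h by simp
      then show "\<exists>k\<in>L2_supp M (wunion j). L2_norm M (\<lambda>x. g x - k x) < e" using k by blast
    qed
    then show "f \<in> wV j" using wV_iff[OF fg] by simp
  qed
qed

lemma wV_mono: "i \<le> j \<Longrightarrow> wV i \<subseteq> wV j"
  unfolding wV_def using L2_supp_mono[OF wunion_mono] by blast

text \<open>Cut the transform down to \<open>wunion (int k)\<close>. The dilates cover almost every
  point, so these cuts converge by dominated convergence.\<close>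

lemma wV_dense:
  assumes f: "f \<in> L2_space M" and e: "e > 0"
  shows "\<exists>h\<in>(\<Union>j. wV j). L2_norm M (\<lambda>x. f x - h x) < e"
proof -
  define g where "g = vil_fourier_L2 p M M f"
  have fg: "fext (-1) f g" unfolding g_def by (rule vil_fourier_L2_fext[OF f])
  have gL: "g \<in> L2_space M" using fext_space(2)[OF fg] .
  let ?G = "\<lambda>k w. g w * indicator (wunion (int k)) w"
  have GL: "?G k \<in> L2_space M" for k by (rule L2_restrict[OF gL wunion_sets])
  have "L2_tendsto M ?G g"
  proof (rule L2_dominated_convergence[OF gL GL])
    show "AE w in M. (\<lambda>k. ?G k w) \<longlonglongrightarrow> g w"
      using wset_cover
    proof eventually_elim
      case (elim w)
      then obtain j u where u: "u \<in> {1..p-1}" "w \<in> wset j u" by blast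
      have "?G k w = g w" if "k \<ge> nat (j + 1)" for k
      proof -
        have "j < int k" using that by linarith
        then have "w \<in> wunion (int k)" using wset_wunion[OF u(1)] u(2) by blast
        then show ?thesis by simp
      qed
      then show ?case by (intro tendsto_eventually) (auto simp: eventually_sequentially)
    qed
    show "AE w in M. cmod (?G k w) \<le> 2 * cmod (g w)" for k
      by (rule AE_I2) (auto simp: indicator_def)
  qed
  then have "(\<lambda>k. L2_norm M (\<lambda>w. ?G k w - g w)) \<longlonglongrightarrow> 0" by (simp add: L2_tendsto_def)
  from LIMSEQ_D[OF this e] obtain k where k: "L2_norm M (\<lambda>w. ?G k w - g w) < e" by auto
  define h where "h = vil_inv_fourier_L2 p M M (?G k)"
  have hG: "fext (-1) h (?G k)" unfolding h_def by (rule vil_inv_fourier_L2_fext[OF GL])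
  have "h \<in> wV (int k)" using wV_iff[OF hG] L2_restrict_supp[OF gL wunion_sets] by simp
  moreover have "L2_norm M (\<lambda>x. f x - h x) < e"
    using fext_norm[OF fext_diff[OF fg hG]] k by (simp add: L2_norm_minus_commute[of M g])
  ultimately show ?thesis by blast
qed

text \<open>Almost every point lies in some \<open>wset j u\<close>, which is disjoint from
  \<open>wunion j\<close> up to a null set; a transform supported in every \<open>wunion j\<close>
  therefore vanishes.\<close>

lemma wV_Inter: "(\<Inter>j. wV j) = {f \<in> L2_space M. AE x in M. f x = 0}"
proof (intro set_eqI iffI)
  fix f assume fV: "f \<in> (\<Inter>j. wV j)"
  then have f: "f \<in> L2_space M" using wV_L2 by blast
  define g where "g = vil_fourier_L2 p M M f"
  have fg: "fext (-1) f g" unfolding g_def by (rule vil_fourier_L2_fext[OF f])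
  have "AE w in M. \<forall>j. w \<notin> wunion j \<longrightarrow> g w = 0"
    unfolding AE_all_countable using fV wV_iff[OF fg] by (auto simp: L2_supp_def)
  moreover have "AE w in M. \<forall>k\<in>UNIV \<times> {1..p-1}. w \<notin> wset (fst k) (snd k) \<or> w \<notin> wunion (fst k)"
    unfolding AE_ball_countable[OF countableI_type] by (intro ballI wset_wunion_disjoint) auto
  ultimately have "AE w in M. g w = 0" using wset_cover
  proof eventually_elim
    case (elim w)
    then obtain j u where u: "u \<in> {1..p-1}" "w \<in> wset j u" by blast
    then have "w \<notin> wunion j" using elim(2) by force
    then show ?case using elim(1) by blast
  qed
  then have "L2_norm M g = 0" using L2_norm_eq_0_iff[OF fext_space(2)[OF fg]] by simp
  then have "L2_norm M f = 0" using fext_norm[OF fg] by simp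
  then show "f \<in> {f \<in> L2_space M. AE x in M. f x = 0}" using L2_norm_eq_0_iff[OF f] f by simp
next
  fix f assume "f \<in> {f \<in> L2_space M. AE x in M. f x = 0}"
  then have f: "f \<in> L2_space M" "AE x in M. f x = 0" by auto
  have "f \<in> wV j" for j
    by (rule L2_closed_subspace_cong_AE[OF wV_closed L2_closed_subspaceD(2)[OF wV_closed] L2_spaceD(1)[OF f(1)]])
       (use f(2) in \<open>auto elim!: eventually_mono\<close>)
  then show "f \<in> (\<Inter>j. wV j)" by blast
qed

text \<open>Composition with \<open>rho\<close> is the dilation at scale 1 without its normalizing
  factor p^(1/2).\<close>

lemma rho_comp_fext:
  assumes fg: "fext (-1) f g"
  shows "fext (-1) (\<lambda>x. f (rho x)) (\<lambda>w. complex_of_real (real_of_int p powr (-1/2)) * fdil 1 vil_zero g w)"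
proof -
  have pp: "real_of_int p > 0" using p_pos by simp
  let ?c = "complex_of_real (real_of_int p powr (-1/2))"
  have d: "fext (-1) (\<lambda>x. ?c * vil_dil p 1 vil_zero f x) (\<lambda>w. ?c * fdil 1 vil_zero g w)"
    by (rule fext_scale[OF fext_vil_dil[OF fg vil_zero_in]])
  have eq: "?c * vil_dil p 1 vil_zero f x = f (rho x)" if "x \<in> vil p" for x
  proof -
    have "vil_sub p (rho_pow 1 x) vil_zero = rho x"
      using that rho_pow_in[OF that, of 1] by (simp add: rho_pow_def rho_def)
    then show ?thesis using pp by (simp add: vil_dil_def powr_add[symmetric] flip: of_real_mult mult.assoc)
  qed
  have m: "(\<lambda>x. f (rho x)) \<in> borel_measurable M"
    using L2_spaceD(1)[OF fext_space(1)[OF d]] by (rule measurable_cong[THEN iffD1, rotated]) (rule eq, simp)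
  show ?thesis
  proof (rule fext_cong_AE[OF d m L2_spaceD(1)[OF fext_space(2)[OF d]]])
    show "AE x in M. ?c * vil_dil p 1 vil_zero f x = f (rho x)"
      by (rule AE_I2, rule eq) simp
  qed simp
qed

lemma wV_rho:
  assumes f: "f \<in> L2_space M"
  shows "f \<in> wV j \<longleftrightarrow> (\<lambda>x. f (rho x)) \<in> wV (j + 1)"
proof -
  have pp: "real_of_int p > 0" using p_pos by simp
  let ?c = "complex_of_real (real_of_int p powr (-1/2))"
  have c0: "?c \<noteq> 0" using pp by simp
  define g where "g = vil_fourier_L2 p M M f"
  have fg: "fext (-1) f g" unfolding g_def by (rule vil_fourier_L2_fext[OF f])
  have gL: "g \<in> L2_space M" using fext_space(2)[OF fg] .
  have dL: "fdil 1 vil_zero g \<in> L2_space M" by (rule L2_fdil(1)[OF gL vil_zero_in])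
  have "(\<lambda>x. f (rho x)) \<in> wV (j + 1) \<longleftrightarrow> (\<lambda>w. ?c * fdil 1 vil_zero g w) \<in> L2_supp M (wunion (j + 1))"
    by (rule wV_iff[OF rho_comp_fext[OF fg]])
  also have "\<dots> \<longleftrightarrow> fdil 1 vil_zero g \<in> L2_supp M (wunion (j + 1))"
    using c0 dL L2_scale[OF dL, of ?c] unfolding L2_supp_def by simp
  \<comment> \<open>Dilating by one scale forward or back shifts the index of \<open>wunion\<close>
    by one.\<close>
  also have "\<dots> \<longleftrightarrow> g \<in> L2_supp M (wunion j)"
  proof
    assume "g \<in> L2_supp M (wunion j)"
    from fdil_supp[OF this wunion_sets vil_zero_in, of 1]
    show "fdil 1 vil_zero g \<in> L2_supp M (wunion (j + 1))" by (simp add: rho_pow_wunion add.commute)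
  next
    assume h: "fdil 1 vil_zero g \<in> L2_supp M (wunion (j + 1))"
    from fdil_supp[OF h wunion_sets vil_zero_in, of "-1"]
    show "g \<in> L2_supp M (wunion j)" using fdil_fdil_inverse[of "-1" g] by (simp add: rho_pow_wunion)
  qed
  also have "\<dots> \<longleftrightarrow> f \<in> wV j" by (rule wV_iff[OF fg, symmetric])
  finally show ?thesis by simp
qed

lemma translate_eq_dil: "(\<lambda>x. f (vil_sub p x n)) = vil_dil p 0 n f"
  using p_pos by (simp add: vil_dil_def fun_eq_iff)

lemma wV_dil:
  assumes "f \<in> wV 0" "n \<in> vil_Lambda p"
  shows "vil_dil p 0 n f \<in> wV 0"
proof -
  obtain g where g: "g \<in> L2_supp M (wunion 0)" "fext (-1) f g" using assms(1) by (auto simp: wV_def)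
  have "fdil 0 n g \<in> L2_supp M (wunion 0)"
    using fdil_supp[OF g(1) wunion_sets Lambda_vil[OF assms(2)], of 0] by (simp add: rho_pow_wunion)
  then show ?thesis using wV_iff[OF fext_vil_dil[OF g(2) Lambda_vil[OF assms(2)]]] by simp
qed

lemma wV_translate:
  assumes f: "f \<in> L2_space M"
  shows "f \<in> wV 0 \<longleftrightarrow> (\<forall>n\<in>vil_Lambda p. (\<lambda>x. f (vil_sub p x n)) \<in> wV 0)"
proof
  assume "f \<in> wV 0"
  then show "\<forall>n\<in>vil_Lambda p. (\<lambda>x. f (vil_sub p x n)) \<in> wV 0"
    unfolding translate_eq_dil by (blast intro: wV_dil)
next
  assume "\<forall>n\<in>vil_Lambda p. (\<lambda>x. f (vil_sub p x n)) \<in> wV 0"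
  \<comment> \<open>Translation by \<open>vil_zero\<close> is the identity on the group, though not
    for arbitrary integer sequences, so \<open>f\<close> is recovered up to equality almost
    everywhere.\<close>
  then have "(\<lambda>x. f (vil_sub p x vil_zero)) \<in> wV 0" using zero_Lambda by blast
  then show "f \<in> wV 0"
    by (rule L2_closed_subspace_cong_AE[OF wV_closed _ L2_spaceD(1)[OF f]]) (auto intro!: AE_I2)
qed

text \<open>Wavelets at scale \<open>j\<close> are supported outside \<open>wunion j\<close> on the
  Fourier side. Conversely, a member of \<open>wV (j + 1)\<close> orthogonal to \<open>wV j\<close>
  has vanishing coefficients below scale \<open>j\<close> by orthogonality and above it by support,
  so only scale \<open>j\<close> remains.\<close>

lemma wV_W:
  "L2_onb M (vil_Lambda p \<times> {1..p-1}) (\<lambda>(n, u). vil_dil p j n (\<psi> u)) (mra_W M wV j)"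
  unfolding L2_onb_iff
proof
  let ?K = "vil_Lambda p \<times> {1..p-1}"
  let ?b = "\<lambda>(n, u). vil_dil p j n (\<psi> u)"
  have b: "?b i \<in> L2_space M" if "i \<in> ?K" for i using that dil_psi_L2 by auto
  show "L2_orthonormal M ?K ?b"
    unfolding L2_orthonormal_def
  proof (intro conjI ballI)
    fix i k assume ik: "i \<in> ?K" "k \<in> ?K"
    then obtain n u n' u' where e: "i = (n, u)" "k = (n', u')" "n \<in> vil_Lambda p" "u \<in> {1..p-1}"
      "n' \<in> vil_Lambda p" "u' \<in> {1..p-1}" by auto
    then show "L2_inner M (?b i) (?b k) = (if i = k then 1 else 0)"
      using L2_orthonormal_inner[OF dil_psi_orthonormal, of "(j, n, u)" "(j, n', u')"] by simp
  qed (rule b)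
  show "L2_closed_span M ?K ?b = mra_W M wV j"
  proof
    show "L2_closed_span M ?K ?b \<subseteq> mra_W M wV j"
    proof
      fix f assume f: "f \<in> L2_closed_span M ?K ?b"
      have "L2_closed_span M ?K ?b \<subseteq> wV (j + 1)"
      proof (rule L2_closed_span_minimal[OF wV_closed])
        fix i assume "i \<in> ?K"
        then obtain n u where e: "i = (n, u)" "n \<in> vil_Lambda p" "u \<in> {1..p-1}" by auto
        have "wav j n u \<in> L2_supp M (wunion (j + 1))"
          using L2_supp_mono[OF wset_wunion[OF e(3), of j "j + 1"]] wav_supp[OF e(2,3), of j] by auto
        then show "?b i \<in> wV (j + 1)" using wV_iff[OF dil_psi_fext[OF e(2,3)]] e by simp
      qed
      then have "f \<in> wV (j + 1)" using f by blast
      moreover have "L2_inner M f h = 0" if h: "h \<in> wV j" for h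
      proof -
        obtain k where k: "k \<in> L2_supp M (wunion j)" "fext (-1) h k" using h by (auto simp: wV_def)
        have "L2_inner M h f = 0"
        proof (rule L2_orthogonal_closed_span[OF b wV_L2[OF h] _ f])
          fix i assume "i \<in> ?K"
          then obtain n u where e: "i = (n, u)" "n \<in> vil_Lambda p" "u \<in> {1..p-1}" by auto
          have "L2_inner M h (vil_dil p j n (\<psi> u)) = L2_inner M k (wav j n u)"
            by (rule fext_inner[OF k(2) dil_psi_fext[OF e(2,3)], symmetric]) simp
          also have "\<dots> = 0"
          proof (rule L2_inner_disjoint_supp[OF k(1) wav_supp[OF e(2,3)]])
            show "AE w in M. w \<notin> wunion j \<or> w \<notin> wset j u"
              using wset_wunion_disjoint[OF e(3) order_refl] by eventually_elim blast
          qed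
          finally show "L2_inner M h (?b i) = 0" using e by simp
        qed
        then show ?thesis using L2_inner_cnj[of M f h] by simp
      qed
      ultimately show "f \<in> mra_W M wV j" by (simp add: mra_W_def)
    qed
    show "mra_W M wV j \<subseteq> L2_closed_span M ?K ?b"
    proof
      fix f assume fW: "f \<in> mra_W M wV j"
      then have fV: "f \<in> wV (j + 1)" and orth: "\<And>h. h \<in> wV j \<Longrightarrow> L2_inner M f h = 0"
        by (auto simp: mra_W_def)
      obtain g where g: "g \<in> L2_supp M (wunion (j + 1))" "fext (-1) f g" using fV by (auto simp: wV_def)
      let ?I = "(UNIV :: int set) \<times> vil_Lambda p \<times> {1..p-1}"
      let ?B = "\<lambda>(j, n, u). vil_dil p j n (\<psi> u)"
      have "f \<in> L2_closed_span M ((\<lambda>i. (j, i)) ` ?K) ?B"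
      proof (rule L2_closed_span_subfamily[OF dil_psi_orthonormal])
        show "f \<in> L2_closed_span M ?I ?B" unfolding dil_psi_complete by (rule wV_L2[OF fV])
        fix i assume iI: "i \<in> ?I - (\<lambda>i. (j, i)) ` ?K"
        then obtain k n u where e': "i = (k, n, u)" "n \<in> vil_Lambda p" "u \<in> {1..p-1}" by auto
        have "k \<noteq> j" using iI e' by blast
        with e' have e: "i = (k, n, u)" "n \<in> vil_Lambda p" "u \<in> {1..p-1}" "k \<noteq> j" by auto
        have "L2_inner M f (vil_dil p k n (\<psi> u)) = 0"
        proof (cases "k < j")
          case True
          have "wav k n u \<in> L2_supp M (wunion j)"
            using L2_supp_mono[OF wset_wunion[OF e(3) True]] wav_supp[OF e(2,3), of k] by auto
          then have "vil_dil p k n (\<psi> u) \<in> wV j" using wV_iff[OF dil_psi_fext[OF e(2,3)]] by simp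
          then show ?thesis by (rule orth)
        next
          case False
          then have k: "j + 1 \<le> k" using e(4) by simp
          have "L2_inner M f (vil_dil p k n (\<psi> u)) = L2_inner M g (wav k n u)"
            by (rule fext_inner[OF g(2) dil_psi_fext[OF e(2,3)], symmetric]) simp
          also have "\<dots> = 0"
          proof (rule L2_inner_disjoint_supp[OF g(1) wav_supp[OF e(2,3)]])
            show "AE w in M. w \<notin> wunion (j + 1) \<or> w \<notin> wset k u"
              using wset_wunion_disjoint[OF e(3) k] by eventually_elim blast
          qed
          finally show ?thesis .
        qed
        then show "L2_inner M f (?B i) = 0" by (simp add: e)
      qed auto
      moreover have "L2_closed_span M ((\<lambda>i. (j, i)) ` ?K) ?B = L2_closed_span M ?K (\<lambda>i. ?B (j, i))"
        by (rule L2_closed_span_image) (use b in auto)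
      ultimately show "f \<in> L2_closed_span M ?K ?b" by simp
    qed
  qed
qed

text \<open>The scaling function is the inverse transform of the indicator of the tile; its dilates
  and translates at scale \<open>j\<close> form a basis of \<open>wV j\<close> because
  \<open>wunion j\<close> is the dilated tile.\<close>

lemma associated_if_tile:
  assumes tile: "vil_tile (wunion 0)"
  shows "associated_with_mra p M \<psi>"
proof -
  have iE: "(indicator (wunion 0) :: _ \<Rightarrow> complex) \<in> L2_space M"
    using vil_tile_emeasure[OF tile] by (intro L2_indicator) auto
  define \<phi> where "\<phi> = vil_inv_fourier_L2 p M M (indicator (wunion 0))"
  have phi: "fext (-1) \<phi> (indicator (wunion 0))" unfolding \<phi>_def by (rule vil_inv_fourier_L2_fext[OF iE])
  have dil: "fext (-1) (vil_dil p j n \<phi>) (fdil j n (indicator (wunion 0)))" if "n \<in> vil_Lambda p" for j n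
    by (rule fext_vil_dil[OF phi Lambda_vil[OF that]])
  have onbV: "L2_onb M (vil_Lambda p) (\<lambda>n. vil_dil p j n \<phi>) (wV j)" for j
    unfolding L2_onb_iff
  proof
    have "L2_orthonormal M (vil_Lambda p) (\<lambda>n. vil_dil p j n \<phi>) \<longleftrightarrow>
        L2_orthonormal M (vil_Lambda p) (\<lambda>n. fdil j n (indicator (wunion 0)))"
      by (rule L2_orthonormal_fext[where s="-1"]) (auto intro: dil)
    then show "L2_orthonormal M (vil_Lambda p) (\<lambda>n. vil_dil p j n \<phi>)"
      using fdil_tile_orthonormal[OF tile] by simp
    have iS: "(indicator (wunion 0) :: _ \<Rightarrow> complex) \<in> L2_supp M (wunion 0)" using iE by (simp add: L2_supp_def)
    show "L2_closed_span M (vil_Lambda p) (\<lambda>n. vil_dil p j n \<phi>) = wV j"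
    proof
      show "L2_closed_span M (vil_Lambda p) (\<lambda>n. vil_dil p j n \<phi>) \<subseteq> wV j"
      proof (rule L2_closed_span_minimal[OF wV_closed])
        fix n assume n: "n \<in> vil_Lambda p"
        have "fdil j n (indicator (wunion 0)) \<in> L2_supp M (wunion j)"
          using fdil_supp[OF iS wunion_sets Lambda_vil[OF n], of j] by (simp add: rho_pow_wunion)
        then show "vil_dil p j n \<phi> \<in> wV j" using wV_iff[OF dil[OF n]] by simp
      qed
      show "wV j \<subseteq> L2_closed_span M (vil_Lambda p) (\<lambda>n. vil_dil p j n \<phi>)"
      proof
        fix f assume "f \<in> wV j"
        then obtain g where g: "g \<in> L2_supp M (wunion j)" "fext (-1) f g" by (auto simp: wV_def)
        have "rho_pow j ` wunion 0 = wunion j" by (simp add: rho_pow_wunion)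
        then have "g \<in> L2_closed_span M (vil_Lambda p) (\<lambda>n. fdil j n (indicator (wunion 0)))"
          using fdil_tile_complete[OF tile, of j] g(1) by auto
        moreover have "f \<in> L2_closed_span M (vil_Lambda p) (\<lambda>n. vil_dil p j n \<phi>) \<longleftrightarrow>
            g \<in> L2_closed_span M (vil_Lambda p) (\<lambda>n. fdil j n (indicator (wunion 0)))"
          by (rule L2_closed_span_fext[OF _ g(2)]) (auto intro: dil)
        ultimately show "f \<in> L2_closed_span M (vil_Lambda p) (\<lambda>n. vil_dil p j n \<phi>)" by simp
      qed
    qed
  qed
  have sc: "scaling_function p M wV \<phi>"
    unfolding scaling_function_def translate_eq_dil
    using fext_space(1)[OF phi] L2_onb_imp_riesz_basis[OF onbV] by simp
  have mra: "mra p M wV"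
    unfolding mra_def
  proof (intro conjI allI ballI impI)
    show "wV j \<subseteq> wV (j + 1)" for j by (rule wV_mono) simp
    show "\<exists>\<phi>. scaling_function p M wV \<phi>" using sc by blast
  qed (rule wV_closed wV_dense wV_Inter wV_rho wV_translate; assumption?)+
  show ?thesis unfolding associated_with_mra_def using mra sc onbV wV_W by blast
qed

end

theorem theorem4p3:
  fixes p :: int
    and M N :: "vseq measure"
    and \<Omega> :: "int \<Rightarrow> vseq set"
    and \<psi> :: "int \<Rightarrow> vseq \<Rightarrow> complex"
  assumes "p \<ge> 2"
    and "vil_haar p M"
    and "vil_haar p N"
    and "wavelet_set p M N \<Omega>"
    and "\<forall>u\<in>{1..p-1}. \<psi> u \<in> L2_space M \<and>
           (AE w in N. vil_fourier_L2 p M N (\<psi> u) w = indicator (\<Omega> u) w)"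
  shows "associated_with_mra p M \<psi> \<longleftrightarrow>
    (\<forall>n\<in>vil_Lambda p.
       emeasure N (Omega_Sigma p \<Omega> \<inter> (\<lambda>w. vil_add p w n) ` Omega_Sigma p \<Omega>) =
         (if n = vil_zero then 1 else 0))"
proof -
  interpret vilenkin p M using assms(1,2) by unfold_locales
  interpret N: vilenkin p N using assms(1,3) by unfold_locales
  have NM: "N = M"
    by (rule haar_unique) (simp_all add: sets_M N.sets_M N.emeasure_vball)
  have O1: "\<Omega> u \<in> sets M" and O2: "(indicator (\<Omega> u) :: _ \<Rightarrow> complex) \<in> L2_space M" if "u \<in> {1..p-1}" for u
    using assms(4) that unfolding wavelet_set_def NM by auto
  \<comment> \<open>The hypothesis fixes the chosen transform of \<open>\<psi> u\<close> only almost
    everywhere, which is enough for the relation \<open>fext\<close>.\<close>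
  have psi: "fext (-1) (\<psi> u) (indicator (\<Omega> u))" if u: "u \<in> {1..p-1}" for u
  proof -
    have L: "\<psi> u \<in> L2_space M" and ae: "AE w in M. vil_fourier_L2 p M M (\<psi> u) w = indicator (\<Omega> u) w"
      using assms(5) u unfolding NM by auto
    show ?thesis
      by (rule fext_cong_AE[OF vil_fourier_L2_fext[OF L] L2_spaceD(1)[OF L] L2_spaceD(1)[OF O2[OF u]] _ ae]) simp
  qed
  let ?I = "(UNIV :: int set) \<times> vil_Lambda p \<times> {1..p-1}"
  let ?a = "\<lambda>(j, n, u). vil_dil p j n (vil_inv_fourier_L2 p M M (indicator (\<Omega> u)))"
  let ?b = "\<lambda>(j, n, u). fdil j n (indicator (\<Omega> u))"
  have onb: "L2_onb M ?I ?a (L2_space M)" using assms(4) unfolding wavelet_set_def NM by blast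
  \<comment> \<open>The basis in \<open>wavelet_set\<close> is built from chosen inverse transforms
    rather than from \<open>\<psi>\<close>. Both have the Fourier side \<open>?b\<close>, on which
    the locale states its hypothesis.\<close>
  have ab: "fext (-1) (?a i) (?b i)" if "i \<in> ?I" for i
    using that fext_vil_dil[OF vil_inv_fourier_L2_fext[OF O2] Lambda_vil] by auto
  have "L2_onb M ?I ?b (L2_space M)"
    unfolding L2_onb_iff
  proof
    have "L2_orthonormal M ?I ?a \<longleftrightarrow> L2_orthonormal M ?I ?b"
      by (rule L2_orthonormal_fext[where s="-1"]) (erule ab | simp)+
    then show "L2_orthonormal M ?I ?b" using onb by (simp add: L2_onb_iff)
    show "L2_closed_span M ?I ?b = L2_space M"
    proof
      show "L2_space M \<subseteq> L2_closed_span M ?I ?b"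
      proof
        fix g assume "g \<in> L2_space M"
        then have fg: "fext (-1) (vil_inv_fourier_L2 p M M g) g" by (rule vil_inv_fourier_L2_fext)
        have "vil_inv_fourier_L2 p M M g \<in> L2_closed_span M ?I ?a"
          using onb fext_space(1)[OF fg] by (simp add: L2_onb_iff)
        moreover have "vil_inv_fourier_L2 p M M g \<in> L2_closed_span M ?I ?a \<longleftrightarrow> g \<in> L2_closed_span M ?I ?b"
          by (rule L2_closed_span_fext[OF _ fg]) (erule ab | simp)+
        ultimately show "g \<in> L2_closed_span M ?I ?b" by simp
      qed
    qed (use L2_closed_span_space in blast)
  qed
  then interpret vilenkin_wavelet p M \<Omega> \<psi>
    using O1 O2 psi by unfold_locales auto
  have "associated_with_mra p M \<psi> \<longleftrightarrow> vil_tile (Omega_Sigma p \<Omega>)"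
    unfolding Omega_Sigma_eq using tile_if_associated associated_if_tile by blast
  also have "\<dots> \<longleftrightarrow> (\<forall>n\<in>vil_Lambda p.
       emeasure N (Omega_Sigma p \<Omega> \<inter> (\<lambda>w. vil_add p w n) ` Omega_Sigma p \<Omega>) =
         (if n = vil_zero then 1 else 0))"
    unfolding vil_tile_def NM using wunion_sets[of 0] by (simp add: Omega_Sigma_eq)
  finally show ?thesis .
qed

end
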